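(* Let $K\in\mathcal{L}(Z,U)$ be such that $A+BK$ generates a bounded polynomially stable $C_0$-semigroup $T_{A+BK}(t)$ on $Z$. If there exist $\Pi\in\mathcal{L}(W,Z)$ with $\Pi(D(S))\subset D(A)$ and $\Gamma\in\mathcal{L}(W,U)$ such that the regulator equations $$A\Pi+B\Gamma+P=\Pi S\ \text{ in } D(S),\qquad C\Pi=Q\ \text{ in } W$$ hold, then the control law $u(t)=Kz(t)+(\Gamma-K\Pi)w(t)$ solves the state feedback regulation problem (SFRP).
   Context: Setting. $Z,U,Y,W$ are complex Banach spaces. The plant is $\dot z(t)=Az(t)+Bu(t)+\mathcal{U}_d(t)$, $y(t)=Cz(t)$, $t\ge 0$, $z(0)=z_0\in Z$, where $A$ generates a $C_0$-semigroup $T_A(t)$ on $Z$, $B\in\mathcal{L}(U,Z)$, $C\in\mathcal{L}(Z,Y)$. The exosystem is $\dot w(t)=Sw(t)$, $y_r(t)=Qw(t)$, $\mathcal{U}_d(t)=Pw(t)$, $t\in\mathbb{R}$, $w(0)=w_0\in W$, where $S$ generates an isometric $C_0$-group $T_S(t)$, $t\in\mathbb{R}$, on $W$, $P\in\mathcal{L}(W,Z)$, $Q\in\mathcal{L}(W,Y)$. Solutions are mild solutions. The tracking error is $e(t)=y(t)-y_r(t)=Cz(t)-Qw(t)$. Polynomial stability. A $C_0$-semigroup $T(t)$ on $Z$ with generator $G$ is polynomially stable if there are constants $\alpha,\beta,N>0$ with $\|T(t)G_\mu^{-\alpha}\|\le N t^{-\beta}$ for all $t>0$, where $G_\mu=\mu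 I-G$ and $\mu$ is a fixed real number with $\|T(t)\|\le Me^{(\mu-\varepsilon)t}$ for some $M,\varepsilon>0$ and all $t\ge 0$ (the notion does not depend on $\mu$). It is bounded if $\sup_{t\ge0}\|T(t)\|<\infty$. For a bounded polynomially stable semigroup, $\sigma(G)\subset\{\mathrm{Re}\,\lambda<0\}$ and there are $\alpha,N>0$ with $\|T(t)(-G)^{-\alpha}\|\le N/t$ for all $t>0$, equivalently (with a possibly different $N$) $\|T(t)G^{-1}\|\le N t^{-1/\alpha}$ for all $t>0$. SFRP. A control law $u(t)=Kz(t)+Lw(t)$, with $K\in\mathcal{L}(Z,U)$ and $L\in\mathcal{L}(W,U)$, solves the SFRP if: (i) $A+BK$ generates a bounded polynomially stable $C_0$-semigroup $T_{A+BK}(t)$ on $Z$; (ii) for the extended closed loop system $\dot z(t)=(A+BK)z(t)+(BL+P)w(t)$, $\dot w(t)=Sw(t)$, $t\ge0$, the tracking error $e(t)=Cz(t)-Qw(t)$ tends to $0$ as $t\to\infty$ for all initial conditions $z_0\in Z$, $w_0\in W$, and for all $z_0\in D(A)$, $w_0\in D(S)$ there is $m>0$ (depending on the initial conditions) with $\|e(t)\|_Y\le m\,t^{-1/\alpha}$ for all $t>0$, where $\alpha$ is the exponent above for $G=A+BK$. *)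

theory Defs
  imports "HOL-Analysis.Analysis"
begin

text \<open>Complex Banach spaces, operators and semigroups. The complex structure extends the real
  Banach space structure of the library, so its norm, limits and integrals apply unchanged.\<close>

class complex_banach = banach +
  fixes scaleC :: "complex \<Rightarrow> 'a \<Rightarrow> 'a"  (infixr "*\<^sub>C" 75)
  assumes scaleC_add_right: "c *\<^sub>C (x + y) = c *\<^sub>C x + c *\<^sub>C y"
    and scaleC_add_left: "(c + d) *\<^sub>C x = c *\<^sub>C x + d *\<^sub>C x"
    and scaleC_scaleC: "c *\<^sub>C (d *\<^sub>C x) = (c * d) *\<^sub>C x"
    and scaleC_of_real: "complex_of_real r *\<^sub>C x = r *\<^sub>R x"
    and norm_scaleC: "norm (c *\<^sub>C x) = cmod c * norm x"

instantiation complex :: complex_banach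
begin

definition scaleC_complex_def: "c *\<^sub>C x = (c * x :: complex)"

instance
  by standard (auto simp: scaleC_complex_def algebra_simps norm_mult scaleR_conv_of_real)

end

definition bounded_clinear :: "('a::complex_banach \<Rightarrow> 'b::complex_banach) \<Rightarrow> bool" where
  "bounded_clinear f \<longleftrightarrow> bounded_linear f \<and> (\<forall>c x. f (c *\<^sub>C x) = c *\<^sub>C f x)"

text \<open>A semigroup is a function on the reals of which only the values at \<open>t \<ge> 0\<close> matter.\<close>

definition c0_semigroup :: "(real \<Rightarrow> 'a::complex_banach \<Rightarrow> 'a) \<Rightarrow> bool" where
  "c0_semigroup T \<longleftrightarrow>
     (\<forall>t\<ge>0. bounded_clinear (T t)) \<and>
     T 0 = id \<and>
     (\<forall>s\<ge>0. \<forall>t\<ge>0. T (s + t) = T s \<circ> T t) \<and>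
     (\<forall>x. ((\<lambda>t. T t x) \<longlongrightarrow> x) (at_right 0))"

definition c0_group :: "(real \<Rightarrow> 'a::complex_banach \<Rightarrow> 'a) \<Rightarrow> bool" where
  "c0_group T \<longleftrightarrow>
     (\<forall>t. bounded_clinear (T t)) \<and>
     T 0 = id \<and>
     (\<forall>s t. T (s + t) = T s \<circ> T t) \<and>
     (\<forall>x. ((\<lambda>t. T t x) \<longlongrightarrow> x) (at 0))"

definition isometric_group :: "(real \<Rightarrow> 'a::complex_banach \<Rightarrow> 'a) \<Rightarrow> bool" where
  "isometric_group T \<longleftrightarrow> (\<forall>t x. norm (T t x) = norm x)"

text \<open>An unbounded operator is given by its domain \<open>D\<close> and a function \<open>G\<close>, whose values outside
  \<open>D\<close> are irrelevant. The domain of a generator is the exact set on which the difference quotients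
  converge.\<close>

definition generates_semigroup ::
    "'a::complex_banach set \<Rightarrow> ('a \<Rightarrow> 'a) \<Rightarrow> (real \<Rightarrow> 'a \<Rightarrow> 'a) \<Rightarrow> bool" where
  "generates_semigroup D G T \<longleftrightarrow>
     c0_semigroup T \<and>
     D = {x. \<exists>y. ((\<lambda>h. (T h x - x) /\<^sub>R h) \<longlongrightarrow> y) (at_right 0)} \<and>
     (\<forall>x\<in>D. ((\<lambda>h. (T h x - x) /\<^sub>R h) \<longlongrightarrow> G x) (at_right 0))"

definition generates_group ::
    "'a::complex_banach set \<Rightarrow> ('a \<Rightarrow> 'a) \<Rightarrow> (real \<Rightarrow> 'a \<Rightarrow> 'a) \<Rightarrow> bool" where
  "generates_group D G T \<longleftrightarrow>
     c0_group T \<and>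
     D = {x. \<exists>y. ((\<lambda>h. (T h x - x) /\<^sub>R h) \<longlongrightarrow> y) (at 0)} \<and>
     (\<forall>x\<in>D. ((\<lambda>h. (T h x - x) /\<^sub>R h) \<longlongrightarrow> G x) (at 0))"

definition resolvent ::
    "'a::complex_banach set \<Rightarrow> ('a \<Rightarrow> 'a) \<Rightarrow> complex \<Rightarrow> 'a \<Rightarrow> 'a" where
  "resolvent D G l = inv_into D (\<lambda>x. l *\<^sub>C x - G x)"

definition resolvent_set :: "'a::complex_banach set \<Rightarrow> ('a \<Rightarrow> 'a) \<Rightarrow> complex set" where
  "resolvent_set D G =
     {l. bij_betw (\<lambda>x. l *\<^sub>C x - G x) D UNIV \<and> bounded_clinear (resolvent D G l)}"

text \<open>The fractional power \<open>(\<mu>I - G)\<^sup>-\<^sup>\<alpha>\<close>, \<open>\<alpha> > 0\<close>, by the Balakrishnan--Komatsu formula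
  \<open>H\<^sup>-\<^sup>\<alpha> = \<Gamma>(n) / (\<Gamma>(\<alpha>) \<Gamma>(n - \<alpha>)) \<integral>\<^sub>0\<^sup>\<infinity> s\<^sup>n\<^sup>-\<^sup>\<alpha>\<^sup>-\<^sup>1 (sI + H)\<^sup>-\<^sup>n ds\<close> for \<open>H = \<mu>I - G\<close>, whose value is the
  same for every integer \<open>n > \<alpha>\<close>; here \<open>n = \<lfloor>\<alpha>\<rfloor> + 1\<close>. For \<open>\<alpha> < 1\<close> this is Balakrishnan's formula
  \<open>H\<^sup>-\<^sup>\<alpha> = (sin \<pi>\<alpha> / \<pi>) \<integral>\<^sub>0\<^sup>\<infinity> s\<^sup>-\<^sup>\<alpha> (sI + H)\<^sup>-\<^sup>1 ds\<close>, and for an integer \<open>\<alpha>\<close> it is the ordinary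
  power. The integral converges absolutely if \<open>\<mu>\<close> exceeds the growth bound of the semigroup
  generated by \<open>G\<close>, and also if \<open>\<mu> = 0\<close>, the semigroup is bounded and \<open>0\<close> is in the resolvent
  set of \<open>G\<close>.\<close>

definition neg_frac_power ::
    "'a::complex_banach set \<Rightarrow> ('a \<Rightarrow> 'a) \<Rightarrow> real \<Rightarrow> real \<Rightarrow> 'a \<Rightarrow> 'a" where
  "neg_frac_power D G \<mu> \<alpha> x =
     (let n = nat \<lfloor>\<alpha>\<rfloor> + 1 in
      (Gamma (real n) / (Gamma \<alpha> * Gamma (real n - \<alpha>))) *\<^sub>R
      integral {0..} (\<lambda>s. s powr (real n - \<alpha> - 1) *\<^sub>R
        (resolvent D G (complex_of_real (s + \<mu>)) ^^ n) x))"

definition bounded_semigroup :: "(real \<Rightarrow> 'a::complex_banach \<Rightarrow> 'a) \<Rightarrow> bool" where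
  "bounded_semigroup T \<longleftrightarrow> (\<exists>M. \<forall>t\<ge>0. onorm (T t) \<le> M)"

text \<open>The notion does not depend on the choice of \<open>\<mu>\<close>, and every \<open>C\<^sub>0\<close>-semigroup admits some
  \<open>\<mu>\<close> with the growth estimate.\<close>

definition polynomially_stable ::
    "'a::complex_banach set \<Rightarrow> ('a \<Rightarrow> 'a) \<Rightarrow> (real \<Rightarrow> 'a \<Rightarrow> 'a) \<Rightarrow> bool" where
  "polynomially_stable D G T \<longleftrightarrow>
     (\<exists>\<mu>. (\<exists>M>0. \<exists>\<epsilon>>0. \<forall>t\<ge>0. onorm (T t) \<le> M * exp ((\<mu> - \<epsilon>) * t)) \<and>
          (\<exists>\<alpha>>0. \<exists>\<beta>>0. \<exists>N>0. \<forall>t>0.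
             onorm (T t \<circ> neg_frac_power D G \<mu> \<alpha>) \<le> N * t powr (- \<beta>)))"

text \<open>The exponents \<open>\<alpha>\<close> with \<open>\<parallel>T(t)(-G)\<^sup>-\<^sup>\<alpha>\<parallel> \<le> N / t\<close>. The condition on \<open>0\<close> is what makes
  \<open>(-G)\<^sup>-\<^sup>\<alpha>\<close> a bounded operator; it is automatic for bounded polynomially stable semigroups.\<close>

definition decay_exponent ::
    "'a::complex_banach set \<Rightarrow> ('a \<Rightarrow> 'a) \<Rightarrow> (real \<Rightarrow> 'a \<Rightarrow> 'a) \<Rightarrow> real \<Rightarrow> bool" where
  "decay_exponent D G T \<alpha> \<longleftrightarrow>
     \<alpha> > 0 \<and> 0 \<in> resolvent_set D G \<and>
     (\<exists>N>0. \<forall>t>0. onorm (T t \<circ> neg_frac_power D G 0 \<alpha>) \<le> N / t)"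

text \<open>The mild solution of \<open>z'(t) = G z(t) + f(t)\<close>, \<open>z(0) = z0\<close>, where \<open>G\<close> generates \<open>T\<close>.\<close>

definition mild_solution ::
    "(real \<Rightarrow> 'a::complex_banach \<Rightarrow> 'a) \<Rightarrow> (real \<Rightarrow> 'a) \<Rightarrow> 'a \<Rightarrow> real \<Rightarrow> 'a" where
  "mild_solution T f z0 t = T t z0 + integral {0..t} (\<lambda>s. T (t - s) (f s))"

text \<open>The tracking error \<open>C z(t) - Q w(t)\<close> of the extended closed loop system
  \<open>z' = (A + BK) z + (BL + P) w\<close>, \<open>w' = S w\<close>, where \<open>T\<close> is the semigroup generated by \<open>A + BK\<close>
  and \<open>TS\<close> is the group generated by \<open>S\<close>.\<close>

definition tracking_error ::
    "(real \<Rightarrow> 'z::complex_banach \<Rightarrow> 'z) \<Rightarrow> ('u::complex_banach \<Rightarrow> 'z) \<Rightarrow>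
     ('z \<Rightarrow> 'y::complex_banach) \<Rightarrow> (real \<Rightarrow> 'w::complex_banach \<Rightarrow> 'w) \<Rightarrow>
     ('w \<Rightarrow> 'z) \<Rightarrow> ('w \<Rightarrow> 'y) \<Rightarrow> ('w \<Rightarrow> 'u) \<Rightarrow> 'z \<Rightarrow> 'w \<Rightarrow> real \<Rightarrow> 'y" where
  "tracking_error T B C TS P Q L z0 w0 t =
     C (mild_solution T (\<lambda>s. B (L (TS s w0)) + P (TS s w0)) z0 t) - Q (TS t w0)"

text \<open>The control law \<open>u = K z + L w\<close> solves the state feedback regulation problem. The semigroup
  \<open>T\<close> is determined on \<open>t \<ge> 0\<close> by its generator \<open>A + BK\<close>. The exponent of a bounded polynomially
  stable semigroup is not unique: the rate is required for every admissible \<open>\<alpha>\<close>, and one is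
  required to exist.\<close>

definition solves_SFRP ::
    "'z::complex_banach set \<Rightarrow> ('z \<Rightarrow> 'z) \<Rightarrow> ('u::complex_banach \<Rightarrow> 'z) \<Rightarrow>
     ('z \<Rightarrow> 'y::complex_banach) \<Rightarrow>
     'w::complex_banach set \<Rightarrow> (real \<Rightarrow> 'w \<Rightarrow> 'w) \<Rightarrow> ('w \<Rightarrow> 'z) \<Rightarrow> ('w \<Rightarrow> 'y) \<Rightarrow>
     ('z \<Rightarrow> 'u) \<Rightarrow> ('w \<Rightarrow> 'u) \<Rightarrow> bool" where
  "solves_SFRP DA A B C DS TS P Q K L \<longleftrightarrow>
     bounded_clinear K \<and> bounded_clinear L \<and>
     (\<exists>T. generates_semigroup DA (\<lambda>z. A z + B (K z)) T \<and>
          bounded_semigroup T \<and>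
          polynomially_stable DA (\<lambda>z. A z + B (K z)) T \<and>
          (\<forall>z0 w0. (tracking_error T B C TS P Q L z0 w0 \<longlongrightarrow> 0) at_top) \<and>
          (\<exists>\<alpha>. decay_exponent DA (\<lambda>z. A z + B (K z)) T \<alpha>) \<and>
          (\<forall>\<alpha>. decay_exponent DA (\<lambda>z. A z + B (K z)) T \<alpha> \<longrightarrow>
             (\<forall>z0\<in>DA. \<forall>w0\<in>DS. \<exists>m>0. \<forall>t>0.
                norm (tracking_error T B C TS P Q L z0 w0 t) \<le> m * t powr (- 1 / \<alpha>))))"

end

theory Submission
  imports Defs
begin

text \<open>The regulator equations say that, along an orbit \<open>w(t)\<close> of the exosystem that starts in
  \<open>D(S)\<close>, the curve \<open>\<Pi> w(t)\<close> is itself a solution of the closed loop \<open>z' = (A + BK) z + (BL + P) w\<close>.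
  Hence \<open>z(t) - \<Pi> w(t) = T(t) (z\<^sub>0 - \<Pi> w\<^sub>0)\<close>, first for \<open>w\<^sub>0\<close> in \<open>D(S)\<close> and by density for all
  \<open>w\<^sub>0\<close> (\<open>mild_solution_regulator\<close>), and \<open>C \<Pi> = Q\<close> turns the tracking error into
  \<open>C T(t) (z\<^sub>0 - \<Pi> w\<^sub>0)\<close>. What remains concerns only the bounded polynomially stable semigroup \<open>T\<close>
  with generator \<open>G = A + BK\<close>: its orbits tend to zero, it has a decay exponent, and each of its
  decay exponents \<open>\<alpha>\<close> yields the rate \<open>t\<^sup>-\<^sup>1\<^sup>/\<^sup>\<alpha>\<close> on the domain of \<open>G\<close>.

  All three facts follow from one inequality, \<open>moment_inequality\<close>. Let \<open>H = \<mu> - G\<close>, let \<open>R(s)\<close> be the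
  inverse of \<open>s + H\<close>, and let \<open>F(s)\<close> be a constant multiple of \<open>(s + H)\<^sup>-\<^sup>\<alpha>\<close>, given by a
  Balakrishnan integral. Then, for all \<open>w > 0\<close> and all bounded \<open>Y\<close>,
  \<open>\<parallel>Y R(0)\<parallel> \<le> C (w\<^sup>\<alpha> \<parallel>Y R(0) F(0)\<parallel> + \<parallel>Y\<parallel> / w)\<close>. The reason is that \<open>w\<^sup>\<alpha> F(w)\<close> is an approximate
  multiple of the identity, with an error \<open>O(1/w)\<close> after multiplication by \<open>R(0)\<close>, whereas
  \<open>F(w) = F(0) (1 - w R(w))\<^sup>\<alpha>\<close>, where the last factor is a binomial series in the power bounded element
  \<open>w R(w)\<close> and therefore bounded uniformly in \<open>w\<close>. In place of a composition law for
  fractional powers, this rests on the differential equation \<open>F' = -\<alpha> R F\<close>: along it the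
  derivatives of the partial sums of \<open>(1 - (w - v) R(w))\<^sup>\<alpha> F(v)\<close> with respect to \<open>v\<close> telescope.

  With \<open>Y = T(t)\<close>, \<open>\<mu>\<close> beyond the growth bound and \<open>w\<close> a suitable power of \<open>t\<close>, the inequality turns the
  decay of \<open>T(t) H\<^sup>-\<^sup>\<alpha>\<close> into some rate \<open>\<parallel>T(t) R(0)\<parallel> = O(t\<^sup>-\<^sup>g)\<close>. So orbits that start in the domain tend to
  zero, and by density all orbits do. A Neumann series gives \<open>0\<close> in the resolvent set of \<open>G\<close>, and a
  large integer is a decay exponent, because the powers of \<open>G\<^sup>-\<^sup>1\<close> decay correspondingly faster. With
  \<open>\<mu> = 0\<close> and \<open>Y = T(2t)\<close>, the inequality becomes a recursion from \<open>\<parallel>T(t) G\<^sup>-\<^sup>1\<parallel>\<close> to \<open>\<parallel>T(2t) G\<^sup>-\<^sup>1\<parallel>\<close> that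
  preserves exactly the rate \<open>t\<^sup>-\<^sup>1\<^sup>/\<^sup>\<alpha>\<close>, for large and small \<open>\<alpha>\<close> alike.\<close>

section \<open>Integrals over the half line\<close>

text \<open>For the gauge integral, an improper integral over the half line is an integral (Hake's theorem), also
  when it converges only conditionally. This makes the fundamental theorem of calculus available up to
  infinity without a domination hypothesis.\<close>

lemma has_integral_Ici_iff:
  fixes f :: "real \<Rightarrow> 'a::banach"
  assumes int: "\<And>b. b \<ge> 0 \<Longrightarrow> f integrable_on {0..b}"
  shows "(f has_integral i) {0..} \<longleftrightarrow> ((\<lambda>b. integral {0..b} f) \<longlongrightarrow> i) at_top"
proof -
  let ?f = "\<lambda>x. if x \<in> {0..} then f x else 0"
  have eq: "?f integrable_on {a..b} \<and> integral {a..b} ?f = integral {0..b} f" if "a \<le> 0" for a b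
  proof -
    have "((\<lambda>x. if x \<in> {a..b} then ?f x else 0) has_integral integral {0..b} f) UNIV \<longleftrightarrow>
          ((\<lambda>x. if x \<in> {0..b} then f x else 0) has_integral integral {0..b} f) UNIV"
      by (rule has_integral_cong) (use that in auto)
    moreover have "(f has_integral integral {0..b} f) {0..b}"
      using int[of b] by (cases "b \<ge> 0") auto
    ultimately have "(?f has_integral integral {0..b} f) {a..b}"
      by (simp only: has_integral_restrict_UNIV)
    then show ?thesis
      by (auto simp: has_integral_iff)
  qed
  have eq': "?f integrable_on cbox a b" for a b
  proof (cases "a \<le> 0")
    case True
    then show ?thesis using eq[of a b] by simp
  next
    case False
    have "?f integrable_on {0..b}" using eq[of 0 b] by simp
    then show ?thesis
      using False by (simp add: integrable_on_subinterval)
  qed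
  show ?thesis
  proof
    assume "(f has_integral i) {0..}"
    then have *: "\<exists>B>0. \<forall>a b. ball 0 B \<subseteq> cbox a b \<longrightarrow> norm (integral (cbox a b) ?f - i) < e"
      if "e > 0" for e
      using that unfolding has_integral_alt' by blast
    show "((\<lambda>b. integral {0..b} f) \<longlongrightarrow> i) at_top"
    proof (rule tendstoI)
      fix e :: real assume "e > 0"
      from *[OF this] obtain B where B: "B > 0"
        "\<And>a b. ball 0 B \<subseteq> cbox a b \<Longrightarrow> norm (integral (cbox a b) ?f - i) < e" by blast
      have "dist (integral {0..b} f) i < e" if "b \<ge> B" for b
      proof -
        have "ball 0 B \<subseteq> cbox (-b) b" using that by (auto simp: dist_norm)
        from B(2)[OF this] show ?thesis
          using eq[of "-b" b] that \<open>B > 0\<close> by (simp add: dist_norm)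
      qed
      then show "\<forall>\<^sub>F b in at_top. dist (integral {0..b} f) i < e"
        using eventually_at_top_linorder by blast
    qed
  next
    assume lim: "((\<lambda>b. integral {0..b} f) \<longlongrightarrow> i) at_top"
    have "\<exists>B>0. \<forall>a b. ball 0 B \<subseteq> cbox a b \<longrightarrow> norm (integral (cbox a b) ?f - i) < e"
      if "e > 0" for e
    proof -
      from tendstoD[OF lim that] obtain B where
        B: "\<And>b. b \<ge> B \<Longrightarrow> dist (integral {0..b} f) i < e"
        unfolding eventually_at_top_linorder by blast
      have "norm (integral (cbox a b) ?f - i) < e" if sub: "ball 0 (max B 0 + 1) \<subseteq> cbox a b" for a b
      proof -
        have *: "{- (max B 0 + 1) <..< max B 0 + 1} \<subseteq> {a..b}"
          using sub by (simp add: ball_eq_greaterThanLessThan)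
        have "closure {- (max B 0 + 1) <..< max B 0 + 1} \<subseteq> {a..b}"
          by (rule closure_minimal[OF *]) simp
        then have "a \<le> 0" "b \<ge> B" by auto
        with B[of b] eq[of a b] show ?thesis by (simp add: dist_norm)
      qed
      then show ?thesis by (intro exI[of _ "max B 0 + 1"]) auto
    qed
    with eq' show "(f has_integral i) {0..}"
      unfolding has_integral_alt' by blast
  qed
qed

lemma has_integral_Ici_FTC:
  fixes \<Phi> :: "real \<Rightarrow> 'a::banach"
  assumes cont: "continuous_on {0..} \<Phi>"
    and deriv: "\<And>s. s > 0 \<Longrightarrow> (\<Phi> has_vector_derivative \<phi> s) (at s)"
    and lim: "(\<Phi> \<longlongrightarrow> L) at_top"
  shows "(\<phi> has_integral L - \<Phi> 0) {0..}"
proof -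
  have *: "(\<phi> has_integral \<Phi> b - \<Phi> 0) {0..b}" if "b \<ge> 0" for b
    by (rule fundamental_theorem_of_calculus_interior)
       (use that deriv in \<open>auto intro: continuous_on_subset[OF cont]\<close>)
  have "((\<lambda>b. integral {0..b} \<phi>) \<longlongrightarrow> L - \<Phi> 0) at_top"
  proof (rule Lim_transform_eventually)
    show "((\<lambda>b. \<Phi> b - \<Phi> 0) \<longlongrightarrow> L - \<Phi> 0) at_top" by (intro tendsto_intros lim)
    show "\<forall>\<^sub>F b in at_top. \<Phi> b - \<Phi> 0 = integral {0..b} \<phi>"
      using eventually_ge_at_top[of 0] by eventually_elim (use * in \<open>simp add: has_integral_iff\<close>)
  qed
  then show ?thesis
    using * by (subst has_integral_Ici_iff) (auto simp: has_integral_iff)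
qed

lemma continuous_dominated_integrable_Ici:
  fixes f :: "real \<Rightarrow> 'a::banach"
  assumes "continuous_on {0..} f" and "g integrable_on {0..}"
    and "\<And>s. s \<ge> 0 \<Longrightarrow> norm (f s) \<le> g s"
  shows "f integrable_on {0..}"
proof (rule integrable_on_all_intervals_integrable_bound)
  fix a b :: real
  have "(\<lambda>x. if x \<in> {0..} then f x else 0) integrable_on {a..b} \<longleftrightarrow> f integrable_on {0..} \<inter> {a..b}"
    by (rule integrable_restrict_Int)
  also have "{0..} \<inter> {a..b} = {max 0 a..b}" by auto
  also have "f integrable_on {max 0 a..b}"
    by (intro integrable_continuous_interval continuous_on_subset[OF assms(1)]) auto
  finally show "(\<lambda>x. if x \<in> {0..} then f x else 0) integrable_on cbox a b" by simp
qed (use assms in auto)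

lemma integrable_one_plus_powr:
  assumes "a > (0::real)"
  shows "(\<lambda>s. (1 + s) powr (- 1 - a)) integrable_on {0..}"
proof -
  have "((\<lambda>s. (1 + s) powr (- 1 - a)) has_integral 0 - (- ((1 + 0) powr (- a)) / a)) {0..}"
  proof (rule has_integral_Ici_FTC)
    show "continuous_on {0..} (\<lambda>s. - ((1 + s) powr (- a)) / a)"
      using assms by (intro continuous_intros) auto
    show "((\<lambda>s. - ((1 + s) powr (- a)) / a) has_vector_derivative (1 + s) powr (- 1 - a)) (at s)"
      if "s > 0" for s
    proof -
      have "((\<lambda>s. - ((1 + s) powr (- a)) / a) has_real_derivative
          - ((- a) * (1 + s) powr (- a - 1)) / a) (at s)"
        using that assms by (auto intro!: derivative_eq_intros)
      moreover have "- a - 1 = - 1 - a" by simp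
      ultimately show ?thesis
        using assms unfolding has_real_derivative_iff_has_vector_derivative[symmetric] by simp
    qed
    have "((\<lambda>s. (1 + s) powr (- a)) \<longlongrightarrow> 0) at_top"
      by (intro tendsto_neg_powr filterlim_tendsto_add_at_top[OF tendsto_const filterlim_ident])
         (use assms in auto)
    then show "((\<lambda>s. - ((1 + s) powr (- a)) / a) \<longlongrightarrow> 0) at_top"
      using tendsto_divide[OF tendsto_minus tendsto_const, of "\<lambda>s. (1 + s) powr (- a)" 0 at_top a] assms
      by simp
  qed
  then show ?thesis by (auto simp: integrable_on_def)
qed

text \<open>Differentiation under the integral sign, with the dominating function placed in the Taylor remainder:
  then no continuity of the derivative in the parameter and no dominated convergence theorem for
  vector-valued integrals is involved.\<close>

lemma has_vector_derivative_integral_Ici: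
  fixes f :: "real \<Rightarrow> real \<Rightarrow> 'a::banach"
  assumes f: "\<And>v. v \<ge> 0 \<Longrightarrow> f v integrable_on {0..}"
    and f': "f' integrable_on {0..}"
    and g: "g integrable_on {0..}"
    and taylor: "\<And>u s. u \<ge> 0 \<Longrightarrow> s \<ge> 0 \<Longrightarrow>
      norm (f u s - f v s - (u - v) *\<^sub>R f' s) \<le> (u - v)\<^sup>2 * g s"
    and v: "v \<ge> 0"
  shows "((\<lambda>v. integral {0..} (f v)) has_vector_derivative integral {0..} f') (at v within {0..})"
proof -
  let ?F = "\<lambda>v. integral {0..} (f v)"
  have bd: "norm (?F u - ?F v - (u - v) *\<^sub>R integral {0..} f') \<le> (u - v)\<^sup>2 * integral {0..} g"
    if "u \<ge> 0" for u
  proof -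
    have "?F u - ?F v - (u - v) *\<^sub>R integral {0..} f'
        = integral {0..} (\<lambda>s. f u s - f v s - (u - v) *\<^sub>R f' s)"
      using that v f f' by (simp add: integral_diff integrable_diff integrable_cmul)
    also have "norm \<dots> \<le> integral {0..} (\<lambda>s. (u - v)\<^sup>2 * g s)"
      using that v f f' g taylor
      by (intro integral_norm_bound_integral integrable_diff integrable_cmul)
         (auto intro: integrable_cmul[of g _ "(u - v)\<^sup>2", simplified])
    finally show ?thesis by simp
  qed
  show ?thesis
    unfolding has_vector_derivative_def
  proof (rule has_derivativeI_sandwich[where e=1])
    show "norm (?F u - ?F v - (u - v) *\<^sub>R integral {0..} f') / norm (u - v)
        \<le> \<bar>u - v\<bar> * integral {0..} g" if "u \<in> {0..}" "u \<noteq> v" for u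
      proof -
      have eq: "(u - v)\<^sup>2 * integral {0..} g = \<bar>u - v\<bar> * integral {0..} g * norm (u - v)"
      proof -
        have "(u - v)\<^sup>2 = \<bar>u - v\<bar> * \<bar>u - v\<bar>" by (simp add: power2_eq_square)
        then show ?thesis by (simp only: real_norm_def mult_ac)
      qed
      have "u \<ge> 0" using that by simp
      from bd[OF this, unfolded eq] have "norm (?F u - ?F v - (u - v) *\<^sub>R integral {0..} f')
          \<le> \<bar>u - v\<bar> * integral {0..} g * norm (u - v)" .
      then show ?thesis
        by (subst pos_divide_le_eq) (use that in auto)
    qed
    have "((\<lambda>u. \<bar>u - v\<bar> * integral {0..} g) \<longlongrightarrow> \<bar>v - v\<bar> * integral {0..} g) (at v within {0..})"
      by (intro tendsto_intros)
    then show "((\<lambda>u. \<bar>u - v\<bar> * integral {0..} g) \<longlongrightarrow> 0) (at v within {0..})" by simp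
  qed (auto intro: bounded_linear_scaleR_left)
qed

lemma has_vector_derivative_iff_quotient:
  "(f has_vector_derivative d) (at x within S) \<longleftrightarrow>
   ((\<lambda>y. (f y - f x) /\<^sub>R (y - x)) \<longlongrightarrow> d) (at x within S)"
proof -
  have eq: "norm (f y - f x - (y - x) *\<^sub>R d) / norm (y - x) = norm ((f y - f x) /\<^sub>R (y - x) - d)"
    if "y \<noteq> x" for y
  proof -
    have "(f y - f x) /\<^sub>R (y - x) - d = (f y - f x - (y - x) *\<^sub>R d) /\<^sub>R (y - x)"
      using that by (simp add: scaleR_diff_right)
    then show ?thesis by (simp add: divide_inverse mult.commute)
  qed
  have "(f has_vector_derivative d) (at x within S) \<longleftrightarrow>
      ((\<lambda>y. norm (f y - f x - (y - x) *\<^sub>R d) / norm (y - x)) \<longlongrightarrow> 0) (at x within S)"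
    by (auto simp: has_vector_derivative_def has_derivative_iff_norm bounded_linear_scaleR_left)
  also have "\<dots> \<longleftrightarrow> ((\<lambda>y. norm ((f y - f x) /\<^sub>R (y - x) - d)) \<longlongrightarrow> 0) (at x within S)"
    by (rule filterlim_cong) (use eq in \<open>auto simp: eventually_at_filter\<close>)
  also have "\<dots> \<longleftrightarrow> ((\<lambda>y. (f y - f x) /\<^sub>R (y - x)) \<longlongrightarrow> d) (at x within S)"
    by (simp add: tendsto_norm_zero_iff LIM_zero_iff)
  finally show ?thesis .
qed

section \<open>The binomial series\<close>

text \<open>The coefficients of \<open>(1 - x)\<^sup>a\<close>; for \<open>a > 0\<close> the series converges absolutely also on the boundary
  of the unit disc, which is what makes \<open>(1 - X)\<^sup>a\<close> bounded for a merely power bounded \<open>X\<close>.\<close>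

definition binom_coeff :: "real \<Rightarrow> nat \<Rightarrow> real" where
  "binom_coeff a k = (- 1) ^ k * (a gchoose k)"

lemma binom_coeff_0 [simp]: "binom_coeff a 0 = 1"
  by (simp add: binom_coeff_def)

lemma binom_coeff_Suc: "real (Suc k) * binom_coeff a (Suc k) = (real k - a) * binom_coeff a k"
proof -
  have "(a - real k) * (a gchoose k) = real (Suc k) * (a gchoose Suc k)"
    using gbinomial_mult_1[of a k] by (simp add: algebra_simps)
  then have "(- 1) ^ k * (real (Suc k) * (a gchoose Suc k)) = (- 1) ^ k * ((a - real k) * (a gchoose k))"
    by simp
  then show ?thesis
    by (simp add: binom_coeff_def algebra_simps)
qed

text \<open>Beyond \<open>k = a\<close> the coefficients have constant sign, and their recurrence says that
  \<open>a \<bar>b\<^sub>k\<bar> = k \<bar>b\<^sub>k\<bar> - (k + 1) \<bar>b\<^sub>k\<^sub>+\<^sub>1\<bar>\<close>, so that the tail of the series telescopes.\<close>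

lemma sum_binom_coeff:
  assumes "real m > a"
  shows "a * (\<Sum>k=m..<m + l. \<bar>binom_coeff a k\<bar>) + real (m + l) * \<bar>binom_coeff a (m + l)\<bar>
       = real m * \<bar>binom_coeff a m\<bar>"
proof (induction l)
  case (Suc l)
  have "\<bar>real (Suc (m + l)) * binom_coeff a (Suc (m + l))\<bar> = (real (m + l) - a) * \<bar>binom_coeff a (m + l)\<bar>"
    using assms by (subst binom_coeff_Suc) (simp add: abs_mult)
  then have "real (Suc (m + l)) * \<bar>binom_coeff a (Suc (m + l))\<bar> = (real (m + l) - a) * \<bar>binom_coeff a (m + l)\<bar>"
    by (simp only: abs_mult abs_of_nat)
  with Suc show ?case by (simp add: algebra_simps)
qed simp

lemma binom_coeff_bounds:
  assumes "a > 0"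
  obtains C where "\<And>N. (\<Sum>k\<le>N. \<bar>binom_coeff a k\<bar>) \<le> C" and "\<And>N. real N * \<bar>binom_coeff a N\<bar> \<le> C"
proof -
  obtain m :: nat where m: "real m > a" using reals_Archimedean2 by blast
  let ?K = "real m * \<bar>binom_coeff a m\<bar>"
  let ?C1 = "(\<Sum>k<m. \<bar>binom_coeff a k\<bar>) + ?K / a"
  let ?C2 = "(\<Sum>k<m. real k * \<bar>binom_coeff a k\<bar>) + ?K"
  have 1: "(\<Sum>k\<le>N. \<bar>binom_coeff a k\<bar>) \<le> ?C1" for N
  proof -
    have "(\<Sum>k\<le>N. \<bar>binom_coeff a k\<bar>) \<le> (\<Sum>k\<in>{..<m} \<union> {m..<m + N + 1}. \<bar>binom_coeff a k\<bar>)"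
      by (rule sum_mono2) auto
    also have "\<dots> = (\<Sum>k<m. \<bar>binom_coeff a k\<bar>) + (\<Sum>k=m..<m + (N + 1). \<bar>binom_coeff a k\<bar>)"
      by (subst sum.union_disjoint) (auto simp: add.assoc)
    also have "(\<Sum>k=m..<m + (N + 1). \<bar>binom_coeff a k\<bar>) \<le> ?K / a"
      using sum_binom_coeff[OF m, of "N + 1"] assms
      by (simp add: field_simps) (smt (verit) abs_ge_zero mult_nonneg_nonneg of_nat_0_le_iff)
    finally show ?thesis by simp
  qed
  have 2: "real N * \<bar>binom_coeff a N\<bar> \<le> ?C2" for N
  proof (cases "N < m")
    case True
    then have "real N * \<bar>binom_coeff a N\<bar> \<le> (\<Sum>k<m. real k * \<bar>binom_coeff a k\<bar>)"
      by (intro member_le_sum) auto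
    moreover have "?K \<ge> 0" by simp
    ultimately show ?thesis by linarith
  next
    case False
    then obtain l where "N = m + l" using le_Suc_ex not_less by blast
    then have "real N * \<bar>binom_coeff a N\<bar> \<le> ?K"
      using sum_binom_coeff[OF m, of l] assms
      by (smt (verit) abs_ge_zero mult_nonneg_nonneg sum_nonneg)
    moreover have "(\<Sum>k<m. real k * \<bar>binom_coeff a k\<bar>) \<ge> 0" by (intro sum_nonneg) auto
    ultimately show ?thesis by linarith
  qed
  show ?thesis
    by (rule that[of "max ?C1 ?C2"]) (use 1 2 in \<open>auto simp: le_max_iff_disj\<close>)
qed

section \<open>Resolvent families in a Banach algebra\<close>

text \<open>The model is \<open>R(s) = (s + H)\<^sup>-\<^sup>1\<close> for an invertible \<open>H\<close> such that \<open>-H\<close> generates a semigroup bounded by \<open>M\<close>;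
  the power bound is then the Hille--Yosida estimate. At \<open>s = 0\<close> only the resolvent equation is
  assumed, so that \<open>H\<close> may be the negative of a generator with \<open>0\<close> in its resolvent set. The algebra is a
  monoid instead of a ring with \<open>1 \<noteq> 0\<close> because the operators on the zero space are to be an instance.\<close>

locale resolvent_family =
  fixes R :: "real \<Rightarrow> 'b::{banach, real_normed_algebra, monoid_mult}" and M :: real
  assumes resolvent_eq: "\<And>s t. s \<ge> 0 \<Longrightarrow> t \<ge> 0 \<Longrightarrow> R s - R t = (t - s) *\<^sub>R (R s * R t)"
    and power_bound: "\<And>s k. s > 0 \<Longrightarrow> norm (R s ^ k) \<le> M / s ^ k"
begin

lemma M_nonneg: "M \<ge> 0"
  using power_bound[of 1 0] norm_ge_zero[of "R 1 ^ 0"] by (simp del: norm_ge_zero)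

lemma commute: "s \<ge> 0 \<Longrightarrow> t \<ge> 0 \<Longrightarrow> R s * R t = R t * R s"
proof (cases "s = t")
  case False
  assume "s \<ge> 0" "t \<ge> 0"
  then have "(t - s) *\<^sub>R (R s * R t) = - ((s - t) *\<^sub>R (R t * R s))"
    by (simp only: resolvent_eq[symmetric]) simp
  also have "\<dots> = (t - s) *\<^sub>R (R t * R s)"
    by (simp add: algebra_simps)
  finally show ?thesis using False by simp
qed simp

lemma commute_power: "s \<ge> 0 \<Longrightarrow> t \<ge> 0 \<Longrightarrow> R s ^ k * R t = R t * R s ^ k"
  by (simp add: commute power_commuting_commutes)

lemma tendsto_R:
  assumes t: "t \<ge> 0"
  shows "(R \<longlongrightarrow> R t) (at t within {0..})"
proof -
  have "norm (R s - R t) \<le> \<bar>s - t\<bar> * (2 * norm (R t) * norm (R t))"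
    if s: "s \<ge> 0" and st: "\<bar>s - t\<bar> * norm (R t) \<le> 1 / 2" for s
  proof -
    have d: "norm (R s - R t) \<le> \<bar>s - t\<bar> * (norm (R s) * norm (R t))"
      unfolding resolvent_eq[OF s t] norm_scaleR real_norm_def abs_minus_commute[of s t]
      by (intro mult_left_mono norm_mult_ineq) auto
    have "norm (R s) \<le> norm (R t) + norm (R s - R t)"
      using norm_triangle_sub[of "R s" "R t"] by simp
    also have "\<dots> \<le> norm (R t) + (\<bar>s - t\<bar> * norm (R t)) * norm (R s)"
      using d by (simp add: mult_ac)
    also have "\<dots> \<le> norm (R t) + 1 / 2 * norm (R s)"
      using st by (intro add_left_mono mult_right_mono) auto
    finally have "norm (R s) \<le> 2 * norm (R t)" by simp
    then show ?thesis
      by (intro order_trans[OF d] mult_left_mono mult_right_mono) auto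
  qed
  moreover have "\<forall>\<^sub>F s in at t within {0..}. \<bar>s - t\<bar> * norm (R t) < 1 / 2"
  proof (rule order_tendstoD)
    show "((\<lambda>s. \<bar>s - t\<bar> * norm (R t)) \<longlongrightarrow> \<bar>t - t\<bar> * norm (R t)) (at t within {0..})"
      by (intro tendsto_intros)
  qed simp
  ultimately have ev: "\<forall>\<^sub>F s in at t within {0..}.
      norm (R s - R t) \<le> \<bar>s - t\<bar> * (2 * norm (R t) * norm (R t))"
    by (auto simp: eventually_at_filter elim!: eventually_mono)
  have lim: "((\<lambda>s. \<bar>s - t\<bar> * (2 * norm (R t) * norm (R t))) \<longlongrightarrow>
      \<bar>t - t\<bar> * (2 * norm (R t) * norm (R t))) (at t within {0..})"
    by (intro tendsto_intros)
  have "((\<lambda>s. R s - R t) \<longlongrightarrow> 0) (at t within {0..})"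
    by (rule Lim_null_comparison[OF ev]) (use lim in simp)
  then show ?thesis by (simp add: LIM_zero_iff)
qed

lemma continuous_R: "continuous_on {0..} R"
  using tendsto_R by (auto simp: continuous_on_def)

lemma deriv_R:
  assumes t: "t \<ge> 0"
  shows "(R has_vector_derivative - (R t)\<^sup>2) (at t within {0..})"
proof -
  have "((\<lambda>s. - (R s * R t)) \<longlongrightarrow> - (R t)\<^sup>2) (at t within {0..})"
    unfolding power2_eq_square by (intro tendsto_intros tendsto_R t)
  moreover have "(R s - R t) /\<^sub>R (s - t) = - (R s * R t)" if "s \<ge> 0" "s \<noteq> t" for s
  proof -
    have "(R s - R t) /\<^sub>R (s - t) = (inverse (s - t) * (t - s)) *\<^sub>R (R s * R t)"
      using resolvent_eq[OF that(1) t] by simp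
    also have "inverse (s - t) * (t - s) = -1" using that by (simp add: field_simps)
    finally show ?thesis by simp
  qed
  then have "\<forall>\<^sub>F s in at t within {0..}. - (R s * R t) = (R s - R t) /\<^sub>R (s - t)"
    by (auto simp: eventually_at_filter)
  ultimately show ?thesis
    unfolding has_vector_derivative_iff_quotient by (rule Lim_transform_eventually)
qed

lemma deriv_power:
  assumes t: "t \<ge> 0"
  shows "((\<lambda>s. R s ^ k) has_vector_derivative - (real k *\<^sub>R R t ^ Suc k)) (at t within {0..})"
proof (induction k)
  case (Suc k)
  have "((\<lambda>s. R s * R s ^ k) has_vector_derivative
      R t * - (real k *\<^sub>R R t ^ Suc k) + - (R t)\<^sup>2 * R t ^ k) (at t within {0..})"
    by (intro has_vector_derivative_mult deriv_R[OF t] Suc.IH)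
  then show ?case
    by (simp add: algebra_simps power2_eq_square)
qed simp

lemma deriv_power_shift:
  assumes "w \<ge> 0" "t \<ge> 0"
  shows "((\<lambda>s. R (s + w) ^ k) has_vector_derivative - (real k *\<^sub>R R (t + w) ^ Suc k)) (at t within {0..})"
proof -
  have "((\<lambda>s. R s ^ k) \<circ> (\<lambda>s. s + w) has_vector_derivative 1 *\<^sub>R - (real k *\<^sub>R R (t + w) ^ Suc k)) (at t within {0..})"
  proof (rule vector_diff_chain_within)
    show "((\<lambda>s. s + w) has_vector_derivative 1) (at t within {0..})"
      by (auto intro!: derivative_eq_intros)
    show "((\<lambda>s. R s ^ k) has_vector_derivative - (real k *\<^sub>R R (t + w) ^ Suc k)) (at (t + w) within (\<lambda>s. s + w) ` {0..})"
      by (rule has_vector_derivative_within_subset[OF deriv_power]) (use assms in auto)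
  qed
  then show ?thesis by (simp add: o_def)
qed

lemma continuous_power_shift: "w \<ge> 0 \<Longrightarrow> continuous_on {0..} (\<lambda>s. R (s + w) ^ k)"
  using deriv_power_shift by (intro continuous_on_vector_derivative) auto

lemma deriv_power_at:
  assumes "s > 0"
  shows "((\<lambda>s. R s ^ k) has_vector_derivative - (real k *\<^sub>R R s ^ Suc k)) (at s)"
proof -
  have "at s within {0..} = at s"
    by (rule at_within_interior) (use assms in auto)
  then show ?thesis using deriv_power[of s k] assms by simp
qed

lemma continuous_power: "continuous_on {0..} (\<lambda>s. R s ^ k)"
  using continuous_power_shift[of 0 k] by simp

text \<open>Away from \<open>0\<close> the power bound applies, and near \<open>0\<close> continuity does.\<close>

lemma power_decay:
  obtains C where "C \<ge> 0" and "\<And>s. s \<ge> 0 \<Longrightarrow> norm (R s ^ k) \<le> C / (1 + s) ^ k"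
proof -
  have "compact ((\<lambda>s. R s ^ k) ` {0..1})"
    by (intro compact_continuous_image continuous_on_subset[OF continuous_power]) auto
  then obtain B where B: "\<And>s. s \<in> {0..1} \<Longrightarrow> norm (R s ^ k) \<le> B"
    using compact_imp_bounded bounded_iff by (metis (no_types, lifting) image_eqI)
  have B0: "B \<ge> 0" using B[of 0] norm_ge_zero[of "R 0 ^ k"] by (simp del: norm_ge_zero)
  note M0 = M_nonneg
  have "norm (R s ^ k) \<le> (max B M * 2 ^ k) / (1 + s) ^ k" if s: "s \<ge> 0" for s
  proof (cases "s \<le> 1")
    case True
    have "norm (R s ^ k) * (1 + s) ^ k \<le> max B M * 2 ^ k"
      by (intro mult_mono power_mono) (use True s B[of s] B0 in auto)
    then show ?thesis using s by (simp add: field_simps)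
  next
    case False
    have "norm (R s ^ k) * (1 + s) ^ k \<le> M / s ^ k * (2 * s) ^ k"
      by (intro mult_mono power_mono power_bound) (use False M0 in auto)
    also have "\<dots> = M * 2 ^ k" using False by (simp add: power_mult_distrib)
    also have "\<dots> \<le> max B M * 2 ^ k" by (intro mult_right_mono) auto
    finally show ?thesis using s by (simp add: field_simps)
  qed
  moreover have "max B M * 2 ^ k \<ge> 0" using B0 by (intro mult_nonneg_nonneg) auto
  ultimately show ?thesis using that by blast
qed

lemma weighted_power_tendsto_0:
  assumes "p < real k"
  shows "((\<lambda>s. s powr p *\<^sub>R R s ^ k) \<longlongrightarrow> 0) at_top"
proof -
  have "norm (s powr p *\<^sub>R R s ^ k) \<le> M * s powr (p - real k)" if "s \<ge> 1" for s
  proof -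
    have "s powr p * norm (R s ^ k) \<le> s powr p * (M / s ^ k)"
      by (intro mult_left_mono power_bound) (use that in auto)
    also have "\<dots> = M * s powr (p - real k)"
      using that by (simp add: powr_diff powr_realpow)
    finally show ?thesis by simp
  qed
  then have ev: "\<forall>\<^sub>F s in at_top. norm (s powr p *\<^sub>R R s ^ k) \<le> M * s powr (p - real k)"
    using eventually_at_top_linorder by blast
  have "((\<lambda>s. M * s powr (p - real k)) \<longlongrightarrow> M * 0) at_top"
    by (intro tendsto_mult tendsto_const tendsto_neg_powr filterlim_ident) (use assms in auto)
  then show ?thesis
    by (intro Lim_null_comparison[OF ev]) simp
qed

text \<open>An integer power \<open>H\<^sup>-\<^sup>m\<close> is recovered from the Balakrishnan integral by integrating \<open>R' = -R\<^sup>2\<close>.\<close>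

lemma has_integral_power:
  assumes "m > 0"
  shows "((\<lambda>s. R s ^ Suc m) has_integral (1 / real m) *\<^sub>R R 0 ^ m) {0..}"
proof -
  let ?\<Phi> = "\<lambda>s. - ((1 / real m) *\<^sub>R R s ^ m)"
  have "((\<lambda>s. R s ^ Suc m) has_integral - ((1 / real m) *\<^sub>R 0) - ?\<Phi> 0) {0..}"
  proof (rule has_integral_Ici_FTC)
    show "continuous_on {0..} ?\<Phi>"
      by (intro continuous_on_minus continuous_on_scaleR continuous_on_const continuous_power)
    show "(?\<Phi> has_vector_derivative R s ^ Suc m) (at s)" if "s > 0" for s
    proof -
      have "(?\<Phi> has_vector_derivative - ((1 / real m) *\<^sub>R - (real m *\<^sub>R R s ^ Suc m))) (at s)"
        by (intro has_vector_derivative_minus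
            bounded_linear.has_vector_derivative[OF bounded_linear_scaleR_right] deriv_power_at that)
      then show ?thesis using assms by simp
    qed
    have "((\<lambda>s. s powr 0 *\<^sub>R R s ^ m) \<longlongrightarrow> 0) at_top"
      by (rule weighted_power_tendsto_0) (use assms in simp)
    moreover have "\<forall>\<^sub>F s in at_top. s powr 0 *\<^sub>R R s ^ m = R s ^ m"
      using eventually_gt_at_top[of 0] by eventually_elim simp
    ultimately have "((\<lambda>s. R s ^ m) \<longlongrightarrow> 0) at_top"
      by (rule Lim_transform_eventually)
    then show "(?\<Phi> \<longlongrightarrow> - ((1 / real m) *\<^sub>R 0)) at_top"
      by (intro tendsto_intros)
  qed
  then show ?thesis by simp
qed

end

section \<open>Fractional powers as weighted integrals of resolvent powers\<close>

text \<open>The Balakrishnan integral of \<open>(w + H)\<^sup>-\<^sup>a\<close> with resolvent exponent \<open>N\<close>, without its normalising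
  constant. The condition \<open>N > a + 1\<close>, one more than convergence requires, makes the weight continuous
  at \<open>0\<close>; \<open>has_integral_lower_weight\<close> passes to this \<open>N\<close> by integration by parts.\<close>

locale weighted_resolvent_family = resolvent_family +
  fixes a :: real and N :: nat
  assumes a_pos: "a > 0" and N_gt: "real N > a + 1"
begin

definition weight :: "real \<Rightarrow> real" where
  "weight s = s powr (real N - a - 1)"

definition frac :: "real \<Rightarrow> 'a" where
  "frac w = integral {0..} (\<lambda>s. weight s *\<^sub>R R (s + w) ^ N)"

lemma weight_nonneg [simp]: "weight s \<ge> 0"
  by (simp add: weight_def)

lemma continuous_weight: "continuous_on {0..} weight"
  unfolding weight_def using N_gt
  by (intro continuous_on_powr' continuous_on_id continuous_on_const) auto

lemma weight_div_power_le:
  assumes "s \<ge> 0"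
  shows "weight s / (1 + s) ^ N \<le> (1 + s) powr (- 1 - a)"
proof -
  have "weight s / (1 + s) ^ N \<le> (1 + s) powr (real N - a - 1) / (1 + s) ^ N"
    unfolding weight_def using assms N_gt by (intro divide_right_mono powr_mono2) auto
  also have "\<dots> = (1 + s) powr (real N - a - 1) / (1 + s) powr real N"
    using assms by (simp add: powr_realpow)
  also have "\<dots> = (1 + s) powr (real N - a - 1 - real N)"
    by (rule powr_diff[symmetric])
  also have "real N - a - 1 - real N = - 1 - a" by simp
  finally show ?thesis .
qed

lemma weighted_power_decay:
  assumes "k \<ge> N"
  obtains C where "C \<ge> 0" and "\<And>s w. s \<ge> 0 \<Longrightarrow> w \<ge> 0 \<Longrightarrow>
      norm (weight s *\<^sub>R R (s + w) ^ k) \<le> C * (1 + s) powr (- 1 - a)"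
proof -
  obtain C where C: "C \<ge> 0" "\<And>s. s \<ge> 0 \<Longrightarrow> norm (R s ^ k) \<le> C / (1 + s) ^ k"
    using power_decay by blast
  have "norm (weight s *\<^sub>R R (s + w) ^ k) \<le> C * (1 + s) powr (- 1 - a)" if "s \<ge> 0" "w \<ge> 0" for s w
  proof -
    have "norm (R (s + w) ^ k) \<le> C / (1 + (s + w)) ^ k"
      using C(2)[of "s + w"] that by simp
    also have "\<dots> \<le> C / (1 + s) ^ N"
    proof (intro divide_left_mono C mult_pos_pos)
      have "(1 + s) ^ N \<le> (1 + s) ^ k" using that assms by (intro power_increasing) auto
      also have "\<dots> \<le> (1 + (s + w)) ^ k" using that by (intro power_mono) auto
      finally show "(1 + s) ^ N \<le> (1 + (s + w)) ^ k" .
    qed (use that in auto)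
    finally have "norm (weight s *\<^sub>R R (s + w) ^ k) \<le> weight s * (C / (1 + s) ^ N)"
      unfolding norm_scaleR by (simp add: mult_left_mono del: times_divide_eq_right)
    also have "\<dots> = C * (weight s / (1 + s) ^ N)" by simp
    also have "\<dots> \<le> C * (1 + s) powr (- 1 - a)"
      by (intro mult_left_mono weight_div_power_le C that)
    finally show ?thesis .
  qed
  with C(1) show ?thesis by (rule that)
qed

lemma weighted_integrable:
  assumes "k \<ge> N" "w \<ge> 0"
  shows "(\<lambda>s. weight s *\<^sub>R R (s + w) ^ k) integrable_on {0..}"
proof -
  obtain C where C: "\<And>s w. s \<ge> 0 \<Longrightarrow> w \<ge> 0 \<Longrightarrow>
      norm (weight s *\<^sub>R R (s + w) ^ k) \<le> C * (1 + s) powr (- 1 - a)"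
    using weighted_power_decay assms by blast
  show ?thesis
  proof (rule continuous_dominated_integrable_Ici)
    show "continuous_on {0..} (\<lambda>s. weight s *\<^sub>R R (s + w) ^ k)"
      by (intro continuous_intros continuous_weight continuous_power_shift assms)
    show "(\<lambda>s. C * (1 + s) powr (- 1 - a)) integrable_on {0..}"
      using integrable_cmul[OF integrable_one_plus_powr[OF a_pos], of C] by simp
  qed (use C assms in auto)
qed

lemma frac_commute:
  assumes "w \<ge> 0" "t \<ge> 0"
  shows "R t * frac w = integral {0..} (\<lambda>s. weight s *\<^sub>R (R t * R (s + w) ^ N))"
    and "frac w * R t = R t * frac w"
proof -
  note int = weighted_integrable[OF order_refl assms(1)]
  have "integral {0..} ((\<lambda>x. R t * x) \<circ> (\<lambda>s. weight s *\<^sub>R R (s + w) ^ N)) = R t * frac w"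
    unfolding frac_def by (rule integral_linear[OF int bounded_linear_mult_right])
  then show 1: "R t * frac w = integral {0..} (\<lambda>s. weight s *\<^sub>R (R t * R (s + w) ^ N))"
    by (simp add: o_def)
  have "integral {0..} ((\<lambda>x. x * R t) \<circ> (\<lambda>s. weight s *\<^sub>R R (s + w) ^ N)) = frac w * R t"
    unfolding frac_def by (rule integral_linear[OF int bounded_linear_mult_left])
  then have "frac w * R t = integral {0..} (\<lambda>s. weight s *\<^sub>R (R (s + w) ^ N * R t))"
    by (simp add: o_def)
  also have "\<dots> = R t * frac w"
    unfolding 1 by (rule integral_cong) (use assms in \<open>simp add: commute_power\<close>)
  finally show "frac w * R t = R t * frac w" .
qed

text \<open>The second derivative of \<open>R\<^sup>N\<close> is a multiple of \<open>R\<^sup>N\<^sup>+\<^sup>2\<close>, whose decay is more than enough to dominate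
  the remainder. The linearisation bound is applied twice, to \<open>R\<^sup>N\<^sup>+\<^sup>1\<close> for a Lipschitz estimate and then
  to \<open>R\<^sup>N\<close>.\<close>

lemma power_taylor:
  obtains C where "\<And>u v s. u \<ge> 0 \<Longrightarrow> v \<ge> 0 \<Longrightarrow> s \<ge> 0 \<Longrightarrow>
    norm (weight s *\<^sub>R R (s + u) ^ N - weight s *\<^sub>R R (s + v) ^ N
      - (u - v) *\<^sub>R (weight s *\<^sub>R - (real N *\<^sub>R R (s + v) ^ Suc N)))
    \<le> (u - v)\<^sup>2 * (C * (1 + s) powr (- 1 - a))"
proof -
  obtain C where C: "C \<ge> 0" "\<And>s w. s \<ge> 0 \<Longrightarrow> w \<ge> 0 \<Longrightarrow>
      norm (weight s *\<^sub>R R (s + w) ^ Suc (Suc N)) \<le> C * (1 + s) powr (- 1 - a)"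
    using weighted_power_decay[of "Suc (Suc N)"] by auto
  define K where "K s = C * (1 + s) powr (- 1 - a)" for s
  have deriv: "((\<lambda>x. weight s *\<^sub>R R (s + x) ^ k) has_vector_derivative
      weight s *\<^sub>R - (real k *\<^sub>R R (s + x) ^ Suc k)) (at x within T)"
    if "s \<ge> 0" "x \<ge> 0" "T \<subseteq> {0..}" for s x k T
  proof (rule has_vector_derivative_within_subset[OF _ that(3)])
    have "((\<lambda>x. R (x + s) ^ k) has_vector_derivative - (real k *\<^sub>R R (x + s) ^ Suc k)) (at x within {0..})"
      using deriv_power_shift[of s x k] that by simp
    then have "((\<lambda>x. weight s *\<^sub>R R (x + s) ^ k) has_vector_derivative
        weight s *\<^sub>R - (real k *\<^sub>R R (x + s) ^ Suc k)) (at x within {0..})"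
      by (rule bounded_linear.has_vector_derivative[OF bounded_linear_scaleR_right])
    then show "((\<lambda>x. weight s *\<^sub>R R (s + x) ^ k) has_vector_derivative
        weight s *\<^sub>R - (real k *\<^sub>R R (s + x) ^ Suc k)) (at x within {0..})"
      by (simp add: add.commute)
  qed
  have lip: "norm (weight s *\<^sub>R R (s + u) ^ Suc N - weight s *\<^sub>R R (s + v) ^ Suc N)
      \<le> 3 * real (Suc N) * K s * \<bar>u - v\<bar>" if "u \<ge> 0" "v \<ge> 0" "s \<ge> 0" for u v s
  proof -
    let ?f = "\<lambda>x. weight s *\<^sub>R R (s + x) ^ Suc N"
    let ?f' = "\<lambda>x. weight s *\<^sub>R - (real (Suc N) *\<^sub>R R (s + x) ^ Suc (Suc N))"
    have f': "norm (?f' x) \<le> real (Suc N) * K s" if "x \<ge> 0" for x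
    proof -
      have "?f' x = - (real (Suc N) *\<^sub>R (weight s *\<^sub>R R (s + x) ^ Suc (Suc N)))" by simp
      then have "norm (?f' x) = real (Suc N) * norm (weight s *\<^sub>R R (s + x) ^ Suc (Suc N))"
        by (metis norm_minus_cancel norm_scaleR abs_of_nat)
      also have "\<dots> \<le> real (Suc N) * K s"
        unfolding K_def by (intro mult_left_mono C) (use that \<open>s \<ge> 0\<close> in auto)
      finally show ?thesis .
    qed
    \<comment> \<open>The Lipschitz constant is three times the bound of the derivative: two from comparing it with its
      value at \<open>v\<close>, one from the linear term.\<close>
    have "norm (?f u - ?f v - (u - v) *\<^sub>R ?f' v) \<le> norm (u - v) * (2 * real (Suc N) * K s)"
    proof (rule vector_differentiable_bound_linearization[where S="{0..}" and f="?f" and f'="?f'" and ?x0.0=v])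
      show "norm (?f' x - ?f' v) \<le> 2 * real (Suc N) * K s" if "x \<in> {0..}" for x
        by (rule order_trans[OF norm_triangle_ineq4 order_trans[OF add_mono[OF f' f']]])
           (use that \<open>v \<ge> 0\<close> in \<open>auto simp: algebra_simps\<close>)
      show "closed_segment v u \<subseteq> {0..}"
        using that by (auto simp: closed_segment_eq_real_ivl)
    qed (use that deriv[of s _ "{0..}" "Suc N"] in auto)
    moreover have "norm ((u - v) *\<^sub>R ?f' v) \<le> \<bar>u - v\<bar> * (real (Suc N) * K s)"
      unfolding norm_scaleR[of "u - v"] real_norm_def by (intro mult_left_mono f') (use that in auto)
    moreover have "norm (?f u - ?f v) \<le> norm (?f u - ?f v - (u - v) *\<^sub>R ?f' v) + norm ((u - v) *\<^sub>R ?f' v)"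
      by (metis diff_add_cancel norm_triangle_ineq)
    ultimately show ?thesis
      by (simp add: algebra_simps)
  qed
  let ?C = "real N * (3 * real (Suc N)) * C"
  show ?thesis
  proof (rule that[of ?C])
    fix u v s :: real assume uvs: "u \<ge> 0" "v \<ge> 0" "s \<ge> 0"
    let ?f = "\<lambda>x. weight s *\<^sub>R R (s + x) ^ N"
    let ?f' = "\<lambda>x. weight s *\<^sub>R - (real N *\<^sub>R R (s + x) ^ Suc N)"
    let ?S = "closed_segment v u"
    have S: "?S \<subseteq> {0..}" using uvs by (auto simp: closed_segment_eq_real_ivl)
    have "norm (?f u - ?f v - (u - v) *\<^sub>R ?f' v)
        \<le> norm (u - v) * (real N * (3 * real (Suc N) * K s * \<bar>u - v\<bar>))"
    proof (rule vector_differentiable_bound_linearization[where S="?S" and f="?f" and f'="?f'" and ?x0.0=v])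
      show "norm (?f' x - ?f' v) \<le> real N * (3 * real (Suc N) * K s * \<bar>u - v\<bar>)" if "x \<in> ?S" for x
      proof -
        have x: "x \<ge> 0" "\<bar>x - v\<bar> \<le> \<bar>u - v\<bar>"
          using that S by (auto simp: closed_segment_eq_real_ivl split: if_splits)
        have "?f' x - ?f' v = - (real N *\<^sub>R
            (weight s *\<^sub>R R (s + x) ^ Suc N - weight s *\<^sub>R R (s + v) ^ Suc N))"
          by (simp add: algebra_simps)
        then have "norm (?f' x - ?f' v) = real N *
            norm (weight s *\<^sub>R R (s + x) ^ Suc N - weight s *\<^sub>R R (s + v) ^ Suc N)"
          by (metis norm_minus_cancel norm_scaleR abs_of_nat)
        also have "\<dots> \<le> real N * (3 * real (Suc N) * K s * \<bar>x - v\<bar>)"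
          by (intro mult_left_mono lip) (use x uvs in auto)
        also have "\<dots> \<le> real N * (3 * real (Suc N) * K s * \<bar>u - v\<bar>)"
          by (intro mult_left_mono mult_nonneg_nonneg x) (use C(1) in \<open>auto simp: K_def\<close>)
        finally show ?thesis .
      qed
      show "(?f has_vector_derivative ?f' x) (at x within ?S)" if "x \<in> ?S" for x
        using deriv[of s x ?S N] uvs S that by blast
    qed (use uvs in auto)
    also have "\<dots> = (u - v)\<^sup>2 * (?C * (1 + s) powr (- 1 - a))"
    proof -
      have "(u - v)\<^sup>2 = \<bar>u - v\<bar> * \<bar>u - v\<bar>" by (simp add: power2_eq_square)
      then show ?thesis by (simp only: real_norm_def mult_ac K_def)
    qed
    finally show "norm (?f u - ?f v - (u - v) *\<^sub>R ?f' v) \<le> (u - v)\<^sup>2 * (?C * (1 + s) powr (- 1 - a))" .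
  qed
qed

text \<open>This is \<open>(w + H)\<^sup>-\<^sup>1 (w + H)\<^sup>-\<^sup>a = (w + H)\<^sup>-\<^sup>a\<^sup>-\<^sup>1\<close> in terms of the integrals. With \<open>p = N - a\<close>, the resolvent
  equation \<open>s R(s + w) R(w) = R(w) - R(s + w)\<close> makes the difference of the two integrands the
  derivative of \<open>s\<^sup>p R(s + w)\<^sup>N R(w)\<close>, which vanishes at both ends.\<close>

lemma frac_resolvent_eq:
  assumes w: "w \<ge> 0"
  shows "a *\<^sub>R (R w * frac w) = real N *\<^sub>R integral {0..} (\<lambda>s. weight s *\<^sub>R R (s + w) ^ Suc N)"
proof -
  define p where "p = real N - a"
  have p: "p > 1" and wt: "weight s = s powr (p - 1)" for s
    using N_gt by (auto simp: p_def weight_def)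
  let ?\<Phi> = "\<lambda>s. s powr p *\<^sub>R (R (s + w) ^ N * R w)"
  let ?\<phi> = "\<lambda>s. real N *\<^sub>R (weight s *\<^sub>R R (s + w) ^ Suc N) - a *\<^sub>R (weight s *\<^sub>R (R w * R (s + w) ^ N))"
  have "(?\<phi> has_integral 0 - ?\<Phi> 0) {0..}"
  proof (rule has_integral_Ici_FTC)
    show "continuous_on {0..} ?\<Phi>"
      using p by (intro continuous_on_scaleR continuous_on_mult continuous_power_shift w
          continuous_on_powr' continuous_on_id continuous_on_const) auto
    show "(?\<Phi> has_vector_derivative ?\<phi> s) (at s)" if s: "s > 0" for s
    proof -
      have d1: "((\<lambda>s. s powr p) has_real_derivative p * s powr (p - 1)) (at s)"
        using s by (auto intro!: derivative_eq_intros)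
      have "((\<lambda>s. R (s + w) ^ N) has_vector_derivative - (real N *\<^sub>R R (s + w) ^ Suc N)) (at s)"
      proof -
        have "at s within {0..} = at s"
          by (rule at_within_interior) (use s in auto)
        then show ?thesis using deriv_power_shift[OF w, of s N] s by simp
      qed
      from has_vector_derivative_scaleR[OF d1 has_vector_derivative_mult_left[OF this, of "R w"]]
      have "(?\<Phi> has_vector_derivative (s powr p *\<^sub>R (- (real N *\<^sub>R R (s + w) ^ Suc N) * R w)
          + (p * s powr (p - 1)) *\<^sub>R (R (s + w) ^ N * R w))) (at s)" .
      moreover have "s powr p *\<^sub>R (- (real N *\<^sub>R R (s + w) ^ Suc N) * R w)
          + (p * s powr (p - 1)) *\<^sub>R (R (s + w) ^ N * R w) = ?\<phi> s"
      proof -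
        have sp: "s powr p = weight s * s"
          using s powr_add[of s "p - 1" 1] by (simp add: wt)
        have id: "s *\<^sub>R (R (s + w) * R w) = R w - R (s + w)"
          using resolvent_eq[of w "s + w"] s w commute[of w "s + w"] by simp
        have "s powr p *\<^sub>R (R (s + w) ^ Suc N * R w) = weight s *\<^sub>R (R (s + w) ^ N * (s *\<^sub>R (R (s + w) * R w)))"
          by (simp add: sp power_Suc2 mult.assoc del: power_Suc)
        also have "\<dots> = weight s *\<^sub>R (R w * R (s + w) ^ N) - weight s *\<^sub>R R (s + w) ^ Suc N"
          unfolding id using s w by (simp add: right_diff_distrib scaleR_diff_right commute_power power_commutes)
        finally have 1: "s powr p *\<^sub>R (R (s + w) ^ Suc N * R w)
            = weight s *\<^sub>R (R w * R (s + w) ^ N) - weight s *\<^sub>R R (s + w) ^ Suc N" .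
        have "s powr p *\<^sub>R (- (real N *\<^sub>R R (s + w) ^ Suc N) * R w)
          = - (real N *\<^sub>R (s powr p *\<^sub>R (R (s + w) ^ Suc N * R w)))"
          by (simp add: mult.commute del: power_Suc)
        also have "\<dots> = real N *\<^sub>R (weight s *\<^sub>R R (s + w) ^ Suc N) - real N *\<^sub>R (weight s *\<^sub>R (R w * R (s + w) ^ N))"
          unfolding 1 by (simp add: scaleR_diff_right del: power_Suc)
        finally have 2: "s powr p *\<^sub>R (- (real N *\<^sub>R R (s + w) ^ Suc N) * R w)
          = real N *\<^sub>R (weight s *\<^sub>R R (s + w) ^ Suc N) - real N *\<^sub>R (weight s *\<^sub>R (R w * R (s + w) ^ N))" .
        have 3: "(p * s powr (p - 1)) *\<^sub>R (R (s + w) ^ N * R w)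
          = real N *\<^sub>R (weight s *\<^sub>R (R w * R (s + w) ^ N)) - a *\<^sub>R (weight s *\<^sub>R (R w * R (s + w) ^ N))"
        proof -
          have "p * s powr (p - 1) = real N * weight s - a * weight s"
            unfolding wt by (metis p_def left_diff_distrib)
          then show ?thesis using s w by (simp add: commute_power scaleR_diff_left)
        qed
        show ?thesis unfolding 2 3 by simp
      qed
      ultimately show ?thesis by simp
    qed
    show "(?\<Phi> \<longlongrightarrow> 0) at_top"
    proof -
      obtain C where C: "C \<ge> 0" "\<And>s. s \<ge> 0 \<Longrightarrow> norm (R s ^ N) \<le> C / (1 + s) ^ N"
        using power_decay by blast
      have "norm (?\<Phi> s) \<le> C * norm (R w) * s powr (- a)" if s: "s \<ge> 1" for s
      proof -
        have "norm (R (s + w) ^ N) \<le> C / (1 + (s + w)) ^ N" using C(2)[of "s + w"] s w by simp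
        also have "\<dots> \<le> C / s ^ N"
          by (intro divide_left_mono power_mono mult_pos_pos C) (use s w in auto)
        finally have "norm (R (s + w) ^ N * R w) \<le> C / s ^ N * norm (R w)"
          by (intro order_trans[OF norm_mult_ineq] mult_right_mono) auto
        then have "norm (?\<Phi> s) \<le> s powr p * (C / s ^ N * norm (R w))"
          unfolding norm_scaleR real_norm_def abs_of_nonneg[OF powr_ge_zero]
          by (rule mult_left_mono) simp
        also have "\<dots> = C * norm (R w) * (s powr p / s powr real N)"
          using s by (simp add: powr_realpow)
        also have "s powr p / s powr real N = s powr (- a)"
          using s by (simp add: p_def flip: powr_diff)
        finally show ?thesis .
      qed
      then have "\<forall>\<^sub>F s in at_top. norm (?\<Phi> s) \<le> C * norm (R w) * s powr (- a)"
        using eventually_at_top_linorder by blast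
      moreover have "((\<lambda>s. C * norm (R w) * s powr (- a)) \<longlongrightarrow> C * norm (R w) * 0) at_top"
        by (intro tendsto_intros tendsto_neg_powr filterlim_ident) (use a_pos in auto)
      ultimately show ?thesis by (rule Lim_null_comparison[OF _ tendsto_eq_rhs]) simp
    qed
  qed
  moreover have "?\<Phi> 0 = 0" using p by simp
  ultimately have "integral {0..} ?\<phi> = 0" by (simp add: has_integral_iff)
  moreover have "integral {0..} ?\<phi> = real N *\<^sub>R integral {0..} (\<lambda>s. weight s *\<^sub>R R (s + w) ^ Suc N)
      - a *\<^sub>R (R w * frac w)"
  proof -
    have "(\<lambda>s. weight s *\<^sub>R (R w * R (s + w) ^ N)) integrable_on {0..}"
      using integrable_linear[OF weighted_integrable[OF order_refl w] bounded_linear_mult_right[of "R w"]]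
      by (simp add: o_def)
    then show ?thesis
      unfolding frac_commute(1)[OF w w]
      using weighted_integrable[OF le_SucI[OF order_refl] w] w
      by (simp only: integral_diff integrable_cmul integral_cmul)
  qed
  ultimately show ?thesis by simp
qed

text \<open>The differential equation that replaces the functional calculus of \<open>H\<close>: the
  comparison of \<open>(w + H)\<^sup>-\<^sup>a\<close> with \<open>H\<^sup>-\<^sup>a\<close> rests on it.\<close>

lemma deriv_frac:
  assumes w: "w \<ge> 0"
  shows "(frac has_vector_derivative - (a *\<^sub>R (R w * frac w))) (at w within {0..})"
proof -
  obtain C where C: "\<And>u v s. u \<ge> 0 \<Longrightarrow> v \<ge> 0 \<Longrightarrow> s \<ge> 0 \<Longrightarrow>
    norm (weight s *\<^sub>R R (s + u) ^ N - weight s *\<^sub>R R (s + v) ^ N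
      - (u - v) *\<^sub>R (weight s *\<^sub>R - (real N *\<^sub>R R (s + v) ^ Suc N)))
    \<le> (u - v)\<^sup>2 * (C * (1 + s) powr (- 1 - a))"
    using power_taylor by blast
  let ?f' = "\<lambda>s. weight s *\<^sub>R - (real N *\<^sub>R R (s + w) ^ Suc N)"
  have eq: "?f' = (\<lambda>s. (- real N) *\<^sub>R (weight s *\<^sub>R R (s + w) ^ Suc N))"
    by (auto simp: mult.commute)
  have "(frac has_vector_derivative integral {0..} ?f') (at w within {0..})"
    unfolding frac_def[abs_def]
  proof (rule has_vector_derivative_integral_Ici)
    show "?f' integrable_on {0..}"
      unfolding eq by (intro integrable_cmul weighted_integrable w) auto
    show "(\<lambda>s. C * (1 + s) powr (- 1 - a)) integrable_on {0..}"
      using integrable_cmul[OF integrable_one_plus_powr[OF a_pos], of C] by simp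
  qed (use C w weighted_integrable in auto)
  moreover have "integral {0..} ?f' = - (a *\<^sub>R (R w * frac w))"
    unfolding eq frac_resolvent_eq[OF w] integral_cmul by simp
  ultimately show ?thesis by simp
qed

section \<open>The moment inequality\<close>

text \<open>The partial sums of \<open>(1 - (w - v) R(w))\<^sup>a (v + H)\<^sup>-\<^sup>a\<close>. Since \<open>1 - (w - v) R(w) = (v + H) R(w)\<close>, the full
  series is formally \<open>(w + H)\<^sup>-\<^sup>a\<close> for every \<open>v\<close>, which is why its partial sums are nearly constant in \<open>v\<close>.\<close>

definition binom_sum :: "real \<Rightarrow> nat \<Rightarrow> real \<Rightarrow> 'a" where
  "binom_sum w n v = (\<Sum>k\<le>n. (binom_coeff a k * (w - v) ^ k) *\<^sub>R (R w ^ k * frac v))"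

text \<open>Write \<open>X = (w - v) R(w)\<close>, so that \<open>R(w) = (1 - X) R(v)\<close>. The derivative then is a polynomial in \<open>X\<close> times
  \<open>R(v) (v + H)\<^sup>-\<^sup>a\<close>, and by the recurrence of the binomial coefficients only its last term survives.\<close>

lemma deriv_binom_sum:
  assumes w: "w \<ge> 0" and v: "v \<ge> 0"
  shows "(binom_sum w n has_vector_derivative
    ((real n - a) * binom_coeff a n * (w - v) ^ n) *\<^sub>R (R w ^ n * (R v * frac v))) (at v within {0..})"
proof (induction n)
  case 0
  show ?case
    using deriv_frac[OF v] by (simp add: binom_sum_def[abs_def])
next
  case (Suc n)
  let ?b = "binom_coeff a" and ?X = "R v * frac v"
  have d1: "((\<lambda>v. ?b (Suc n) * (w - v) ^ Suc n) has_real_derivative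
      - (?b (Suc n) * (real (Suc n) * (w - v) ^ n))) (at v within {0..})"
  proof -
    have "((\<lambda>v. (w - v) ^ Suc n) has_real_derivative (1 + real n) * (- 1 * (w - v) ^ n)) (at v within {0..})"
      by (rule DERIV_power_Suc) (auto intro!: derivative_eq_intros)
    from DERIV_cmult[OF this, of "?b (Suc n)"] show ?thesis by simp
  qed
  have d2: "((\<lambda>v. R w ^ Suc n * frac v) has_vector_derivative R w ^ Suc n * - (a *\<^sub>R ?X)) (at v within {0..})"
    by (rule has_vector_derivative_mult_right[OF deriv_frac[OF v]])
  have eq1: "binom_sum w (Suc n) = (\<lambda>v. binom_sum w n v
      + (?b (Suc n) * (w - v) ^ Suc n) *\<^sub>R (R w ^ Suc n * frac v))"
    by (simp add: binom_sum_def fun_eq_iff del: power_Suc)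
  have "R v - R w = (w - v) *\<^sub>R (R v * R w)" by (rule resolvent_eq[OF v w])
  then have Rw: "R w = R v - (w - v) *\<^sub>R (R w * R v)"
    by (simp add: commute[OF v w] algebra_simps)
  have "R w ^ Suc n * frac v = R w ^ n * (R w * frac v)"
    by (simp add: power_Suc2 mult.assoc del: power_Suc)
  also have "R w * frac v = ?X - (w - v) *\<^sub>R (R w * ?X)"
    by (subst Rw) (simp add: left_diff_distrib mult.assoc)
  also have "R w ^ n * \<dots> = R w ^ n * ?X - (w - v) *\<^sub>R (R w ^ Suc n * ?X)"
    by (simp add: right_diff_distrib power_Suc2 mult.assoc del: power_Suc)
  finally have eq2: "R w ^ Suc n * frac v = R w ^ n * ?X - (w - v) *\<^sub>R (R w ^ Suc n * ?X)" .
  have b: "?b (Suc n) * (real (Suc n) * (w - v) ^ n) = (real n - a) * ?b n * (w - v) ^ n"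
    using binom_coeff_Suc[of n a] by (simp only: mult.assoc[symmetric] mult.commute[of "?b (Suc n)"])
  have b': "(real n - a) * ?b n * (w - v) ^ n * (w - v) = real (Suc n) * ?b (Suc n) * (w - v) ^ Suc n"
    using binom_coeff_Suc[of n a] by (simp only: power_Suc2 mult.assoc)
  have "((\<lambda>v. (?b (Suc n) * (w - v) ^ Suc n) *\<^sub>R (R w ^ Suc n * frac v)) has_vector_derivative
      (?b (Suc n) * (w - v) ^ Suc n) *\<^sub>R (R w ^ Suc n * - (a *\<^sub>R ?X))
      + (- (?b (Suc n) * (real (Suc n) * (w - v) ^ n))) *\<^sub>R (R w ^ Suc n * frac v)) (at v within {0..})"
    by (rule has_vector_derivative_scaleR[OF d1 d2])
  from has_vector_derivative_add[OF Suc.IH this]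
  show ?case
    unfolding eq1
  proof (rule back_subst[of "\<lambda>d. (_ has_vector_derivative d) _"])
    let ?c = "(real n - a) * ?b n * (w - v) ^ n" and ?Z = "R w ^ Suc n * ?X"
    have "?c *\<^sub>R (R w ^ n * ?X) + ((?b (Suc n) * (w - v) ^ Suc n) *\<^sub>R (R w ^ Suc n * - (a *\<^sub>R ?X))
        + (- (?b (Suc n) * (real (Suc n) * (w - v) ^ n))) *\<^sub>R (R w ^ Suc n * frac v))
      = (?c * (w - v)) *\<^sub>R ?Z - (a * (?b (Suc n) * (w - v) ^ Suc n)) *\<^sub>R ?Z"
      unfolding b eq2 by (simp add: algebra_simps del: power_Suc)
    also have "\<dots> = ((real (Suc n) - a) * ?b (Suc n) * (w - v) ^ Suc n) *\<^sub>R ?Z"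
      unfolding b' by (simp only: left_diff_distrib scaleR_diff_left mult.assoc)
    finally show "?c *\<^sub>R (R w ^ n * ?X) + ((?b (Suc n) * (w - v) ^ Suc n) *\<^sub>R (R w ^ Suc n * - (a *\<^sub>R ?X))
        + (- (?b (Suc n) * (real (Suc n) * (w - v) ^ n))) *\<^sub>R (R w ^ Suc n * frac v))
      = ((real (Suc n) - a) * ?b (Suc n) * (w - v) ^ Suc n) *\<^sub>R ?Z" .
  qed
qed

text \<open>The factor \<open>((w - v) R(w))\<^sup>n\<close> of the derivative is at most \<open>M ((w - v) / w)\<^sup>n\<close>, whose integral over
  \<open>{0..w}\<close> is \<open>M w / (n + 1)\<close>; the scalar factor stays bounded because \<open>n b\<^sub>n\<close> does. Integrating,
  instead of taking a supremum, admits the endpoint \<open>v = 0\<close>, where the factor need not be small.\<close>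

lemma binom_sum_remainder:
  assumes w: "w > 0"
  obtains E where "\<And>n. norm (frac w - binom_sum w n 0) \<le> E / real (Suc n)"
proof -
  obtain C where C: "\<And>N. (\<Sum>k\<le>N. \<bar>binom_coeff a k\<bar>) \<le> C" "\<And>N. real N * \<bar>binom_coeff a N\<bar> \<le> C"
    using binom_coeff_bounds[OF a_pos] by metis
  have bC: "\<bar>binom_coeff a n\<bar> \<le> C" for n
    by (rule order_trans[OF _ C(1)[of n]]) (intro member_le_sum, auto)
  have "continuous_on {0..w} (\<lambda>v. R v * frac v)"
  proof (intro continuous_on_mult)
    show "continuous_on {0..w} R" by (rule continuous_on_subset[OF continuous_R]) auto
    show "continuous_on {0..w} frac"
      by (rule continuous_on_subset[OF continuous_on_vector_derivative[OF deriv_frac]]) auto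
  qed
  then obtain B where B: "\<And>v. v \<in> {0..w} \<Longrightarrow> norm (R v * frac v) \<le> B"
    using compact_imp_bounded[OF compact_continuous_image[OF _ compact_Icc]]
    by (metis (no_types, lifting) bounded_iff image_eqI)
  define K where "K = (C + a * C) * M * B"
  have "norm (frac w - binom_sum w n 0) \<le> (K * w) / real (Suc n)" for n
  proof -
    let ?c = "(real n - a) * binom_coeff a n"
    let ?D = "\<lambda>v. (?c * (w - v) ^ n) *\<^sub>R (R w ^ n * (R v * frac v))"
    have D: "(?D has_integral binom_sum w n w - binom_sum w n 0) {0..w}"
    proof (rule fundamental_theorem_of_calculus)
      show "(binom_sum w n has_vector_derivative ?D v) (at v within {0..w})" if "v \<in> {0..w}" for v
        by (rule has_vector_derivative_within_subset[OF deriv_binom_sum]) (use that w in auto)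
    qed (use w in auto)
    have cancel: "- K * w / m * (m * x * (- 1 / w)) = K * x" if "m \<noteq> 0" for m x :: real
      using w that by (simp add: field_simps)
    have G: "((\<lambda>v. K * ((w - v) / w) ^ n) has_integral
        (- K * w / real (Suc n) * ((w - w) / w) ^ Suc n) - (- K * w / real (Suc n) * ((w - 0) / w) ^ Suc n)) {0..w}"
    proof (rule fundamental_theorem_of_calculus)
      fix v assume "v \<in> {0..w}"
      have "((\<lambda>v. ((w - v) / w) ^ Suc n) has_real_derivative (real (Suc n) * ((w - v) / w) ^ n * (- 1 / w))) (at v within {0..w})"
      proof -
        have "((\<lambda>v. ((w - v) / w) ^ Suc n) has_real_derivative (1 + real n) * (- 1 / w * ((w - v) / w) ^ n)) (at v within {0..w})"
          by (rule DERIV_power_Suc) (use w in \<open>auto intro!: derivative_eq_intros\<close>)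
        then show ?thesis by simp
      qed
      from DERIV_cmult[OF this, of "- K * w / real (Suc n)"]
      show "((\<lambda>v. - K * w / real (Suc n) * ((w - v) / w) ^ Suc n) has_vector_derivative K * ((w - v) / w) ^ n)
          (at v within {0..w})"
        unfolding has_real_derivative_iff_has_vector_derivative[symmetric]
        by (rule back_subst[of "\<lambda>d. (_ has_field_derivative d) _"]) (use w cancel in simp)
    qed (use w in auto)
    have c: "\<bar>?c\<bar> \<le> C + a * C"
    proof -
      have "\<bar>?c\<bar> \<le> (real n + a) * \<bar>binom_coeff a n\<bar>"
        unfolding abs_mult using a_pos by (intro mult_right_mono) auto
      also have "\<dots> \<le> C + a * C"
        unfolding distrib_right using a_pos by (intro add_mono C mult_left_mono bC) auto
      finally show ?thesis .
    qed
    have bd: "norm (?D v) \<le> K * ((w - v) / w) ^ n" if v: "v \<in> {0..w}" for v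
    proof -
      have "norm (?D v) = \<bar>?c\<bar> * (w - v) ^ n * norm (R w ^ n * (R v * frac v))"
        using v by (simp add: abs_mult power_abs)
      also have "\<dots> \<le> (C + a * C) * (w - v) ^ n * (M / w ^ n * B)"
      proof (intro mult_mono c order_refl)
        show "norm (R w ^ n * (R v * frac v)) \<le> M / w ^ n * B"
          by (intro order_trans[OF norm_mult_ineq] mult_mono power_bound B v)
             (use w M_nonneg in auto)
      qed (use v c in auto)
      also have "\<dots> = K * ((w - v) / w) ^ n"
        by (simp add: K_def power_divide)
      finally show ?thesis .
    qed
    have "binom_sum w n w = frac w"
      unfolding binom_sum_def by (subst sum.atMost_shift) simp
    then have "norm (frac w - binom_sum w n 0) = norm (integral {0..w} ?D)"
      using D by (simp add: has_integral_iff)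
    also have "\<dots> \<le> integral {0..w} (\<lambda>v. K * ((w - v) / w) ^ n)"
      by (rule integral_norm_bound_integral) (use D G bd in \<open>auto simp: has_integral_iff\<close>)
    also have "\<dots> = K * w / real (Suc n)"
      using integral_unique[OF G] w by simp
    finally show ?thesis .
  qed
  then show ?thesis by (rule that)
qed

text \<open>The limit of the binomial sums: \<open>(w + H)\<^sup>-\<^sup>a = H\<^sup>-\<^sup>a E\<close> with \<open>E = (1 - w R(w))\<^sup>a\<close>, and \<open>\<parallel>E\<parallel>\<close> is at most
  \<open>M\<close> times the sum of the absolute binomial coefficients, whatever \<open>w\<close> is.\<close>

lemma norm_mult_frac_le:
  obtains C where "C \<ge> 0" and "\<And>Y w. w > 0 \<Longrightarrow> norm (Y * frac w) \<le> C * norm (Y * frac 0)"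
proof -
  obtain C where C: "\<And>N. (\<Sum>k\<le>N. \<bar>binom_coeff a k\<bar>) \<le> C"
    using binom_coeff_bounds[OF a_pos] by metis
  have C0: "C \<ge> 0" using C[of 0] by simp
  have "norm (Y * frac w) \<le> (C * M) * norm (Y * frac 0)" if w: "w > 0" for Y w
  proof -
    obtain E where E: "\<And>n. norm (frac w - binom_sum w n 0) \<le> E / real (Suc n)"
      using binom_sum_remainder[OF w] by blast
    have bs: "norm (Y * binom_sum w n 0) \<le> (C * M) * norm (Y * frac 0)" for n
    proof -
      have "Y * binom_sum w n 0 = (\<Sum>k\<le>n. (binom_coeff a k * w ^ k) *\<^sub>R (Y * frac 0 * R w ^ k))"
      proof -
        have "R w ^ k * frac 0 = frac 0 * R w ^ k" for k
          using frac_commute(2)[of 0 w] w power_commuting_commutes[of "R w" "frac 0" k] by simp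
        then show ?thesis by (simp add: binom_sum_def sum_distrib_left mult.assoc)
      qed
      also have "norm \<dots> \<le> (\<Sum>k\<le>n. \<bar>binom_coeff a k\<bar> * (M * norm (Y * frac 0)))"
      proof (rule sum_norm_le)
        fix k
        have "norm ((binom_coeff a k * w ^ k) *\<^sub>R (Y * frac 0 * R w ^ k))
            \<le> \<bar>binom_coeff a k\<bar> * w ^ k * (norm (Y * frac 0) * (M / w ^ k))"
          unfolding norm_scaleR real_norm_def abs_mult using w
          by (intro mult_mono[OF _ order_trans[OF norm_mult_ineq mult_left_mono[OF power_bound]]]) auto
        also have "\<dots> = \<bar>binom_coeff a k\<bar> * (M * norm (Y * frac 0))"
          using w by simp
        finally show "norm ((binom_coeff a k * w ^ k) *\<^sub>R (Y * frac 0 * R w ^ k))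
            \<le> \<bar>binom_coeff a k\<bar> * (M * norm (Y * frac 0))" .
      qed
      also have "\<dots> \<le> C * (M * norm (Y * frac 0))"
        unfolding sum_distrib_right[symmetric] using M_nonneg by (intro mult_right_mono C) auto
      finally show ?thesis by simp
    qed
    have "norm (Y * frac w) \<le> (C * M) * norm (Y * frac 0) + norm Y * (E / real (Suc n))" for n
    proof -
      have "Y * frac w = Y * binom_sum w n 0 + Y * (frac w - binom_sum w n 0)"
        by (simp add: right_diff_distrib)
      then have "norm (Y * frac w) \<le> norm (Y * binom_sum w n 0) + norm (Y * (frac w - binom_sum w n 0))"
        by (metis norm_triangle_ineq)
      also have "\<dots> \<le> (C * M) * norm (Y * frac 0) + norm Y * (E / real (Suc n))"
        by (intro add_mono bs order_trans[OF norm_mult_ineq] mult_left_mono E) auto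
      finally show ?thesis .
    qed
    moreover have "(\<lambda>n. (C * M) * norm (Y * frac 0) + norm Y * (E / real (Suc n))) \<longlonglongrightarrow> (C * M) * norm (Y * frac 0) + norm Y * 0"
      by (intro tendsto_intros LIMSEQ_Suc[OF lim_const_over_n])
    ultimately show ?thesis
      by (intro LIMSEQ_le_const) auto
  qed
  then show ?thesis using that[of "C * M"] C0 M_nonneg by simp
qed

text \<open>The Beta integral \<open>B(N - a, a)\<close>, which enters through its positivity and its scaling.\<close>

definition kappa :: real where
  "kappa = integral {0..} (\<lambda>s. weight s / (1 + s) ^ N)"

lemma kappa_integrable: "(\<lambda>s. weight s / (1 + s) ^ N) integrable_on {0..}"
proof (rule continuous_dominated_integrable_Ici)
  show "continuous_on {0..} (\<lambda>s. weight s / (1 + s) ^ N)"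
    by (intro continuous_on_divide continuous_weight continuous_intros) auto
  show "norm (weight s / (1 + s) ^ N) \<le> (1 + s) powr (- 1 - a)" if "s \<ge> 0" for s
    using weight_div_power_le[OF that] that by simp
qed (rule integrable_one_plus_powr[OF a_pos])

lemma kappa_pos: "kappa > 0"
proof -
  have int: "(\<lambda>s. weight s / (1 + s) ^ N) integrable_on {1..2}"
    by (rule integrable_on_subinterval[OF kappa_integrable]) auto
  have "0 < integral {1..2} (\<lambda>s::real. 1 / 3 ^ N :: real)" by simp
  also have "\<dots> \<le> integral {1..2} (\<lambda>s. weight s / (1 + s) ^ N)"
  proof (rule integral_le[OF _ int])
    show "1 / 3 ^ N \<le> weight s / (1 + s) ^ N" if "s \<in> {1..2}" for s
      using that N_gt unfolding weight_def by (intro frac_le power_mono ge_one_powr_ge_zero) auto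
  qed auto
  also have "\<dots> \<le> kappa"
    unfolding kappa_def by (rule integral_subset_le[OF _ int kappa_integrable]) auto
  finally show ?thesis .
qed

lemma kappa_scaling:
  assumes w: "w > 0"
  shows "((\<lambda>s. weight s / (s + w) ^ N) has_integral kappa * w powr (- a)) {0..}"
proof -
  let ?f = "\<lambda>s. weight s / (s + w) ^ N"
  have eq: "\<bar>w\<bar> * ?f (w * r) = w powr (- a) * (weight r / (1 + r) ^ N)" if "r \<ge> 0" for r
  proof -
    have "(w * r + w) ^ N = w powr real N * (1 + r) ^ N"
      using w by (simp add: powr_realpow power_mult_distrib[symmetric] algebra_simps)
    moreover have "weight (w * r) = w powr (real N - a - 1) * weight r"
      using w that by (simp add: weight_def powr_mult)
    moreover have "w * w powr (real N - a - 1) / w powr real N = w powr (- a)"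
    proof -
      have "w * w powr (real N - a - 1) = w powr (1 + (real N - a - 1))"
        using w by (subst powr_add) simp
      then show ?thesis using w by (simp flip: powr_diff)
    qed
    moreover have "w * (x * y) / (p * q) = (w * x / p) * (y / q)" for x y p q :: real by simp
    ultimately show ?thesis using w by (simp only: abs_of_pos times_divide_eq_right[symmetric])
  qed
  have int: "((\<lambda>r. \<bar>w\<bar> * ?f (w * r)) has_integral w powr (- a) * kappa) {0..}"
  proof (rule has_integral_eq)
    show "((\<lambda>r. w powr (- a) * (weight r / (1 + r) ^ N)) has_integral w powr (- a) * kappa) {0..}"
      using kappa_integrable unfolding kappa_def by (intro has_integral_mult_right) auto
  qed (use eq in auto)
  have abs: "(\<lambda>r. \<bar>w\<bar> * ?f (w * r)) absolutely_integrable_on {0..}"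
    by (rule nonnegative_absolutely_integrable_1)
       (use int w in \<open>auto simp: has_integral_iff intro!: mult_nonneg_nonneg divide_nonneg_nonneg\<close>)
  have img: "(\<lambda>r. w * r) ` {0..} = {0..}"
  proof
    show "{0..} \<subseteq> (\<lambda>r. w * r) ` {0..}"
      using w by (auto intro!: image_eqI[of _ _ "_ / w"])
  qed (use w in auto)
  have "?f absolutely_integrable_on (\<lambda>r. w * r) ` {0..} \<and> integral ((\<lambda>r. w * r) ` {0..}) ?f = w powr (- a) * kappa"
  proof (rule iffD1[OF has_absolute_integral_change_of_variables_1'])
    show "((\<lambda>r. w * r) has_field_derivative w) (at x within {0..})" for x
      by (auto intro!: derivative_eq_intros)
    show "inj_on (\<lambda>r. w * r) {0..}" using w by (auto simp: inj_on_def)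
  qed (use abs int in \<open>auto simp: has_integral_iff\<close>)
  then show ?thesis
    unfolding img by (auto simp: has_integral_iff set_lebesgue_integral_eq_integral mult.commute)
qed

text \<open>In terms of \<open>H\<close>: \<open>H\<^sup>-\<^sup>1 (1/s - (s + H)\<^sup>-\<^sup>1) = (s + H)\<^sup>-\<^sup>1 / s\<close> gains a power of \<open>s\<close>, and induction passes to the
  powers.\<close>

lemma resolvent_power_asymp:
  assumes s: "s > 0"
  shows "norm ((1 / s ^ j) *\<^sub>R R 0 - R 0 * R s ^ j) \<le> real j * M / s ^ Suc j"
proof (induction j)
  case (Suc j)
  have "R 0 - R s = s *\<^sub>R (R 0 * R s)" using resolvent_eq[of 0 s] s by simp
  then have RR: "R 0 * R s = (1 / s) *\<^sub>R R 0 - (1 / s) *\<^sub>R R s"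
    using s by (simp flip: scaleR_diff_right)
  have "R 0 * R s ^ Suc j = (R 0 * R s) * R s ^ j"
    by (simp add: mult.assoc)
  also have "\<dots> = (1 / s) *\<^sub>R (R 0 * R s ^ j) - (1 / s) *\<^sub>R R s ^ Suc j"
    unfolding RR by (simp add: left_diff_distrib)
  finally have "(1 / s ^ Suc j) *\<^sub>R R 0 - R 0 * R s ^ Suc j
      = (1 / s) *\<^sub>R ((1 / s ^ j) *\<^sub>R R 0 - R 0 * R s ^ j) + (1 / s) *\<^sub>R R s ^ Suc j"
    by (simp add: scaleR_diff_right)
  also have "norm \<dots> \<le> (1 / s) * (real j * M / s ^ Suc j) + (1 / s) * (M / s ^ Suc j)"
  proof (rule order_trans[OF norm_triangle_ineq add_mono])
    show "norm ((1 / s) *\<^sub>R ((1 / s ^ j) *\<^sub>R R 0 - R 0 * R s ^ j)) \<le> (1 / s) * (real j * M / s ^ Suc j)"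
      unfolding norm_scaleR using s Suc.IH by (intro mult_mono) auto
    show "norm ((1 / s) *\<^sub>R R s ^ Suc j) \<le> (1 / s) * (M / s ^ Suc j)"
      unfolding norm_scaleR using s power_bound[of s "Suc j"] by (intro mult_mono) auto
  qed
  also have "\<dots> = real (Suc j) * M / s ^ Suc (Suc j)"
    using s by (simp add: field_simps)
  finally show ?case .
qed simp

text \<open>The operator \<open>w\<^sup>a (w + H)\<^sup>-\<^sup>a\<close> tends to the identity as \<open>w\<close> grows, at the rate \<open>1 / w\<close> on the domain of \<open>H\<close>:
  compare the integrand with its scalar counterpart \<open>(s + w)\<^sup>-\<^sup>N\<close>.\<close>

lemma frac_asymp:
  assumes w: "w > 0"
  shows "norm ((kappa * w powr (- a)) *\<^sub>R R 0 - R 0 * frac w) \<le> real N * M * kappa * w powr (- a) / w"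
proof -
  let ?g = "\<lambda>s. (weight s / (s + w) ^ N) *\<^sub>R R 0 - weight s *\<^sub>R (R 0 * R (s + w) ^ N)"
  have 1: "((\<lambda>s. (weight s / (s + w) ^ N) *\<^sub>R R 0) has_integral (kappa * w powr (- a)) *\<^sub>R R 0) {0..}"
    by (rule has_integral_scaleR_left[OF kappa_scaling[OF w]])
  have 2: "((\<lambda>s. weight s *\<^sub>R (R 0 * R (s + w) ^ N)) has_integral R 0 * frac w) {0..}"
    using has_integral_linear[OF integrable_integral[OF weighted_integrable[OF order_refl]] bounded_linear_mult_right[of "R 0"], of w] w
    by (simp add: o_def frac_def)
  have g: "(?g has_integral (kappa * w powr (- a)) *\<^sub>R R 0 - R 0 * frac w) {0..}"
    by (rule has_integral_diff[OF 1 2])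
  have h: "((\<lambda>s. (real N * M / w) * (weight s / (s + w) ^ N)) has_integral (real N * M / w) * (kappa * w powr (- a))) {0..}"
    by (rule has_integral_mult_right[OF kappa_scaling[OF w]])
  have "norm (integral {0..} ?g) \<le> integral {0..} (\<lambda>s. (real N * M / w) * (weight s / (s + w) ^ N))"
  proof (rule integral_norm_bound_integral)
    fix s :: real assume "s \<in> {0..}"
    then have s: "s \<ge> 0" by simp
    have "?g s = weight s *\<^sub>R ((1 / (s + w) ^ N) *\<^sub>R R 0 - R 0 * R (s + w) ^ N)"
      by (simp add: scaleR_diff_right)
    then have "norm (?g s) = weight s * norm ((1 / (s + w) ^ N) *\<^sub>R R 0 - R 0 * R (s + w) ^ N)"
      by (metis abs_of_nonneg norm_scaleR weight_nonneg)
    also have "\<dots> \<le> weight s * (real N * M / (s + w) ^ Suc N)"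
      by (intro mult_left_mono resolvent_power_asymp) (use s w in auto)
    also have "\<dots> \<le> weight s * (real N * M / (w * (s + w) ^ N))"
    proof (intro mult_left_mono divide_left_mono)
      show "w * (s + w) ^ N \<le> (s + w) ^ Suc N"
        unfolding power_Suc using s w by (intro mult_right_mono) auto
    qed (use s w M_nonneg in auto)
    also have "\<dots> = (real N * M / w) * (weight s / (s + w) ^ N)" by simp
    finally show "norm (?g s) \<le> (real N * M / w) * (weight s / (s + w) ^ N)" .
  qed (use g h in \<open>auto simp: has_integral_iff\<close>)
  then show ?thesis
    using integral_unique[OF g] integral_unique[OF h] by simp
qed

text \<open>Split \<open>kappa R(0)\<close> into \<open>w\<^sup>a R(0) frac(w)\<close> and a remainder of size \<open>1 / w\<close>, and pay a constant to replace
  \<open>frac(w)\<close> by \<open>frac(0)\<close>.\<close>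

theorem moment_inequality:
  obtains C where "C \<ge> 0" and "\<And>Y w. w > 0 \<Longrightarrow>
    norm (Y * R 0) \<le> C * (w powr a * norm (Y * R 0 * frac 0) + norm Y / w)"
proof -
  obtain C where C: "C \<ge> 0" "\<And>Y w. w > 0 \<Longrightarrow> norm (Y * frac w) \<le> C * norm (Y * frac 0)"
    using norm_mult_frac_le by blast
  let ?C = "C / kappa + real N * M"
  have "norm (Y * R 0) \<le> ?C * (w powr a * norm (Y * R 0 * frac 0) + norm Y / w)" if w: "w > 0" for Y w
  proof -
    let ?p = "w powr a"
    have p: "?p * w powr (- a) = 1" using w by (simp flip: powr_add)
    have "kappa *\<^sub>R (Y * R 0) = ?p *\<^sub>R (Y * R 0 * frac w)
        + ?p *\<^sub>R (Y * ((kappa * w powr (- a)) *\<^sub>R R 0 - R 0 * frac w))"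
      using p by (simp add: algebra_simps mult.assoc)
    then have "norm (kappa *\<^sub>R (Y * R 0)) \<le> norm (?p *\<^sub>R (Y * R 0 * frac w))
        + norm (?p *\<^sub>R (Y * ((kappa * w powr (- a)) *\<^sub>R R 0 - R 0 * frac w)))"
      by (metis norm_triangle_ineq)
    also have "\<dots> \<le> ?p * (C * norm (Y * R 0 * frac 0))
        + ?p * (norm Y * (real N * M * kappa * w powr (- a) / w))"
      unfolding norm_scaleR abs_of_nonneg[OF powr_ge_zero]
      by (intro add_mono mult_left_mono C w order_trans[OF norm_mult_ineq] frac_asymp) auto
    also have "?p * (norm Y * (real N * M * kappa * w powr (- a) / w)) = (?p * w powr (- a)) * (kappa * (real N * M * (norm Y / w)))"
      by simp
    finally have "kappa * norm (Y * R 0) \<le> ?p * (C * norm (Y * R 0 * frac 0)) + kappa * (real N * M * (norm Y / w))"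
      using kappa_pos by (simp add: p)
    then have "norm (Y * R 0) \<le> (C / kappa) * (?p * norm (Y * R 0 * frac 0)) + real N * M * (norm Y / w)"
      using kappa_pos by (simp add: field_simps)
    also have "\<dots> \<le> ?C * (?p * norm (Y * R 0 * frac 0)) + ?C * (norm Y / w)"
      using C(1) kappa_pos M_nonneg w by (intro add_mono mult_right_mono) auto
    finally show ?thesis by (simp add: distrib_left)
  qed
  moreover have "?C \<ge> 0" using C(1) kappa_pos M_nonneg by simp
  ultimately show ?thesis using that by blast
qed

end

section \<open>The Banach algebra of bounded operators\<close>

text \<open>A copy of the bounded operators from a space to itself, in order to have composition as the
  multiplication of a type class: powers, product rules and the results about resolvent families then
  apply to operators.\<close>

typedef (overloaded) ('a::real_normed_vector) endo = "UNIV :: ('a \<Rightarrow>\<^sub>L 'a) set"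
  morphisms blinfun_of_endo endo_of_blinfun ..

setup_lifting type_definition_endo

instantiation endo :: (real_normed_vector) "{real_normed_algebra, monoid_mult}"
begin

lift_definition norm_endo :: "'a endo \<Rightarrow> real" is norm .
lift_definition plus_endo :: "'a endo \<Rightarrow> 'a endo \<Rightarrow> 'a endo" is "(+)" .
lift_definition minus_endo :: "'a endo \<Rightarrow> 'a endo \<Rightarrow> 'a endo" is "(-)" .
lift_definition uminus_endo :: "'a endo \<Rightarrow> 'a endo" is uminus .
lift_definition zero_endo :: "'a endo" is 0 .
lift_definition one_endo :: "'a endo" is id_blinfun .
lift_definition times_endo :: "'a endo \<Rightarrow> 'a endo \<Rightarrow> 'a endo" is "(o\<^sub>L)" .
lift_definition scaleR_endo :: "real \<Rightarrow> 'a endo \<Rightarrow> 'a endo" is "scaleR" .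

definition dist_endo :: "'a endo \<Rightarrow> 'a endo \<Rightarrow> real" where
  "dist_endo S T = norm (S - T)"

definition uniformity_endo :: "('a endo \<times> 'a endo) filter" where
  "uniformity_endo = (INF e\<in>{0 <..}. principal {(x, y). dist x y < e})"

definition open_endo :: "'a endo set \<Rightarrow> bool" where
  "open_endo S = (\<forall>x\<in>S. \<forall>\<^sub>F (x', y) in uniformity. x' = x \<longrightarrow> y \<in> S)"

definition sgn_endo :: "'a endo \<Rightarrow> 'a endo" where
  "sgn_endo T = scaleR (inverse (norm T)) T"

instance
proof
  fix S T U :: "'a endo" and r s :: real
  show "norm (S * T) \<le> norm S * norm T"
    by transfer (rule norm_blinfun_compose)
  show "norm (S + T) \<le> norm S + norm T"
    by transfer (rule norm_triangle_ineq)
  show "S * T * U = S * (T * U)" "(S + T) * U = S * U + T * U" "S * (T + U) = S * T + S * U"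
    "r *\<^sub>R S * T = r *\<^sub>R (S * T)" "S * r *\<^sub>R T = r *\<^sub>R (S * T)" "1 * S = S" "S * 1 = S"
    by (transfer; auto intro!: blinfun_eqI simp: blinfun.bilinear_simps)+
qed (rule dist_endo_def sgn_endo_def uniformity_endo_def open_endo_def |
     transfer; simp add: algebra_simps)+

end

instance endo :: (banach) banach
proof
  fix X :: "nat \<Rightarrow> 'a endo"
  have dist: "dist S T = dist (blinfun_of_endo S) (blinfun_of_endo T)" for S T :: "'a endo"
    unfolding dist_endo_def dist_norm by transfer simp
  assume "Cauchy X"
  then have "Cauchy (\<lambda>n. blinfun_of_endo (X n))"
    by (simp add: Cauchy_def dist)
  then obtain L where "(\<lambda>n. blinfun_of_endo (X n)) \<longlonglongrightarrow> L"
    using Cauchy_convergent convergent_def by blast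
  then have "X \<longlonglongrightarrow> endo_of_blinfun L"
    by (simp add: lim_sequentially dist endo_of_blinfun_inverse)
  then show "convergent X" by (auto simp: convergent_def)
qed

lift_definition app :: "'a::real_normed_vector endo \<Rightarrow> 'a \<Rightarrow> 'a" is blinfun_apply .

lift_definition Endo :: "('a::real_normed_vector \<Rightarrow> 'a) \<Rightarrow> 'a endo" is Blinfun .

lemma app_Endo: "bounded_linear f \<Longrightarrow> app (Endo f) = f"
  by transfer (rule bounded_linear_Blinfun_apply)

lemma app_eqI: "(\<And>x. app S x = app T x) \<Longrightarrow> S = T"
  by transfer (rule blinfun_eqI)

lemma app_simps [simp]:
  "app (S * T) x = app S (app T x)" "app 1 x = x" "app 0 x = 0"
  "app (S + T) x = app S x + app T x" "app (S - T) x = app S x - app T x"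
  "app (- S) x = - app S x" "app (r *\<^sub>R S) x = r *\<^sub>R app S x"
  by (transfer; simp add: blinfun.bilinear_simps)+

lemma bounded_linear_app_left: "bounded_linear (\<lambda>T. app T x)"
proof (rule bounded_linear_intro[of _ "norm x"])
  show "norm (app T x) \<le> norm T * norm x" for T
    by transfer (rule norm_blinfun)
qed simp_all

lemma norm_app: "norm (app T x) \<le> norm T * norm x"
  by transfer (rule norm_blinfun)

lemma norm_endo_eq_onorm: "norm T = onorm (app T)"
  by transfer (rule norm_blinfun.rep_eq)

lemma norm_endo_le: "b \<ge> 0 \<Longrightarrow> (\<And>x. norm (app T x) \<le> b * norm x) \<Longrightarrow> norm T \<le> b"
  by transfer (rule norm_blinfun_bound)

lemma app_power: "app (T ^ n) = app T ^^ n"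
  by (induction n) (auto simp: fun_eq_iff)

lemma has_integral_app:
  fixes f :: "real \<Rightarrow> 'a::banach endo"
  assumes "(f has_integral i) S"
  shows "((\<lambda>s. app (f s) x) has_integral app i x) S"
  using has_integral_linear[OF assms bounded_linear_app_left[of x]] by (simp add: o_def)

section \<open>Bounded semigroups and their generators\<close>

lemma bounded_clinear_imp_bounded_linear: "bounded_clinear f \<Longrightarrow> bounded_linear f"
  by (simp add: bounded_clinear_def)

lemma bounded_linear_scaleC: "bounded_linear (\<lambda>x. c *\<^sub>C (x::'a::complex_banach))"
proof (rule bounded_linear_intro[of _ "cmod c"])
  fix r :: real and x :: 'a
  show "c *\<^sub>C (r *\<^sub>R x) = r *\<^sub>R (c *\<^sub>C x)"
    by (simp only: scaleC_of_real[symmetric] scaleC_scaleC mult.commute)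
qed (simp_all add: scaleC_add_right norm_scaleC)

text \<open>Differences of orbits at \<open>s\<close> and \<open>t\<close> are expressed below by the semigroup at time \<open>\<bar>s - t\<bar>\<close>, which treats
  left and right limits together.\<close>

lemma tendsto_at_right_abs_diff:
  fixes f :: "real \<Rightarrow> 'a::topological_space"
  assumes "(f \<longlongrightarrow> l) (at_right 0)"
  shows "((\<lambda>s. f \<bar>s - t\<bar>) \<longlongrightarrow> l) (at t within S)"
proof -
  have "((\<lambda>s. \<bar>s - t\<bar>) \<longlongrightarrow> \<bar>t - t\<bar>) (at t within S)"
    by (intro tendsto_intros)
  then have "filterlim (\<lambda>s. \<bar>s - t\<bar>) (at_right 0) (at t within S)"
    unfolding filterlim_at by (auto simp: eventually_at_filter)
  with assms show ?thesis by (rule filterlim_compose)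
qed

locale bounded_c0_semigroup =
  fixes D :: "'a::complex_banach set" and G :: "'a \<Rightarrow> 'a" and T :: "real \<Rightarrow> 'a \<Rightarrow> 'a" and K :: real
  assumes gen: "generates_semigroup D G T"
    and bound: "\<And>t x. t \<ge> 0 \<Longrightarrow> norm (T t x) \<le> K * norm x"
begin

lemma T_clinear: "t \<ge> 0 \<Longrightarrow> bounded_clinear (T t)"
  and T_0 [simp]: "T 0 x = x"
  and T_add: "s \<ge> 0 \<Longrightarrow> t \<ge> 0 \<Longrightarrow> T (s + t) x = T s (T t x)"
  and T_tendsto_0: "((\<lambda>t. T t x) \<longlongrightarrow> x) (at_right 0)"
  using gen by (auto simp: generates_semigroup_def c0_semigroup_def)

lemma T_linear: "t \<ge> 0 \<Longrightarrow> bounded_linear (T t)"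
  using T_clinear bounded_clinear_imp_bounded_linear by blast

lemmas T_diff = linear_diff[OF bounded_linear.linear[OF T_linear]]
  and T_sum = linear_add[OF bounded_linear.linear[OF T_linear]]
  and T_scaleR = linear_scale[OF bounded_linear.linear[OF T_linear]]

lemma T_commute: "s \<ge> 0 \<Longrightarrow> t \<ge> 0 \<Longrightarrow> T s (T t x) = T t (T s x)"
  by (metis T_add add.commute)

lemma generator_tendsto: "x \<in> D \<Longrightarrow> ((\<lambda>h. (T h x - x) /\<^sub>R h) \<longlongrightarrow> G x) (at_right 0)"
  using gen by (auto simp: generates_semigroup_def)

lemma generatorI:
  assumes "((\<lambda>h. (T h x - x) /\<^sub>R h) \<longlongrightarrow> y) (at_right 0)"
  shows "x \<in> D" and "G x = y"
proof -
  show x: "x \<in> D" using gen assms unfolding generates_semigroup_def by blast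
  show "G x = y"
    by (rule tendsto_unique[OF _ generator_tendsto[OF x] assms]) simp
qed

text \<open>The semigroup is only strongly continuous, so a moving argument is handled by the uniform bound
  \<open>K\<close>.\<close>

lemma tendsto_T_min:
  assumes t: "t \<ge> 0" and q: "(q \<longlongrightarrow> y) (at_right 0)"
    and c: "((\<lambda>s. T (min s t) y) \<longlongrightarrow> T t y) (at t within {0..})"
  shows "((\<lambda>s. T (min s t) (q \<bar>s - t\<bar>)) \<longlongrightarrow> T t y) (at t within {0..})"
proof -
  have "((\<lambda>s. K * norm (q \<bar>s - t\<bar> - y)) \<longlongrightarrow> K * norm (y - y)) (at t within {0..})"
    by (intro tendsto_intros tendsto_at_right_abs_diff[OF q])
  then have lim: "((\<lambda>s. K * norm (q \<bar>s - t\<bar> - y)) \<longlongrightarrow> 0) (at t within {0..})" by simp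
  have "\<forall>\<^sub>F s in at t within {0..}. norm (T (min s t) (q \<bar>s - t\<bar> - y)) \<le> K * norm (q \<bar>s - t\<bar> - y)"
    using t by (auto simp: eventually_at_filter intro!: always_eventually bound)
  then have "((\<lambda>s. T (min s t) (q \<bar>s - t\<bar> - y)) \<longlongrightarrow> 0) (at t within {0..})"
    by (rule Lim_null_comparison[OF _ lim])
  from tendsto_add[OF this c]
  have "((\<lambda>s. T (min s t) (q \<bar>s - t\<bar> - y) + T (min s t) y) \<longlongrightarrow> T t y) (at t within {0..})" by simp
  moreover have "\<forall>\<^sub>F s in at t within {0..}. T (min s t) (q \<bar>s - t\<bar> - y) + T (min s t) y = T (min s t) (q \<bar>s - t\<bar>)"
    using t by (auto simp: eventually_at_filter intro!: always_eventually) (simp add: T_diff)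
  ultimately show ?thesis by (rule Lim_transform_eventually)
qed

lemma T_diff_eq:
  assumes "s \<ge> 0" "t \<ge> 0"
  shows "T s x - T t x = sgn (s - t) *\<^sub>R T (min s t) (T \<bar>s - t\<bar> x - x)"
proof (cases "s \<ge> t")
  case True
  then show ?thesis
    using assms T_add[of t "s - t" x] by (cases "s = t") (auto simp: T_diff)
next
  case False
  then show ?thesis
    using assms T_add[of s "t - s" x] by (auto simp: T_diff)
qed

lemma tendsto_T:
  assumes t: "t \<ge> 0"
  shows "((\<lambda>s. T s x) \<longlongrightarrow> T t x) (at t within {0..})"
proof -
  have "((\<lambda>s. K * norm (T \<bar>s - t\<bar> x - x)) \<longlongrightarrow> K * norm (x - x)) (at t within {0..})"
    by (intro tendsto_intros tendsto_at_right_abs_diff[OF T_tendsto_0])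
  then have lim: "((\<lambda>s. K * norm (T \<bar>s - t\<bar> x - x)) \<longlongrightarrow> 0) (at t within {0..})" by simp
  have "norm (T s x - T t x) \<le> K * norm (T \<bar>s - t\<bar> x - x)" if "s \<ge> 0" "s \<noteq> t" for s
    using bound[of "min s t" "T \<bar>s - t\<bar> x - x"] that t
    by (simp add: T_diff_eq[OF \<open>s \<ge> 0\<close> t] abs_sgn_eq)
  then have "\<forall>\<^sub>F s in at t within {0..}. norm (T s x - T t x) \<le> K * norm (T \<bar>s - t\<bar> x - x)"
    by (auto simp: eventually_at_filter intro!: always_eventually)
  then have "((\<lambda>s. T s x - T t x) \<longlongrightarrow> 0) (at t within {0..})"
    by (rule Lim_null_comparison[OF _ lim])
  then show ?thesis by (simp add: LIM_zero_iff)
qed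

lemma continuous_T: "continuous_on {0..} (\<lambda>t. T t x)"
  using tendsto_T by (auto simp: continuous_on_def)

lemma tendsto_T_min_const:
  assumes t: "t \<ge> 0"
  shows "((\<lambda>s. T (min s t) y) \<longlongrightarrow> T t y) (at t within {0..})"
proof -
  have "continuous_on {0..} (\<lambda>s. T (min s t) y)"
    by (rule continuous_on_compose2[OF continuous_T]) (use t in \<open>auto intro!: continuous_intros\<close>)
  then have "((\<lambda>s. T (min s t) y) \<longlongrightarrow> T (min t t) y) (at t within {0..})"
    using t unfolding continuous_on_def by (meson atLeast_iff)
  then show ?thesis by simp
qed

lemma deriv_T:
  assumes t: "t \<ge> 0" and x: "x \<in> D"
  shows "((\<lambda>s. T s x) has_vector_derivative T t (G x)) (at t within {0..})"
  unfolding has_vector_derivative_iff_quotient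
proof (rule Lim_transform_eventually)
  show "((\<lambda>s. T (min s t) ((T \<bar>s - t\<bar> x - x) /\<^sub>R \<bar>s - t\<bar>)) \<longlongrightarrow> T t (G x)) (at t within {0..})"
    by (rule tendsto_T_min[OF t generator_tendsto[OF x] tendsto_T_min_const[OF t]])
  have "T (min s t) ((T \<bar>s - t\<bar> x - x) /\<^sub>R \<bar>s - t\<bar>) = (T s x - T t x) /\<^sub>R (s - t)"
    if "s \<ge> 0" "s \<noteq> t" for s
    using that t by (subst T_diff_eq) (auto simp: T_scaleR sgn_if inverse_eq_divide minus_divide_right)
  then show "\<forall>\<^sub>F s in at t within {0..}.
      T (min s t) ((T \<bar>s - t\<bar> x - x) /\<^sub>R \<bar>s - t\<bar>) = (T s x - T t x) /\<^sub>R (s - t)"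
    by (auto simp: eventually_at_filter intro!: always_eventually)
qed

lemma T_in_D:
  assumes t: "t \<ge> 0" and x: "x \<in> D"
  shows "T t x \<in> D" and "G (T t x) = T t (G x)"
proof -
  have "((\<lambda>h. T t ((T h x - x) /\<^sub>R h)) \<longlongrightarrow> T t (G x)) (at_right 0)"
    by (rule bounded_linear.tendsto[OF T_linear[OF t] generator_tendsto[OF x]])
  moreover have "\<forall>\<^sub>F h in at_right 0. T t ((T h x - x) /\<^sub>R h) = (T h (T t x) - T t x) /\<^sub>R h"
    using eventually_at_right_less[of 0]
    by eventually_elim (use t in \<open>simp add: T_scaleR T_diff T_commute\<close>)
  ultimately have "((\<lambda>h. (T h (T t x) - T t x) /\<^sub>R h) \<longlongrightarrow> T t (G x)) (at_right 0)"
    by (rule Lim_transform_eventually)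
  then show "T t x \<in> D" and "G (T t x) = T t (G x)" by (rule generatorI)+
qed

lemma generator_add:
  assumes "x \<in> D" "y \<in> D"
  shows "x + y \<in> D" and "G (x + y) = G x + G y"
proof -
  have "((\<lambda>h. (T h x - x) /\<^sub>R h + (T h y - y) /\<^sub>R h) \<longlongrightarrow> G x + G y) (at_right 0)"
    by (intro tendsto_intros generator_tendsto assms)
  moreover have "\<forall>\<^sub>F h in at_right 0. (T h x - x) /\<^sub>R h + (T h y - y) /\<^sub>R h = (T h (x + y) - (x + y)) /\<^sub>R h"
    using eventually_at_right_less[of 0]
    by eventually_elim (simp add: T_sum algebra_simps)
  ultimately have "((\<lambda>h. (T h (x + y) - (x + y)) /\<^sub>R h) \<longlongrightarrow> G x + G y) (at_right 0)"
    by (rule Lim_transform_eventually)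
  then show "x + y \<in> D" and "G (x + y) = G x + G y" by (rule generatorI)+
qed

lemma generator_scaleC:
  assumes "x \<in> D"
  shows "c *\<^sub>C x \<in> D" and "G (c *\<^sub>C x) = c *\<^sub>C G x"
proof -
  interpret c: bounded_linear "\<lambda>x::'a. c *\<^sub>C x" by (rule bounded_linear_scaleC)
  have "((\<lambda>h. c *\<^sub>C ((T h x - x) /\<^sub>R h)) \<longlongrightarrow> c *\<^sub>C G x) (at_right 0)"
    by (rule c.tendsto[OF generator_tendsto[OF assms]])
  moreover have "\<forall>\<^sub>F h in at_right 0. c *\<^sub>C ((T h x - x) /\<^sub>R h) = (T h (c *\<^sub>C x) - c *\<^sub>C x) /\<^sub>R h"
    using eventually_at_right_less[of 0]
    by eventually_elim (use T_clinear in \<open>simp add: bounded_clinear_def c.scaleR c.diff\<close>)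
  ultimately have "((\<lambda>h. (T h (c *\<^sub>C x) - c *\<^sub>C x) /\<^sub>R h) \<longlongrightarrow> c *\<^sub>C G x) (at_right 0)"
    by (rule Lim_transform_eventually)
  then show "c *\<^sub>C x \<in> D" and "G (c *\<^sub>C x) = c *\<^sub>C G x" by (rule generatorI)+
qed

lemma generator_scaleR: "x \<in> D \<Longrightarrow> r *\<^sub>R x \<in> D" "x \<in> D \<Longrightarrow> G (r *\<^sub>R x) = r *\<^sub>R G x"
  using generator_scaleC[of x "complex_of_real r"] by (simp_all add: scaleC_of_real)

lemma generator_diff:
  assumes "x \<in> D" "y \<in> D"
  shows "x - y \<in> D" and "G (x - y) = G x - G y"
  using generator_add[of x "(-1) *\<^sub>R y"] generator_scaleR[of y "-1"] assms by simp_all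

lemma T_integrable: "0 \<le> a \<Longrightarrow> (\<lambda>u. T u x) integrable_on {a..b}"
  by (intro integrable_continuous_interval continuous_on_subset[OF continuous_T]) auto

lemma average_tendsto:
  assumes t: "t \<ge> 0"
  shows "((\<lambda>h. integral {t..t + h} (\<lambda>u. T u x) /\<^sub>R h) \<longlongrightarrow> T t x) (at_right 0)"
proof -
  have "((\<lambda>u. integral {t..u} (\<lambda>u. T u x)) has_vector_derivative T t x) (at t within {t..t + 1})"
    by (rule integral_has_vector_derivative)
       (use t in \<open>auto intro: continuous_on_subset[OF continuous_T]\<close>)
  then have "((\<lambda>y. integral {t..y} (\<lambda>u. T u x) /\<^sub>R (y - t)) \<longlongrightarrow> T t x) (at t within {t..t + 1})"
    unfolding has_vector_derivative_iff_quotient by simp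
  moreover have "at t within {t..t + 1} = at_right t"
    by (rule at_within_Icc_at_right) simp
  ultimately have "((\<lambda>y. integral {t..y} (\<lambda>u. T u x) /\<^sub>R (y - t)) \<longlongrightarrow> T t x) (at_right t)"
    by simp
  then show ?thesis
    by (simp add: at_right_to_0[of t] filterlim_filtermap add.commute)
qed

lemma integral_T_in_D:
  assumes t: "t \<ge> 0"
  shows "integral {0..t} (\<lambda>u. T u x) \<in> D" and "G (integral {0..t} (\<lambda>u. T u x)) = T t x - x"
proof -
  let ?V = "integral {0..t} (\<lambda>u. T u x)"
  have "((\<lambda>h. integral {t..t + h} (\<lambda>u. T u x) /\<^sub>R h - integral {0..0 + h} (\<lambda>u. T u x) /\<^sub>R h)
      \<longlongrightarrow> T t x - T 0 x) (at_right 0)"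
    by (intro tendsto_diff average_tendsto t) simp
  moreover have "\<forall>\<^sub>F h in at_right 0. integral {t..t + h} (\<lambda>u. T u x) /\<^sub>R h - integral {0..0 + h} (\<lambda>u. T u x) /\<^sub>R h
      = (T h ?V - ?V) /\<^sub>R h"
    using eventually_at_right_less[of 0]
  proof eventually_elim
    case (elim h)
    have "T h ?V = integral {0..t} (\<lambda>u. T h (T u x))"
      using integral_linear[OF T_integrable[of 0 x t] T_linear[of h]] elim by (simp add: o_def)
    also have "\<dots> = integral {0..t} ((\<lambda>u. T u x) \<circ> (+) h)"
      by (rule integral_cong) (use elim in \<open>simp add: T_add\<close>)
    also have "\<dots> = integral {h..t + h} (\<lambda>u. T u x)"
      using integral_shift_Icc_real[of 0 t "\<lambda>u. T u x" h] by simp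
    finally have Th: "T h ?V = integral {h..t + h} (\<lambda>u. T u x)" .
    have "integral {0..h} (\<lambda>u. T u x) + T h ?V = integral {0..t + h} (\<lambda>u. T u x)"
      unfolding Th by (rule Henstock_Kurzweil_Integration.integral_combine) (use t elim T_integrable in auto)
    moreover have "?V + integral {t..t + h} (\<lambda>u. T u x) = integral {0..t + h} (\<lambda>u. T u x)"
      by (rule Henstock_Kurzweil_Integration.integral_combine) (use t elim T_integrable in auto)
    ultimately have "integral {t..t + h} (\<lambda>u. T u x) - integral {0..h} (\<lambda>u. T u x) = T h ?V - ?V"
      by (simp add: algebra_simps)
    then show ?case by (simp flip: scaleR_diff_right)
  qed
  ultimately have "((\<lambda>h. (T h ?V - ?V) /\<^sub>R h) \<longlongrightarrow> T t x - T 0 x) (at_right 0)"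
    by (rule Lim_transform_eventually)
  then have "((\<lambda>h. (T h ?V - ?V) /\<^sub>R h) \<longlongrightarrow> T t x - x) (at_right 0)" by simp
  then show "?V \<in> D" and "G ?V = T t x - x" by (rule generatorI)+
qed

lemma integral_T_generator:
  assumes t: "t \<ge> 0" and x: "x \<in> D"
  shows "integral {0..t} (\<lambda>u. T u (G x)) = T t x - x"
proof -
  have "((\<lambda>u. T u (G x)) has_integral (T t x - T 0 x)) {0..t}"
    by (rule fundamental_theorem_of_calculus[OF t])
       (use x in \<open>auto intro: has_vector_derivative_within_subset[OF deriv_T]\<close>)
  then show ?thesis by (simp add: has_integral_iff)
qed

text \<open>The averages of an orbit over \<open>{0..h}\<close> lie in the domain and converge to its initial value.\<close>

lemma dense_domain: "closure D = UNIV"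
proof -
  have "x \<in> closure D" for x
  proof (rule Lim_in_closed_set[OF closed_closure])
    show "((\<lambda>h. integral {0..0 + h} (\<lambda>u. T u x) /\<^sub>R h) \<longlongrightarrow> x) (at_right 0)"
      using average_tendsto[of 0 x] by simp
    show "\<forall>\<^sub>F h in at_right 0. integral {0..0 + h} (\<lambda>u. T u x) /\<^sub>R h \<in> closure D"
      using eventually_at_right_less[of 0]
      by eventually_elim
         (use integral_T_in_D generator_scaleR closure_subset in \<open>auto intro!: subsetD[OF closure_subset]\<close>)
  qed simp
  then show ?thesis by auto
qed

lemma bounded_linear_integral_T:
  assumes t: "t \<ge> 0"
  shows "bounded_linear (\<lambda>x. integral {0..t} (\<lambda>u. T u x))"
proof (rule bounded_linear_intro[of _ "t * K"])
  fix x y :: 'a and r :: real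
  have "integral {0..t} (\<lambda>u. T u (x + y)) = integral {0..t} (\<lambda>u. T u x + T u y)"
    by (rule integral_cong) (simp add: T_sum)
  then show "integral {0..t} (\<lambda>u. T u (x + y)) = integral {0..t} (\<lambda>u. T u x) + integral {0..t} (\<lambda>u. T u y)"
    by (simp add: integral_add T_integrable)
  have "integral {0..t} (\<lambda>u. T u (r *\<^sub>R x)) = integral {0..t} (\<lambda>u. r *\<^sub>R T u x)"
    by (rule integral_cong) (simp add: T_scaleR)
  then show "integral {0..t} (\<lambda>u. T u (r *\<^sub>R x)) = r *\<^sub>R integral {0..t} (\<lambda>u. T u x)" by simp
  have "norm (integral {0..t} (\<lambda>u. T u x)) \<le> (K * norm x) * (t - 0)"
    by (rule integral_bound[OF t continuous_on_subset[OF continuous_T]]) (auto intro: bound)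
  then show "norm (integral {0..t} (\<lambda>u. T u x)) \<le> norm x * (t * K)"
    by (simp add: mult_ac)
qed

end

section \<open>Resolvents of generators\<close>

lemma neumann_solvable:
  fixes N :: "'a::banach \<Rightarrow> 'a"
  assumes N: "bounded_linear N" and small: "\<And>x. norm (N x) \<le> norm x / 2"
  shows "\<exists>x. x - N x = y"
proof -
  interpret N: bounded_linear N by (rule N)
  have "\<exists>!x. y + N x = x"
  proof (rule banach_fix_type[of "1/2"])
    show "\<forall>x z. dist (y + N x) (y + N z) \<le> 1 / 2 * dist x z"
      using small by (simp add: dist_norm flip: N.diff)
  qed auto
  then obtain x where "y + N x = x" by auto
  then show ?thesis by (intro exI[of _ x]) (simp add: algebra_simps)
qed

context bounded_c0_semigroup
begin

text \<open>An approximate two-sided inverse \<open>W\<close> of \<open>-G\<close> suffices, since \<open>1 - N\<close> is invertible by a Neumann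
  series. Every resolvent below is obtained from integrals of the semigroup over a bounded interval in
  this way, without improper integrals.\<close>

lemma neg_generator_inverse:
  assumes W: "bounded_linear W" and N: "bounded_linear N"
    and small: "\<And>x. norm (N x) \<le> norm x / 2"
    and WD: "\<And>y. W y \<in> D" and GW: "\<And>y. - G (W y) = y - N y"
    and WG: "\<And>x. x \<in> D \<Longrightarrow> W (- G x) = x - N x"
  shows "bij_betw (\<lambda>x. - G x) D UNIV" and "bounded_clinear (inv_into D (\<lambda>x. - G x))"
proof -
  interpret W: bounded_linear W by (rule W)
  obtain B where B: "B > 0" "\<And>x. norm (W x) \<le> norm x * B" using W.pos_bounded by blast
  have bd: "norm x \<le> norm (- G x) * (2 * B)" if "x \<in> D" for x
  proof -
    have "norm x \<le> norm (x - N x) + norm (N x)"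
      by (metis diff_add_cancel norm_triangle_ineq)
    then show ?thesis
      using small[of x] B(2)[of "- G x"] WG[OF that] by simp
  qed
  have inj: "inj_on (\<lambda>x. - G x) D"
  proof (rule inj_onI)
    fix x y assume "x \<in> D" "y \<in> D" "- G x = - G y"
    then show "x = y"
      using bd[of "x - y"] generator_diff[of x y] by simp
  qed
  have surj: "(\<lambda>x. - G x) ` D = UNIV"
  proof -
    have "y \<in> (\<lambda>x. - G x) ` D" for y
    proof -
      obtain x where "x - N x = y" using neumann_solvable[OF N small] by blast
      then have "- G (W x) = y" by (simp only: GW)
      then show ?thesis using WD by blast
    qed
    then show ?thesis by auto
  qed
  show bij: "bij_betw (\<lambda>x. - G x) D UNIV"
    using inj surj by (simp add: bij_betw_def)
  let ?R = "inv_into D (\<lambda>x. - G x)"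
  have RD: "?R y \<in> D" and GR: "- G (?R y) = y" for y
    using inv_into_into[of y "\<lambda>x. - G x" D] f_inv_into_f[of y "\<lambda>x. - G x" D] surj by auto
  have RI: "?R y = x" if "x \<in> D" "- G x = y" for x y
    using inv_into_f_f[OF inj that(1)] that(2) by simp
  have C: "?R (c *\<^sub>C y) = c *\<^sub>C ?R y" for c y
  proof (rule RI)
    have "- (c *\<^sub>C G (?R y)) = c *\<^sub>C (- G (?R y))"
      by (simp add: linear_neg[OF bounded_linear.linear[OF bounded_linear_scaleC]])
    then show "- G (c *\<^sub>C ?R y) = c *\<^sub>C y"
      using generator_scaleC[OF RD[of y], of c] GR[of y] by simp
  qed (rule generator_scaleC[OF RD])
  have "bounded_linear ?R"
  proof (rule bounded_linear_intro[of _ "2 * B"])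
    fix x y r
    show "?R (x + y) = ?R x + ?R y"
      by (rule RI) (use generator_add[OF RD RD] GR[of x] GR[of y] in \<open>auto simp: algebra_simps\<close>)
    show "?R (r *\<^sub>R x) = r *\<^sub>R ?R x"
      using C[of "complex_of_real r" x] by (simp add: scaleC_of_real)
    show "norm (?R x) \<le> norm x * (2 * B)"
      using bd[OF RD[of x]] GR[of x] by simp
  qed
  with C show "bounded_clinear ?R" by (simp add: bounded_clinear_def)
qed

end

lemma exp_decay:
  assumes "(s::real) > 0"
  shows "((\<lambda>t. exp (- s * t)) \<longlongrightarrow> 0) at_top"
proof (rule filterlim_compose[OF exp_at_bot])
  have "filterlim (\<lambda>t. s * t) at_top at_top"
    by (rule filterlim_tendsto_pos_mult_at_top[OF tendsto_const assms filterlim_ident])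
  then show "filterlim (\<lambda>t. - s * t) at_bot at_top"
    by (simp add: filterlim_uminus_at_top)
qed

lemma shifted_quotient_tendsto:
  fixes T :: "real \<Rightarrow> 'a::real_normed_vector \<Rightarrow> 'a"
  assumes "((\<lambda>h. (T h x - x) /\<^sub>R h) \<longlongrightarrow> y) (at_right 0)"
  shows "((\<lambda>h. (exp (- s * h) *\<^sub>R T h x - x) /\<^sub>R h) \<longlongrightarrow> y - s *\<^sub>R x) (at_right 0)"
proof -
  have "((\<lambda>h. exp (- s * h)) has_vector_derivative - s) (at 0 within {0<..})"
    unfolding has_real_derivative_iff_has_vector_derivative[symmetric]
    by (auto intro!: derivative_eq_intros)
  then have d: "((\<lambda>h. (exp (- s * h) - 1) /\<^sub>R h) \<longlongrightarrow> - s) (at_right 0)"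
    unfolding has_vector_derivative_iff_quotient by simp
  have "((\<lambda>h. exp (- s * h)) \<longlongrightarrow> exp (- s * 0)) (at_right 0)"
    by (intro tendsto_intros)
  then have "((\<lambda>h. exp (- s * h) *\<^sub>R ((T h x - x) /\<^sub>R h) + ((exp (- s * h) - 1) /\<^sub>R h) *\<^sub>R x)
      \<longlongrightarrow> 1 *\<^sub>R y + (- s) *\<^sub>R x) (at_right 0)"
    by (intro tendsto_add tendsto_scaleR assms d tendsto_const) simp
  moreover have "exp (- s * h) *\<^sub>R ((T h x - x) /\<^sub>R h) + ((exp (- s * h) - 1) /\<^sub>R h) *\<^sub>R x
      = (exp (- s * h) *\<^sub>R T h x - x) /\<^sub>R h" for h
    by (simp add: algebra_simps)
  ultimately show ?thesis by simp
qed

text \<open>Rescaling by an exponential reduces all spectral parameters to \<open>0\<close>, and growth bounds to boundedness.\<close>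

lemma generates_semigroup_shift:
  assumes "generates_semigroup D G T"
  shows "generates_semigroup D (\<lambda>x. G x - s *\<^sub>R x) (\<lambda>t x. exp (- s * t) *\<^sub>R T t x)"
proof -
  let ?T = "\<lambda>t x. exp (- s * t) *\<^sub>R T t x"
  have c0: "c0_semigroup T"
    and D: "D = {x. \<exists>y. ((\<lambda>h. (T h x - x) /\<^sub>R h) \<longlongrightarrow> y) (at_right 0)}"
    and G: "\<And>x. x \<in> D \<Longrightarrow> ((\<lambda>h. (T h x - x) /\<^sub>R h) \<longlongrightarrow> G x) (at_right 0)"
    using assms by (auto simp: generates_semigroup_def)
  have "bounded_clinear (?T t)" if "t \<ge> 0" for t
  proof -
    have T: "bounded_linear (T t)" "\<And>c x. T t (c *\<^sub>C x) = c *\<^sub>C T t x"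
      using c0 that by (auto simp: c0_semigroup_def bounded_clinear_def)
    then show ?thesis
      unfolding bounded_clinear_def
      by (auto intro!: bounded_linear_const_scaleR
          simp: linear_scale[OF bounded_linear.linear[OF bounded_linear_scaleC]])
  qed
  moreover have "?T 0 = id"
    using c0 by (auto simp: c0_semigroup_def id_def)
  moreover have "?T (r + t) = ?T r \<circ> ?T t" if "r \<ge> 0" "t \<ge> 0" for r t
  proof
    fix x
    have "bounded_linear (T r)"
      using c0 that by (auto simp: c0_semigroup_def bounded_clinear_def)
    then show "?T (r + t) x = (?T r \<circ> ?T t) x"
      using c0 that
      by (simp add: c0_semigroup_def linear_scale[OF bounded_linear.linear] distrib_left exp_diff exp_minus field_simps)
  qed
  moreover have "((\<lambda>t. ?T t x) \<longlongrightarrow> x) (at_right 0)" for x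
  proof -
    have "((\<lambda>t. ?T t x) \<longlongrightarrow> exp (- s * 0) *\<^sub>R x) (at_right 0)"
      using c0 by (intro tendsto_intros) (auto simp: c0_semigroup_def)
    then show ?thesis by simp
  qed
  ultimately have c0': "c0_semigroup ?T" by (simp add: c0_semigroup_def id_def)
  have G': "((\<lambda>h. (?T h x - x) /\<^sub>R h) \<longlongrightarrow> G x - s *\<^sub>R x) (at_right 0)" if "x \<in> D" for x
    by (rule shifted_quotient_tendsto) (rule G[OF that])
  have D': "D = {x. \<exists>y. ((\<lambda>h. (?T h x - x) /\<^sub>R h) \<longlongrightarrow> y) (at_right 0)}"
  proof (intro set_eqI iffI)
    fix x assume "x \<in> D"
    from G'[OF this] show "x \<in> {x. \<exists>y. ((\<lambda>h. (?T h x - x) /\<^sub>R h) \<longlongrightarrow> y) (at_right 0)}" by blast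
  next
    fix x assume "x \<in> {x. \<exists>y. ((\<lambda>h. (?T h x - x) /\<^sub>R h) \<longlongrightarrow> y) (at_right 0)}"
    then obtain y where "((\<lambda>h. (?T h x - x) /\<^sub>R h) \<longlongrightarrow> y) (at_right 0)" by blast
    from shifted_quotient_tendsto[where T = ?T and s = "- s", OF this]
    have "((\<lambda>h. (T h x - x) /\<^sub>R h) \<longlongrightarrow> y + s *\<^sub>R x) (at_right 0)"
      by (simp flip: exp_add)
    then show "x \<in> D" unfolding D by blast
  qed
  from c0' D' G' show ?thesis
    unfolding generates_semigroup_def by blast
qed

lemma resolvent_shift:
  fixes D :: "'a::complex_banach set"
  assumes "t - r = s"
  shows "resolvent D (\<lambda>x. G x - r *\<^sub>R x) (complex_of_real s) = resolvent D G (complex_of_real t)"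
    and "complex_of_real s \<in> resolvent_set D (\<lambda>x. G x - r *\<^sub>R x) \<longleftrightarrow> complex_of_real t \<in> resolvent_set D G"
proof -
  have eq: "(\<lambda>x. complex_of_real s *\<^sub>C x - (G x - r *\<^sub>R x)) = (\<lambda>x. complex_of_real t *\<^sub>C x - G x)"
  proof
    fix x :: 'a
    have "s *\<^sub>R x = t *\<^sub>R x - r *\<^sub>R x" using assms by (auto simp: scaleR_diff_left)
    then show "complex_of_real s *\<^sub>C x - (G x - r *\<^sub>R x) = complex_of_real t *\<^sub>C x - G x"
      unfolding scaleC_of_real by simp
  qed
  then show 1: "resolvent D (\<lambda>x. G x - r *\<^sub>R x) (complex_of_real s) = resolvent D G (complex_of_real t)"
    by (simp add: resolvent_def)
  show "complex_of_real s \<in> resolvent_set D (\<lambda>x. G x - r *\<^sub>R x) \<longleftrightarrow> complex_of_real t \<in> resolvent_set D G"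
    unfolding resolvent_set_def mem_Collect_eq 1 eq ..
qed

lemma zero_mem_resolvent_set_iff:
  fixes D :: "'a::complex_banach set"
  shows "0 \<in> resolvent_set D G \<longleftrightarrow>
    bij_betw (\<lambda>x. - G x) D UNIV \<and> bounded_clinear (inv_into D (\<lambda>x. - G x))"
proof -
  have "0 *\<^sub>C x = 0" for x :: 'a
    using scaleC_of_real[of 0 x] by simp
  then show ?thesis by (simp add: resolvent_set_def resolvent_def)
qed

locale resolvent_point =
  fixes D :: "'a::complex_banach set" and G :: "'a \<Rightarrow> 'a" and s :: real
  assumes mem: "complex_of_real s \<in> resolvent_set D G"
begin

abbreviation "Res \<equiv> resolvent D G (complex_of_real s)"

lemma bij: "bij_betw (\<lambda>x. s *\<^sub>R x - G x) D UNIV"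
  using mem by (simp add: resolvent_set_def scaleC_of_real)

lemma Res_bounded_clinear: "bounded_clinear Res"
  using mem by (simp add: resolvent_set_def)

lemma Res_linear: "bounded_linear Res"
  using Res_bounded_clinear by (rule bounded_clinear_imp_bounded_linear)

lemma Res_eq: "Res = inv_into D (\<lambda>x. s *\<^sub>R x - G x)"
  by (simp add: resolvent_def scaleC_of_real)

lemma Res_in_D: "Res y \<in> D"
  and Res_right: "s *\<^sub>R Res y - G (Res y) = y"
  and Res_left: "x \<in> D \<Longrightarrow> Res (s *\<^sub>R x - G x) = x"
  using bij bij_betw_inv_into_left[OF bij] bij_betw_inv_into_right[OF bij, of y]
    inv_into_into[of y "\<lambda>x. s *\<^sub>R x - G x" D]
  by (auto simp: Res_eq bij_betw_def)

lemma Res_range: "range Res = D"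
  using Res_in_D Res_left by (metis UNIV_I image_subset_iff rangeI subsetI subset_antisym)

end

context bounded_c0_semigroup
begin

lemma bounded_c0_semigroup_shift:
  assumes "s \<ge> 0"
  shows "bounded_c0_semigroup D (\<lambda>x. G x - s *\<^sub>R x) (\<lambda>t x. exp (- s * t) *\<^sub>R T t x) K"
proof
  show "generates_semigroup D (\<lambda>x. G x - s *\<^sub>R x) (\<lambda>t x. exp (- s * t) *\<^sub>R T t x)"
    by (rule generates_semigroup_shift[OF gen])
  show "norm (exp (- s * t) *\<^sub>R T t x) \<le> K * norm x" if "t \<ge> 0" for t x
  proof -
    have "exp (- s * t) * norm (T t x) \<le> 1 * (K * norm x)"
      by (intro mult_mono bound) (use that assms in auto)
    then show ?thesis by simp
  qed
qed

text \<open>For the rescaled semigroup \<open>S(t) = e\<^sup>-\<^sup>s\<^sup>t T(t)\<close>, the integral of \<open>S\<close> over \<open>{0..t}\<close> inverts \<open>s - G\<close> up to \<open>S(t)\<close>,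
  which is small for large \<open>t\<close>.\<close>

lemma positive_in_resolvent_set:
  assumes s: "s > 0"
  shows "complex_of_real s \<in> resolvent_set D G"
proof -
  let ?G = "\<lambda>x. G x - s *\<^sub>R x" and ?T = "\<lambda>t x. exp (- s * t) *\<^sub>R T t x"
  interpret S: bounded_c0_semigroup D ?G ?T K
    by (rule bounded_c0_semigroup_shift) (use s in simp)
  have "((\<lambda>t. exp (- s * t) * K) \<longlongrightarrow> 0 * K) at_top"
  proof (intro tendsto_mult_right)
    show "((\<lambda>t. exp (- s * t)) \<longlongrightarrow> 0) at_top"
      by (rule exp_decay[OF s])
  qed
  then have "\<forall>\<^sub>F t in at_top. exp (- s * t) * K < 1 / 2"
    by (rule order_tendstoD) simp
  with eventually_ge_at_top[of 0] have "\<forall>\<^sub>F t in at_top. t \<ge> 0 \<and> exp (- s * t) * K < 1 / 2"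
    by eventually_elim simp
  then obtain t where t: "t \<ge> 0" "exp (- s * t) * K < 1 / 2"
    using eventually_happens[of _ "at_top :: real filter"] by auto
  let ?W = "\<lambda>x. integral {0..t} (\<lambda>u. ?T u x)"
  have 1: "norm (?T t x) \<le> norm x / 2" for x
  proof -
    have "norm (?T t x) \<le> exp (- s * t) * (K * norm x)"
      using bound[OF t(1), of x] by simp
    also have "\<dots> \<le> 1 / 2 * norm x"
      unfolding mult.assoc[symmetric] by (intro mult_right_mono) (use t in auto)
    finally show ?thesis by simp
  qed
  have 2: "?W (- ?G x) = x - ?T t x" if "x \<in> D" for x
    using S.integral_T_generator[OF t(1) that] linear_neg[OF bounded_linear.linear[OF S.bounded_linear_integral_T[OF t(1)]], of "?G x"]
    by (simp add: algebra_simps)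
  have 3: "- ?G (?W y) = y - ?T t y" for y
    by (simp only: S.integral_T_in_D(2)[OF t(1)] minus_diff_eq)
  have "0 \<in> resolvent_set D ?G"
    unfolding zero_mem_resolvent_set_iff
    using S.neg_generator_inverse[OF S.bounded_linear_integral_T[OF t(1)] S.T_linear[OF t(1)] 1 S.integral_T_in_D(1)[OF t(1)] 3 2]
    by blast
  then show ?thesis
    using resolvent_shift(2)[of s s 0 D G] by simp
qed

lemma T_commute_resolvent:
  assumes "complex_of_real s \<in> resolvent_set D G" and t: "t \<ge> 0"
  shows "T t (resolvent D G (complex_of_real s) y) = resolvent D G (complex_of_real s) (T t y)"
proof -
  interpret R: resolvent_point D G s by unfold_locales (rule assms)
  have "s *\<^sub>R T t (R.Res y) - G (T t (R.Res y)) = T t (s *\<^sub>R R.Res y - G (R.Res y))"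
    using t T_in_D(2)[OF t R.Res_in_D[of y]] by (simp add: T_diff T_scaleR)
  also have "\<dots> = T t y" by (simp add: R.Res_right)
  finally show ?thesis
    using R.Res_left[OF T_in_D(1)[OF t R.Res_in_D[of y]]] by simp
qed

text \<open>The Hille--Yosida estimate for the powers. The orbit \<open>T(r)\<close> in front makes the induction work: the bound for all
  \<open>r\<close> at one power is integrated against \<open>e\<^sup>-\<^sup>s\<^sup>u\<close> to give the next one with the same constant.\<close>

lemma T_resolvent_power_bound:
  assumes s: "s > 0" and r: "r \<ge> 0"
  shows "norm (T r ((resolvent D G (complex_of_real s) ^^ k) x)) \<le> K * norm x / s ^ k"
  using r
proof (induction k arbitrary: r)
  case 0
  then show ?case using bound by simp
next
  case (Suc k)
  interpret R: resolvent_point D G s by unfold_locales (rule positive_in_resolvent_set[OF s])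
  let ?G = "\<lambda>x. G x - s *\<^sub>R x" and ?T = "\<lambda>t x. exp (- s * t) *\<^sub>R T t x"
  interpret S: bounded_c0_semigroup D ?G ?T K
    by (rule bounded_c0_semigroup_shift) (use s in simp)
  define y where "y = (R.Res ^^ k) x"
  let ?z = "R.Res y" and ?c = "K * norm x / s ^ k"
  have c: "?c \<ge> 0"
    using Suc.IH[of 0] norm_ge_zero order_trans by blast
  have "norm (T r ?z) \<le> exp (- s * t) * (K * norm ?z) + ?c / s" if t: "t \<ge> 0" for t
  proof -
    have "?G ?z = - y" using R.Res_right[of y] by (simp add: algebra_simps)
    then have "integral {0..t} (\<lambda>u. ?T u (- y)) = ?T t ?z - ?z"
      using S.integral_T_generator[OF t R.Res_in_D[of y]] by simp
    \<comment> \<open>The finite form of the Laplace representation of the resolvent; the first term disappears as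
      \<open>t\<close> grows.\<close>
    then have z: "?z = ?T t ?z + integral {0..t} (\<lambda>u. ?T u y)"
      using linear_neg[OF bounded_linear.linear[OF S.bounded_linear_integral_T[OF t]], of y]
      by (simp add: algebra_simps)
    have "T r (integral {0..t} (\<lambda>u. ?T u y)) = integral {0..t} (\<lambda>u. T r (?T u y))"
      using integral_linear[OF S.T_integrable[of 0 y t] T_linear[OF Suc.prems]] by (simp add: o_def)
    also have "norm \<dots> \<le> integral {0..t} (\<lambda>u. ?c * exp (- s * u))"
    proof (rule integral_norm_bound_integral)
      show "(\<lambda>u. T r (?T u y)) integrable_on {0..t}"
        using integrable_linear[OF S.T_integrable[of 0 y t] T_linear[OF Suc.prems]] by (simp add: o_def)
      show "(\<lambda>u. ?c * exp (- s * u)) integrable_on {0..t}"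
        by (intro integrable_continuous_interval continuous_intros)
      show "norm (T r (?T u y)) \<le> ?c * exp (- s * u)" if "u \<in> {0..t}" for u
      proof -
        have "T r (?T u y) = exp (- s * u) *\<^sub>R T (r + u) y"
          using that Suc.prems by (simp add: T_scaleR T_add)
        then have "norm (T r (?T u y)) = norm (T (r + u) y) * exp (- s * u)" by simp
        also have "\<dots> \<le> ?c * exp (- s * u)"
          unfolding y_def by (intro mult_right_mono Suc.IH) (use Suc.prems that in auto)
        finally show ?thesis .
      qed
    qed
    also have "\<dots> = ?c * integral {0..t} (\<lambda>u. exp (- s * u))" by simp
    also have "integral {0..t} (\<lambda>u. exp (- s * u)) \<le> 1 / s"
    proof -
      have "((\<lambda>u. exp (- s * u)) has_integral (- exp (- s * t) / s - - exp (- s * 0) / s)) {0..t}"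
        by (rule fundamental_theorem_of_calculus[OF t])
           (use s in \<open>auto intro!: derivative_eq_intros
              simp flip: has_real_derivative_iff_has_vector_derivative\<close>)
      from integral_unique[OF this]
      have "integral {0..t} (\<lambda>u. exp (- s * u)) = 1 / s - exp (- s * t) / s" by simp
      moreover have "exp (- s * t) / s \<ge> 0" using s by simp
      ultimately show ?thesis by linarith
    qed
    finally have int: "norm (T r (integral {0..t} (\<lambda>u. ?T u y))) \<le> ?c * (1 / s)"
      using c by (meson mult_left_mono order_trans)
    have "T r ?z = T r (?T t ?z) + T r (integral {0..t} (\<lambda>u. ?T u y))"
      by (subst z) (rule T_sum[OF Suc.prems])
    then have "norm (T r ?z) \<le> norm (T r (?T t ?z)) + norm (T r (integral {0..t} (\<lambda>u. ?T u y)))"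
      by (metis norm_triangle_ineq)
    moreover have "norm (T r (?T t ?z)) \<le> exp (- s * t) * (K * norm ?z)"
      using bound[of "r + t" ?z] t Suc.prems by (simp add: T_scaleR flip: T_add)
    ultimately show ?thesis using int by simp
  qed
  moreover have "((\<lambda>t. exp (- s * t) * (K * norm ?z) + ?c / s) \<longlongrightarrow> 0 * (K * norm ?z) + ?c / s) at_top"
  proof (intro tendsto_add tendsto_mult_right tendsto_const)
    show "((\<lambda>t. exp (- s * t)) \<longlongrightarrow> 0) at_top"
      by (rule exp_decay[OF s])
  qed
  ultimately have "norm (T r ?z) \<le> 0 * (K * norm ?z) + ?c / s"
    by (intro tendsto_lowerbound[where F=at_top]) (auto simp: eventually_at_top_linorder intro!: exI[of _ 0])
  then show ?case by (simp add: y_def mult.commute)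
qed

end

lemma growth_in_resolvent_set:
  assumes "generates_semigroup D G T"
    and "\<And>t x. t \<ge> 0 \<Longrightarrow> norm (T t x) \<le> M * exp (\<omega> * t) * norm x" and "s > \<omega>"
  shows "complex_of_real s \<in> resolvent_set D G"
    and "norm ((resolvent D G (complex_of_real s) ^^ k) x) \<le> M * norm x / (s - \<omega>) ^ k"
proof -
  interpret S: bounded_c0_semigroup D "\<lambda>x. G x - \<omega> *\<^sub>R x" "\<lambda>t x. exp (- \<omega> * t) *\<^sub>R T t x" M
  proof
    show "norm (exp (- \<omega> * t) *\<^sub>R T t x) \<le> M * norm x" if "t \<ge> 0" for t x
    proof -
      have "norm (exp (- \<omega> * t) *\<^sub>R T t x) \<le> exp (- \<omega> * t) * (M * exp (\<omega> * t) * norm x)"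
        using assms(2)[OF that, of x] by simp
      also have "\<dots> = M * norm x" by (simp add: exp_minus field_simps)
      finally show ?thesis .
    qed
  qed (rule generates_semigroup_shift[OF assms(1)])
  show "complex_of_real s \<in> resolvent_set D G"
    using S.positive_in_resolvent_set[of "s - \<omega>"] assms(3) resolvent_shift(2)[of s \<omega> "s - \<omega>" D G] by simp
  show "norm ((resolvent D G (complex_of_real s) ^^ k) x) \<le> M * norm x / (s - \<omega>) ^ k"
    using S.T_resolvent_power_bound[of "s - \<omega>" 0 k x] assms(3)
      S.T_0[of "(resolvent D G (complex_of_real s) ^^ k) x"] resolvent_shift(1)[of s \<omega> "s - \<omega>" D G] by simp
qed

text \<open>The two cases of interest are a base point \<open>a\<close> beyond the growth bound, where membership of \<open>a\<close> in the
  resolvent set is automatic, and \<open>a = \<omega> = 0\<close> for a bounded semigroup.\<close>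

lemma resolvent_family_of_semigroup:
  assumes gen: "generates_semigroup D G T"
    and growth: "\<And>t x. t \<ge> 0 \<Longrightarrow> norm (T t x) \<le> M * exp (\<omega> * t) * norm x"
    and a: "\<omega> \<le> a" and "M \<ge> 0"
    and mem: "complex_of_real a \<in> resolvent_set D G"
  shows "s \<ge> 0 \<Longrightarrow> complex_of_real (s + a) \<in> resolvent_set D G"
    and "resolvent_family (\<lambda>s. Endo (resolvent D G (complex_of_real (s + a)))) M"
proof -
  show mem': "complex_of_real (s + a) \<in> resolvent_set D G" if "s \<ge> 0" for s
    using growth_in_resolvent_set(1)[OF gen growth, of "s + a"] a that mem
    by (cases "s = 0") auto
  have app: "app (Endo (resolvent D G (complex_of_real (s + a)))) = resolvent D G (complex_of_real (s + a))"
    if "s \<ge> 0" for s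
    using mem'[OF that] by (intro app_Endo bounded_clinear_imp_bounded_linear) (simp add: resolvent_set_def)
  show "resolvent_family (\<lambda>s. Endo (resolvent D G (complex_of_real (s + a)))) M"
  proof
    fix s t :: real assume s: "s \<ge> 0" and t: "t \<ge> 0"
    interpret Rs: resolvent_point D G "s + a" by unfold_locales (rule mem'[OF s])
    interpret Rt: resolvent_point D G "t + a" by unfold_locales (rule mem'[OF t])
    have "Rs.Res y - Rt.Res y = (t - s) *\<^sub>R Rs.Res (Rt.Res y)" for y
    proof -
      interpret bounded_linear Rs.Res by (rule Rs.Res_linear)
      let ?x = "Rt.Res y"
      have "y = (t - s) *\<^sub>R ?x + ((s + a) *\<^sub>R ?x - G ?x)"
        using Rt.Res_right[of y] by (simp add: algebra_simps)
      then have "Rs.Res y = (t - s) *\<^sub>R Rs.Res ?x + Rs.Res ((s + a) *\<^sub>R ?x - G ?x)"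
        by (metis add scaleR)
      then show ?thesis by (simp only: Rs.Res_left[OF Rt.Res_in_D] add_diff_cancel_right')
    qed
    then show "Endo Rs.Res - Endo Rt.Res = (t - s) *\<^sub>R (Endo Rs.Res * Endo Rt.Res)"
      by (intro app_eqI) (simp only: app_simps app[OF s] app[OF t])
  next
    fix s :: real and k :: nat assume s: "s > 0"
    show "norm (Endo (resolvent D G (complex_of_real (s + a))) ^ k) \<le> M / s ^ k"
    proof (rule norm_endo_le)
      fix x
      have "norm (app (Endo (resolvent D G (complex_of_real (s + a))) ^ k) x) \<le> M * norm x / (s + a - \<omega>) ^ k"
        using growth_in_resolvent_set(2)[OF gen growth, of "s + a" k x] s a
        by (simp only: app_power app[OF less_imp_le[OF s]])
      also have "\<dots> \<le> M * norm x / s ^ k"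
        using s a \<open>M \<ge> 0\<close> by (intro divide_left_mono power_mono mult_nonneg_nonneg mult_pos_pos) auto
      finally show "norm (app (Endo (resolvent D G (complex_of_real (s + a))) ^ k) x) \<le> M / s ^ k * norm x"
        by simp
    qed (use s \<open>M \<ge> 0\<close> in simp)
  qed
qed

section \<open>Fractional powers and decay\<close>

context weighted_resolvent_family
begin

text \<open>Integration by parts raises the resolvent exponent from \<open>n\<close> to \<open>n + 1\<close> and replaces the singular
  weight by a continuous one.\<close>

lemma has_integral_lower_weight:
  assumes N: "N = Suc n"
  shows "((\<lambda>s. s powr (real n - a - 1) *\<^sub>R R s ^ n) has_integral (real n / (real n - a)) *\<^sub>R frac 0) {0..}"
proof -
  define p where "p = real n - a"
  have p: "p > 0" using N_gt N by (simp add: p_def)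
  have weight: "weight s = s powr p" for s by (simp add: weight_def p_def) (simp add: N)
  let ?\<Phi> = "\<lambda>s. s powr p *\<^sub>R R s ^ n"
  let ?\<phi> = "\<lambda>s. (p * s powr (p - 1)) *\<^sub>R R s ^ n - real n *\<^sub>R (weight s *\<^sub>R R s ^ N)"
  have "(?\<phi> has_integral 0 - ?\<Phi> 0) {0..}"
  proof (rule has_integral_Ici_FTC)
    show "continuous_on {0..} ?\<Phi>"
      using p by (intro continuous_on_scaleR continuous_power continuous_on_powr'
          continuous_on_id continuous_on_const) auto
    show "(?\<Phi> has_vector_derivative ?\<phi> s) (at s)" if s: "s > 0" for s
    proof -
      have "((\<lambda>s. s powr p) has_real_derivative p * s powr (p - 1)) (at s)"
        using s by (auto intro!: derivative_eq_intros)
      from has_vector_derivative_scaleR[OF this deriv_power_at[OF s, of n]]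
      have "(?\<Phi> has_vector_derivative s powr p *\<^sub>R - (real n *\<^sub>R R s ^ Suc n)
          + (p * s powr (p - 1)) *\<^sub>R R s ^ n) (at s)" .
      then show ?thesis
        by (rule back_subst[of "\<lambda>d. (_ has_vector_derivative d) _"])
           (simp add: weight mult.commute flip: N del: power_Suc)
    qed
    show "(?\<Phi> \<longlongrightarrow> 0) at_top"
      by (rule weighted_power_tendsto_0) (use a_pos in \<open>simp add: p_def\<close>)
  qed
  then have 1: "(?\<phi> has_integral 0) {0..}" using p by simp
  have "((\<lambda>s. weight s *\<^sub>R R s ^ N) has_integral frac 0) {0..}"
    using weighted_integrable[OF order_refl, of 0] unfolding frac_def by auto
  then have 2: "((\<lambda>s. real n *\<^sub>R (weight s *\<^sub>R R s ^ N)) has_integral real n *\<^sub>R frac 0) {0..}"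
    by (rule has_integral_cmul)
  have "((\<lambda>s. (p * s powr (p - 1)) *\<^sub>R R s ^ n) has_integral real n *\<^sub>R frac 0) {0..}"
    using has_integral_add[OF 1 2] by simp
  from has_integral_cmul[OF this, of "1 / p"] show ?thesis
    using p by (simp add: p_def)
qed

text \<open>The moment inequality with the \<open>w\<close> that balances its two terms.\<close>

lemma decay_of_resolvent:
  fixes T :: "real \<Rightarrow> 'a"
  assumes bound: "\<And>t. t > 0 \<Longrightarrow> norm (T t) \<le> K"
    and decay: "\<And>t. t > 0 \<Longrightarrow> norm (T t * frac 0) \<le> L * t powr (- b)"
  shows "\<exists>C. \<forall>t>0. norm (T t * R 0) \<le> C * t powr (- b / (a + 1))"
proof -
  obtain C where C: "C \<ge> 0" "\<And>Y w. w > 0 \<Longrightarrow>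
      norm (Y * R 0) \<le> C * (w powr a * norm (Y * R 0 * frac 0) + norm Y / w)"
    using moment_inequality by blast
  have "norm (T t * R 0) \<le> (C * (L * norm (R 0) + K)) * t powr (- b / (a + 1))" if t: "t > 0" for t
  proof -
    define w where "w = t powr (b / (a + 1))"
    have w: "w > 0" using t by (simp add: w_def)
    have "T t * R 0 * frac 0 = T t * frac 0 * R 0"
      using frac_commute(2)[of 0 0] by (simp add: mult.assoc)
    then have 1: "norm (T t * R 0 * frac 0) \<le> L * t powr (- b) * norm (R 0)"
      using order_trans[OF norm_mult_ineq mult_right_mono[OF decay[OF t] norm_ge_zero], of "R 0"]
      by (simp only:)
    have 2: "w powr a * t powr (- b) = t powr (- b / (a + 1))"
    proof -
      have "w powr a * t powr (- b) = t powr (b / (a + 1) * a + - b)"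
        by (simp only: w_def powr_powr powr_add)
      also have "b / (a + 1) * a + - b = - b / (a + 1)"
        using a_pos by (simp add: field_simps)
      finally show ?thesis .
    qed
    have 3: "1 / w = t powr (- b / (a + 1))"
      by (simp add: w_def powr_minus_divide)
    have "norm (T t * R 0) \<le> C * (w powr a * norm (T t * R 0 * frac 0) + norm (T t) / w)"
      by (rule C(2)[OF w])
    also have "\<dots> \<le> C * (w powr a * (L * t powr (- b) * norm (R 0)) + K / w)"
      by (intro mult_left_mono add_mono divide_right_mono bound 1 C) (use w t in auto)
    also have "\<dots> = C * ((w powr a * t powr (- b)) * (L * norm (R 0)) + K * (1 / w))"
      by simp
    also have "\<dots> = (C * (L * norm (R 0) + K)) * t powr (- b / (a + 1))"
      unfolding 2 3 by (simp add: algebra_simps)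
    finally show ?thesis .
  qed
  then show ?thesis by blast
qed

text \<open>The exponent \<open>-b / (a + 1)\<close> of the balanced estimate is not optimal for \<open>b = 1\<close>. Let
  \<open>\<phi>(t) = \<parallel>T(t) R(0)\<parallel>\<close>. As \<open>\<parallel>T(2t) R(0) frac(0)\<parallel> \<le> \<phi>(t) L / t\<close>, the moment inequality with
  \<open>w = l t\<^sup>1\<^sup>/\<^sup>a\<close> gives \<open>\<phi>(2t) \<le> C (l\<^sup>a L \<phi>(t) + K t\<^sup>-\<^sup>1\<^sup>/\<^sup>a / l)\<close>. For small \<open>l\<close> the first term contracts
  against the doubling of \<open>t\<close>, so a bound \<open>\<phi>(t) \<le> m t\<^sup>-\<^sup>1\<^sup>/\<^sup>a\<close> propagates from \<open>t \<le> 1\<close> to all \<open>t\<close>.\<close>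

lemma sharp_decay_of_resolvent:
  fixes T :: "real \<Rightarrow> 'a"
  assumes bound: "\<And>t. t > 0 \<Longrightarrow> norm (T t) \<le> K"
    and semigroup: "\<And>t. t > 0 \<Longrightarrow> T (2 * t) = T t * T t"
    and commute: "\<And>t. t > 0 \<Longrightarrow> T t * R 0 = R 0 * T t"
    and decay: "\<And>t. t > 0 \<Longrightarrow> norm (T t * frac 0) \<le> L / t"
  shows "\<exists>C>0. \<forall>t>0. norm (T t * R 0) \<le> C * t powr (- 1 / a)"
proof -
  obtain C where C: "C \<ge> 0" "\<And>Y w. w > 0 \<Longrightarrow>
      norm (Y * R 0) \<le> C * (w powr a * norm (Y * R 0 * frac 0) + norm Y / w)"
    using moment_inequality by blast
  have K: "K \<ge> 0" using bound[of 1] norm_ge_zero[of "T 1"] by (simp del: norm_ge_zero)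
  have L: "L \<ge> 0" using decay[of 1] norm_ge_zero[of "T 1 * frac 0"] by (simp del: norm_ge_zero)
  define q where "q = 2 powr (1 / a)"
  have q: "q > 0" by (simp add: q_def)
  define l where "l = (1 / (2 * (C * L + 1) * q)) powr (1 / a)"
  have CL: "C * L + 1 > 0" using C(1) L by (simp add: add_nonneg_pos)
  have l: "l > 0" using q CL by (simp add: l_def)
  have la: "l powr a = 1 / (2 * (C * L + 1) * q)"
    using q CL a_pos by (simp add: l_def powr_powr)
  \<comment> \<open>\<open>q\<close> is the loss of \<open>t\<^sup>-\<^sup>1\<^sup>/\<^sup>a\<close> under doubling of \<open>t\<close>; \<open>l\<close> is chosen so that the first term uses at most half of \<open>m\<close>.\<close>
  have lq: "C * L * l powr a * q \<le> 1 / 2"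
  proof -
    have "C * L * l powr a * q = C * L / (C * L + 1) / 2"
      unfolding la using q by simp
    also have "\<dots> \<le> 1 / 2" using CL by (simp add: divide_le_eq_1)
    finally show ?thesis .
  qed
  define m where "m = K * norm (R 0) + 2 * (C * K * q / l) + 1"
  have m: "m > 0" using K C(1) q l by (simp add: m_def add_nonneg_pos)
  have m1: "K * norm (R 0) \<le> m" using K C(1) q l by (simp add: m_def)
  have m2: "C * K * q / l \<le> m / 2"
  proof -
    have *: "x \<le> (y + 2 * x + 1) / 2" if "y \<ge> 0" for x y :: real using that by simp
    show ?thesis unfolding m_def by (rule *) (use K in simp)
  qed
  have "\<forall>t. 0 < t \<and> t \<le> 2 ^ k \<longrightarrow> norm (T t * R 0) \<le> m * t powr (- 1 / a)" for k
  proof (induction k)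
    case 0
    show ?case
    proof (intro allI impI)
      fix t :: real assume t: "0 < t \<and> t \<le> 2 ^ 0"
      have "norm (T t * R 0) \<le> K * norm (R 0)"
        by (rule order_trans[OF norm_mult_ineq mult_right_mono[OF bound]]) (use t in auto)
      also have "\<dots> \<le> m * 1" using m1 by simp
      also have "\<dots> \<le> m * t powr (- 1 / a)"
      proof (intro mult_left_mono)
        show "1 \<le> t powr (- 1 / a)"
          using t a_pos powr_mono2'[of "- 1 / a" t 1] by simp
      qed (use m in simp)
      finally show "norm (T t * R 0) \<le> m * t powr (- 1 / a)" .
    qed
  next
    case (Suc k)
    show ?case
    proof (intro allI impI)
      fix t :: real assume t: "0 < t \<and> t \<le> 2 ^ Suc k"
      define s where "s = t / 2"
      have s: "s > 0" "s \<le> 2 ^ k" "t = 2 * s" using t by (auto simp: s_def)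
      define w where "w = l * s powr (1 / a)"
      have w: "w > 0" using l s by (simp add: w_def)
      have wa: "w powr a = l powr a * s"
        using l s a_pos by (simp add: w_def powr_mult powr_powr)
      have sq: "s powr (- 1 / a) = q * t powr (- 1 / a)"
        using s a_pos by (simp add: q_def powr_mult powr_minus field_simps)
      have IH: "norm (T s * R 0) \<le> m * s powr (- 1 / a)" using Suc.IH s by blast
      have "T t * R 0 * frac 0 = T s * R 0 * (T s * frac 0)"
      proof -
        have "T t * R 0 = T s * (T s * R 0)" by (simp only: s(3) semigroup[OF s(1)] mult.assoc)
        also have "\<dots> = T s * (R 0 * T s)" by (subst commute[OF s(1)]) (rule refl)
        finally show ?thesis by (simp only: mult.assoc)
      qed
      moreover have "norm (T s * R 0 * (T s * frac 0)) \<le> m * s powr (- 1 / a) * (L / s)"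
        by (rule order_trans[OF norm_mult_ineq mult_mono[OF IH decay[OF s(1)]]]) (use m in auto)
      ultimately have 1: "norm (T t * R 0 * frac 0) \<le> m * s powr (- 1 / a) * (L / s)"
        by (simp only:)
      have "norm (T t * R 0) \<le> C * (w powr a * norm (T t * R 0 * frac 0) + norm (T t) / w)"
        by (rule C(2)[OF w])
      also have "\<dots> \<le> C * (w powr a * (m * s powr (- 1 / a) * (L / s)) + K / w)"
        by (intro mult_left_mono add_mono divide_right_mono bound 1 C) (use w t in auto)
      also have "\<dots> = (C * L * l powr a * m + C * K / l) * s powr (- 1 / a)"
        using s l unfolding wa by (simp add: w_def field_simps powr_minus_divide)
      also have "\<dots> = (m * (C * L * l powr a * q) + C * K * q / l) * t powr (- 1 / a)"
        unfolding sq by (simp add: field_simps)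
      also have "\<dots> \<le> (m * (1 / 2) + m / 2) * t powr (- 1 / a)"
        by (intro mult_right_mono add_mono mult_left_mono lq m2) (use m in auto)
      finally show "norm (T t * R 0) \<le> m * t powr (- 1 / a)" by simp
    qed
  qed
  moreover have "\<exists>k. t \<le> 2 ^ k" for t :: real
    by (meson less_imp_le one_less_numeral_iff real_arch_pow semiring_norm(76))
  ultimately show ?thesis using m by blast
qed

end

text \<open>The constant \<open>c\<close> collects the Gamma factors and the factor of the integration by parts. Decay
  estimates pass between the two sides because it is positive.\<close>

lemma neg_frac_power_eq_frac:
  fixes D :: "'a::complex_banach set" and G :: "'a \<Rightarrow> 'a" and \<mu> :: real
  defines "R \<equiv> \<lambda>s. Endo (resolvent D G (complex_of_real (s + \<mu>)))"
  assumes fam: "resolvent_family R M"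
    and mem: "\<And>s. s \<ge> 0 \<Longrightarrow> complex_of_real (s + \<mu>) \<in> resolvent_set D G" and "\<alpha> > 0"
  obtains c where "c > 0" and "weighted_resolvent_family R M \<alpha> (nat \<lfloor>\<alpha>\<rfloor> + 2)"
    and "neg_frac_power D G \<mu> \<alpha> = app (c *\<^sub>R weighted_resolvent_family.frac R \<alpha> (nat \<lfloor>\<alpha>\<rfloor> + 2) 0)"
proof -
  let ?n = "nat \<lfloor>\<alpha>\<rfloor> + 1"
  interpret resolvent_family R M by (rule fam)
  have n: "real ?n > \<alpha>" using \<open>\<alpha> > 0\<close> by linarith
  interpret w: weighted_resolvent_family R M \<alpha> "nat \<lfloor>\<alpha>\<rfloor> + 2"
    by unfold_locales (use n \<open>\<alpha> > 0\<close> in auto)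
  let ?c = "Gamma (real ?n) / (Gamma \<alpha> * Gamma (real ?n - \<alpha>)) * (real ?n / (real ?n - \<alpha>))"
  have app: "(resolvent D G (complex_of_real (s + \<mu>)) ^^ ?n) x = app (R s ^ ?n) x" if "s \<ge> 0" for s x
    using mem[OF that] unfolding app_power R_def resolvent_set_def
    by (subst app_Endo) (auto intro: bounded_clinear_imp_bounded_linear)
  have "neg_frac_power D G \<mu> \<alpha> x = app (?c *\<^sub>R w.frac 0) x" for x
  proof -
    have "integral {0..} (\<lambda>s. s powr (real ?n - \<alpha> - 1) *\<^sub>R (resolvent D G (complex_of_real (s + \<mu>)) ^^ ?n) x)
        = integral {0..} (\<lambda>s. app (s powr (real ?n - \<alpha> - 1) *\<^sub>R R s ^ ?n) x)"
      by (rule integral_cong) (simp only: app atLeast_iff app_simps)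
    also have "\<dots> = app ((real ?n / (real ?n - \<alpha>)) *\<^sub>R w.frac 0) x"
      by (rule integral_unique[OF has_integral_app[OF w.has_integral_lower_weight]]) simp
    finally show ?thesis
      unfolding neg_frac_power_def Let_def by simp
  qed
  moreover have "?c > 0"
    using n \<open>\<alpha> > 0\<close> by (intro mult_pos_pos divide_pos_pos Gamma_real_pos) auto
  ultimately show ?thesis using that[of ?c] w.weighted_resolvent_family_axioms by blast
qed

text \<open>Here the constant does matter: \<open>\<Gamma>(m + 1) / (\<Gamma>(m) \<Gamma>(1)) = m\<close> cancels the factor \<open>1 / m\<close> of the integral.\<close>

lemma neg_frac_power_of_nat:
  fixes D :: "'a::complex_banach set"
  assumes fam: "resolvent_family (\<lambda>s. Endo (resolvent D G (complex_of_real (s + \<mu>)))) M"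
    and mem: "\<And>s. s \<ge> 0 \<Longrightarrow> complex_of_real (s + \<mu>) \<in> resolvent_set D G" and m: "m > 0"
  shows "neg_frac_power D G \<mu> (real m) = app (Endo (resolvent D G (complex_of_real \<mu>)) ^ m)"
proof
  fix x
  interpret resolvent_family "\<lambda>s. Endo (resolvent D G (complex_of_real (s + \<mu>)))" M by (rule fam)
  let ?R = "\<lambda>s. Endo (resolvent D G (complex_of_real (s + \<mu>)))"
  have app: "(resolvent D G (complex_of_real (s + \<mu>)) ^^ Suc m) x = app (?R s ^ Suc m) x" if "s \<ge> 0" for s
    using mem[OF that] unfolding app_power resolvent_set_def
    by (subst app_Endo) (auto intro: bounded_clinear_imp_bounded_linear)
  have "integral {0..} (\<lambda>s. s powr (real (m + 1) - real m - 1) *\<^sub>R (resolvent D G (complex_of_real (s + \<mu>)) ^^ Suc m) x)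
      = integral {0..} (\<lambda>s. app (?R s ^ Suc m) x)"
    by (rule integral_spike[of "{0}"]) (auto simp: app simp del: of_real_add funpow.simps power_Suc)
  also have "\<dots> = app ((1 / real m) *\<^sub>R ?R 0 ^ m) x"
    by (rule integral_unique[OF has_integral_app[OF has_integral_power[OF m]]])
  moreover have "Gamma (1 + real m) = real m * Gamma (real m)"
    using m Gamma_plus1[of "real m"] by (simp add: add.commute of_nat_in_nonpos_Ints_iff)
  ultimately show "neg_frac_power D G \<mu> (real m) x = app (Endo (resolvent D G (complex_of_real \<mu>)) ^ m) x"
    using m
    by (simp add: neg_frac_power_def Let_def add.commute Gamma_eq_zero_iff of_nat_in_nonpos_Ints_iff
        del: funpow.simps)
qed

section \<open>Bounded polynomially stable semigroups\<close>

context bounded_c0_semigroup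
begin

text \<open>The semigroup as a curve in the algebra of operators. It need not be norm continuous, so
  integrals of the semigroup are taken pointwise.\<close>

definition op :: "real \<Rightarrow> 'a endo" where
  "op t = Endo (T t)"

lemma app_op: "t \<ge> 0 \<Longrightarrow> app (op t) = T t"
  unfolding op_def by (rule app_Endo[OF T_linear])

lemma op_add: "s \<ge> 0 \<Longrightarrow> t \<ge> 0 \<Longrightarrow> op (s + t) = op s * op t"
  by (rule app_eqI) (simp add: app_op T_add)

lemma norm_op_mult: "t \<ge> 0 \<Longrightarrow> norm (op t * S) = onorm (T t \<circ> app S)"
  unfolding norm_endo_eq_onorm by (rule arg_cong[of _ _ onorm]) (auto simp: app_op)

lemma op_commute_resolvent:
  assumes "complex_of_real s \<in> resolvent_set D G" and "t \<ge> 0"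
  shows "op t * Endo (resolvent D G (complex_of_real s)) = Endo (resolvent D G (complex_of_real s)) * op t"
proof -
  interpret R: resolvent_point D G s by unfold_locales (rule assms)
  show ?thesis
    by (rule app_eqI) (simp add: app_op assms app_Endo[OF R.Res_linear] T_commute_resolvent)
qed

end

text \<open>The bound \<open>K\<close> can be negative only on the zero space.\<close>

locale nonneg_bounded_c0_semigroup = bounded_c0_semigroup +
  assumes K0: "K \<ge> 0"
begin

lemma norm_op: "t \<ge> 0 \<Longrightarrow> norm (op t) \<le> K"
  by (rule norm_endo_le[OF K0]) (simp add: app_op bound)

text \<open>Write \<open>R = (\<mu> - G)\<^sup>-\<^sup>1\<close> and let \<open>V\<close> be the integral of the semigroup over \<open>{0..t}\<close>, so that
  \<open>-G V = 1 - T(t)\<close> and \<open>-G R = 1 - \<mu> R\<close>. Then \<open>-G (R + \<mu> V R) = 1 - \<mu> T(t) R\<close>, and the right-hand side is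
  invertible once \<open>T(t) R\<close> is small.\<close>

lemma zero_in_resolvent_set:
  assumes \<mu>: "complex_of_real \<mu> \<in> resolvent_set D G" and t: "t \<ge> 0"
    and small: "\<bar>\<mu>\<bar> * norm (op t * Endo (resolvent D G (complex_of_real \<mu>))) \<le> 1 / 2"
  shows "0 \<in> resolvent_set D G"
proof -
  interpret R: resolvent_point D G \<mu> by unfold_locales (rule \<mu>)
  interpret Rl: bounded_linear R.Res by (rule R.Res_linear)
  let ?V = "\<lambda>x. integral {0..t} (\<lambda>u. T u x)"
  let ?W = "\<lambda>x. R.Res x + \<mu> *\<^sub>R ?V (R.Res x)" and ?N = "\<lambda>x. \<mu> *\<^sub>R T t (R.Res x)"
  have V: "?V (R.Res x) \<in> D" "G (?V (R.Res x)) = T t (R.Res x) - R.Res x" for x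
    using integral_T_in_D[OF t] by auto
  have W: "bounded_linear ?W"
    by (intro bounded_linear_add R.Res_linear bounded_linear_const_scaleR
        bounded_linear_compose[OF bounded_linear_integral_T[OF t] R.Res_linear])
  have N: "bounded_linear ?N"
    by (intro bounded_linear_const_scaleR bounded_linear_compose[OF T_linear[OF t] R.Res_linear])
  have small': "norm (?N x) \<le> norm x / 2" for x
  proof -
    have "norm (T t (R.Res x)) \<le> norm (op t * Endo R.Res) * norm x"
      using norm_app[of "op t * Endo R.Res" x] by (simp add: app_op t app_Endo[OF R.Res_linear])
    then have "norm (?N x) \<le> (\<bar>\<mu>\<bar> * norm (op t * Endo R.Res)) * norm x"
      by (simp add: mult_left_mono mult.assoc)
    also have "\<dots> \<le> 1 / 2 * norm x" by (intro mult_right_mono small) auto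
    finally show ?thesis by simp
  qed
  have WD: "?W y \<in> D" for y
    by (intro generator_add generator_scaleR V R.Res_in_D)
  have GW: "- G (?W y) = y - ?N y" for y
  proof -
    have "G (?W y) = G (R.Res y) + \<mu> *\<^sub>R (T t (R.Res y) - R.Res y)"
      using V R.Res_in_D by (simp add: generator_add generator_scaleR)
    then show ?thesis using R.Res_right[of y] by (simp add: algebra_simps)
  qed
  have WG: "?W (- G x) = x - ?N x" if x: "x \<in> D" for x
  proof -
    have Rx: "R.Res (- G x) = x - \<mu> *\<^sub>R R.Res x"
      using Rl.diff[of "\<mu> *\<^sub>R x - G x" "\<mu> *\<^sub>R x"] R.Res_left[OF x] by (simp add: Rl.scaleR)
    have Gx: "x - \<mu> *\<^sub>R R.Res x = - G (R.Res x)"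
      using R.Res_right[of x] by (simp add: algebra_simps)
    have "?V (R.Res (- G x)) = - ?V (G (R.Res x))"
      unfolding Rx Gx by (rule linear_neg[OF bounded_linear.linear[OF bounded_linear_integral_T[OF t]]])
    also have "\<dots> = R.Res x - T t (R.Res x)"
      by (simp add: integral_T_generator[OF t R.Res_in_D])
    finally have "\<mu> *\<^sub>R ?V (R.Res (- G x)) = \<mu> *\<^sub>R R.Res x - ?N x"
      by (simp add: scaleR_diff_right)
    then show ?thesis by (simp add: Rx)
  qed
  show ?thesis
    unfolding zero_mem_resolvent_set_iff
    using neg_generator_inverse[OF W N small' WD GW WG] by blast
qed

lemma tendsto_zero_of_resolvent_decay:
  assumes \<mu>: "complex_of_real \<mu> \<in> resolvent_set D G" and "g > 0"
    and decay: "\<And>t. t > 0 \<Longrightarrow> norm (op t * Endo (resolvent D G (complex_of_real \<mu>))) \<le> C * t powr (- g)"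
  shows "((\<lambda>t. T t x) \<longlongrightarrow> 0) at_top"
proof -
  interpret R: resolvent_point D G \<mu> by unfold_locales (rule \<mu>)
  have lim: "((\<lambda>t. T t y) \<longlongrightarrow> 0) at_top" if y: "y \<in> D" for y
  proof -
    obtain z where z: "y = R.Res z" using R.Res_range y by blast
    have "norm (T t y) \<le> C * t powr (- g) * norm z" if "t > 0" for t
      using order_trans[OF norm_app[of "op t * Endo R.Res" z] mult_right_mono[OF decay[OF that]]] that
      by (simp add: app_op app_Endo[OF R.Res_linear] z)
    then have ev: "\<forall>\<^sub>F t in at_top. norm (T t y) \<le> C * t powr (- g) * norm z"
      by (intro eventually_mono[OF eventually_gt_at_top[of 0]])
    have "((\<lambda>t. C * t powr (- g) * norm z) \<longlongrightarrow> C * 0 * norm z) at_top"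
      by (intro tendsto_intros tendsto_neg_powr filterlim_ident) (use \<open>g > 0\<close> in auto)
    then show ?thesis by (intro Lim_null_comparison[OF ev]) simp
  qed
  show ?thesis
  proof (rule tendstoI)
    fix e :: real assume e: "e > 0"
    define d where "d = e / (2 * (K + 1))"
    have d: "d > 0" using e K0 by (simp add: d_def)
    obtain y where y: "y \<in> D" "dist y x < d"
      using dense_domain d by (metis UNIV_I closure_approachable)
    have Kd: "K * d \<le> e / 2"
    proof -
      have "K * d \<le> (K + 1) * d" using d by simp
      also have "\<dots> = e / 2" using K0 by (simp add: d_def field_simps)
      finally show ?thesis .
    qed
    have "\<forall>\<^sub>F t in at_top. dist (T t y) 0 < e / 2"
      using tendstoD[OF lim[OF y(1)], of "e / 2"] e by simp
    with eventually_ge_at_top[of 0] show "\<forall>\<^sub>F t in at_top. dist (T t x) 0 < e"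
    proof eventually_elim
      case (elim t)
      have "norm (T t x) \<le> norm (T t (x - y)) + norm (T t y)"
        using elim by (simp add: T_diff norm_triangle_sub add.commute)
      also have "norm (T t (x - y)) \<le> K * d"
        using y K0 by (intro order_trans[OF bound[OF elim(1)]] mult_left_mono)
          (auto simp: dist_norm norm_minus_commute)
      finally show ?case using elim Kd by simp
    qed
  qed
qed

lemma resolvent_family_at_zero:
  assumes "0 \<in> resolvent_set D G"
  shows "s \<ge> 0 \<Longrightarrow> complex_of_real (s + 0) \<in> resolvent_set D G"
    and "resolvent_family (\<lambda>s. Endo (resolvent D G (complex_of_real (s + 0)))) K"
  using resolvent_family_of_semigroup[of D G T K 0 0] gen bound K0 assms by auto

text \<open>The resolvent equation gives \<open>(-G)\<^sup>-\<^sup>1 = R (1 + \<mu> (-G)\<^sup>-\<^sup>1)\<close> with \<open>R = (\<mu> - G)\<^sup>-\<^sup>1\<close>.\<close>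

lemma decay_at_zero:
  assumes \<mu>: "complex_of_real \<mu> \<in> resolvent_set D G" and zero: "0 \<in> resolvent_set D G"
    and decay: "\<And>t. t > 0 \<Longrightarrow> norm (op t * Endo (resolvent D G (complex_of_real \<mu>))) \<le> C * t powr (- g)"
  shows "\<exists>C'\<ge>0. \<forall>t>0. norm (op t * Endo (resolvent D G 0)) \<le> C' * t powr (- g)"
proof -
  interpret R: resolvent_point D G \<mu> by unfold_locales (rule \<mu>)
  interpret R0: resolvent_point D G 0 by unfold_locales (use zero in simp)
  have R0: "app (Endo (resolvent D G 0)) = resolvent D G 0"
    using app_Endo[OF R0.Res_linear] by simp
  have eq: "Endo (resolvent D G 0) = Endo R.Res * (1 + \<mu> *\<^sub>R Endo (resolvent D G 0))"
  proof (rule app_eqI)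
    fix y
    define x where "x = resolvent D G 0 y"
    have x: "x \<in> D" "- G x = y" using R0.Res_in_D[of y] R0.Res_right[of y] by (auto simp: x_def)
    have eq1: "\<mu> *\<^sub>R x - G x = y + \<mu> *\<^sub>R x" unfolding x(2)[symmetric] by simp
    have "R.Res (y + \<mu> *\<^sub>R x) = x" using R.Res_left[OF x(1)] unfolding eq1 .
    then show "app (Endo (resolvent D G 0)) y = app (Endo R.Res * (1 + \<mu> *\<^sub>R Endo (resolvent D G 0))) y"
      by (simp only: R0 app_Endo[OF R.Res_linear] app_simps x_def[symmetric])
  qed
  let ?k = "norm (1 + \<mu> *\<^sub>R Endo (resolvent D G 0))"
  have C: "C \<ge> 0" using decay[of 1] norm_ge_zero[of "op 1 * Endo R.Res"] by (simp del: norm_ge_zero)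
  have "norm (op t * Endo (resolvent D G 0)) \<le> (C * ?k) * t powr (- g)" if "t > 0" for t
  proof -
    have "norm (op t * Endo (resolvent D G 0)) \<le> norm (op t * Endo R.Res) * ?k"
      using norm_mult_ineq[of "op t * Endo R.Res" "1 + \<mu> *\<^sub>R Endo (resolvent D G 0)"]
      unfolding mult.assoc eq[symmetric] .
    also have "\<dots> \<le> C * t powr (- g) * ?k"
      by (intro mult_right_mono decay that) auto
    finally show ?thesis by (simp add: mult_ac)
  qed
  then show ?thesis using C by (intro exI[of _ "C * ?k"]) simp
qed

text \<open>Distributing the time \<open>t\<close> evenly over \<open>m\<close> factors, \<open>T(t) R\<^sup>m = (T(t/m) R)\<^sup>m\<close> decays like \<open>t\<^sup>-\<^sup>g\<^sup>m\<close>; any integer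
  \<open>m \<ge> 1 / g\<close> is therefore a decay exponent.\<close>

lemma decay_exponent_exists:
  assumes zero: "0 \<in> resolvent_set D G" and g: "g > 0" and C: "C \<ge> 0"
    and decay: "\<And>t. t > 0 \<Longrightarrow> norm (op t * Endo (resolvent D G 0)) \<le> C * t powr (- g)"
  shows "\<exists>\<alpha>. decay_exponent D G T \<alpha>"
proof -
  let ?R = "Endo (resolvent D G 0)"
  have comm: "op t * ?R = ?R * op t" if "t \<ge> 0" for t
    using op_commute_resolvent[of 0 t] zero that by simp
  have pow: "norm (op (real (Suc j) * t) * ?R ^ Suc j) \<le> (C * t powr (- g)) ^ Suc j" if t: "t > 0" for t j
  proof (induction j)
    case 0
    then show ?case using decay[OF t] by simp
  next
    case (Suc j)
    let ?s = "real (Suc j) * t"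
    have "real (Suc (Suc j)) * t = t + ?s" by (simp add: algebra_simps)
    then have "op (real (Suc (Suc j)) * t) * ?R ^ Suc (Suc j) = op t * (op ?s * ?R) * ?R ^ Suc j"
      using op_add[of t ?s] t by (simp add: mult.assoc)
    also have "op ?s * ?R = ?R * op ?s"
      by (rule comm) (use t in simp)
    also have "op t * (?R * op ?s) * ?R ^ Suc j = (op t * ?R) * (op ?s * ?R ^ Suc j)"
      by (simp only: mult.assoc)
    finally have "norm (op (real (Suc (Suc j)) * t) * ?R ^ Suc (Suc j))
        \<le> norm (op t * ?R) * norm (op ?s * ?R ^ Suc j)"
      by (simp only: norm_mult_ineq)
    also have "\<dots> \<le> (C * t powr (- g)) * (C * t powr (- g)) ^ Suc j"
      by (intro mult_mono decay t Suc.IH mult_nonneg_nonneg C) auto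
    finally show ?case by simp
  qed
  obtain j :: nat where j: "real j > 1 / g" using reals_Archimedean2 by blast
  let ?m = "Suc j"
  have m: "g * real ?m \<ge> 1"
    using j g by (simp add: field_simps)
  let ?N = "C ^ ?m * real ?m powr (g * real ?m) + K * norm (?R ^ ?m) + 1"
  have N1: "C ^ ?m * real ?m powr (g * real ?m) \<ge> 0" "K * norm (?R ^ ?m) \<ge> 0"
    using C K0 by auto
  have main: "norm (op t * ?R ^ ?m) \<le> ?N / t" if t: "t > 0" for t
  proof (cases "t \<ge> 1")
    case True
    have "norm (op t * ?R ^ ?m) \<le> (C * (t / real ?m) powr (- g)) ^ ?m"
      using pow[of "t / real ?m" j] t by simp
    also have "\<dots> = C ^ ?m * (t / real ?m) powr (- g * real ?m)"
    proof -
      have "(t / real ?m) powr (- g) > 0" using t by simp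
      then have "((t / real ?m) powr (- g)) ^ ?m = (t / real ?m) powr (- g * real ?m)"
        by (simp only: powr_realpow[symmetric] powr_powr)
      then show ?thesis by (simp only: power_mult_distrib)
    qed
    also have "(t / real ?m) powr (- g * real ?m) = real ?m powr (g * real ?m) * t powr (- (g * real ?m))"
      using t by (simp add: powr_divide powr_minus_divide del: of_nat_Suc)
    also have "\<dots> \<le> real ?m powr (g * real ?m) * t powr (- 1)"
      using m True by (intro mult_left_mono powr_mono) auto
    finally have "norm (op t * ?R ^ ?m) \<le> C ^ ?m * (real ?m powr (g * real ?m) * t powr (- 1))"
      using C by (simp add: mult_left_mono)
    also have "\<dots> = C ^ ?m * real ?m powr (g * real ?m) / t"
      using t by (simp add: powr_minus_divide)
    also have "\<dots> \<le> ?N / t"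
      using t N1 by (intro divide_right_mono) auto
    finally show ?thesis .
  next
    case False
    have "norm (op t * ?R ^ ?m) \<le> K * norm (?R ^ ?m)"
      using norm_mult_ineq mult_right_mono[OF norm_op norm_ge_zero] t by (meson less_imp_le order_trans)
    also have "\<dots> \<le> ?N" using N1 by simp
    also have "\<dots> \<le> ?N / t"
      using divide_left_mono[of t 1 ?N] t False N1 by simp
    finally show ?thesis .
  qed
  have frac: "neg_frac_power D G 0 (real ?m) = app (?R ^ ?m)"
    using neg_frac_power_of_nat[OF resolvent_family_at_zero(2)[OF zero], of ?m] resolvent_family_at_zero(1)[OF zero]
    by simp
  have "decay_exponent D G T (real ?m)"
    unfolding decay_exponent_def
  proof (intro conjI zero exI[of _ ?N] allI impI)
    show "?N > 0" using N1 by simp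
    show "onorm (T t \<circ> neg_frac_power D G 0 (real ?m)) \<le> ?N / t" if "t > 0" for t
      unfolding frac using main[OF that] norm_op_mult[of t "?R ^ ?m"] that by simp
  qed simp
  then show ?thesis by blast
qed

lemma resolvent_decay_of_polynomially_stable:
  assumes "polynomially_stable D G T"
  shows "\<exists>\<mu> C g. complex_of_real \<mu> \<in> resolvent_set D G \<and> g > 0 \<and>
    (\<forall>t>0. norm (op t * Endo (resolvent D G (complex_of_real \<mu>))) \<le> C * t powr (- g))"
proof -
  obtain \<mu> M \<epsilon> \<alpha> \<beta> L where M: "M > 0" and "\<epsilon> > 0" "\<alpha> > 0" "\<beta> > 0"
    and growth: "\<And>t. t \<ge> 0 \<Longrightarrow> onorm (T t) \<le> M * exp ((\<mu> - \<epsilon>) * t)"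
    and decay: "\<And>t. t > 0 \<Longrightarrow> onorm (T t \<circ> neg_frac_power D G \<mu> \<alpha>) \<le> L * t powr (- \<beta>)"
    using assms unfolding polynomially_stable_def by metis
  have growth': "norm (T t x) \<le> M * exp ((\<mu> - \<epsilon>) * t) * norm x" if "t \<ge> 0" for t x
    by (rule order_trans[OF onorm[OF T_linear[OF that]] mult_right_mono[OF growth[OF that]]]) simp
  have mem: "complex_of_real \<mu> \<in> resolvent_set D G"
    by (rule growth_in_resolvent_set(1)[OF gen growth']) (use \<open>\<epsilon> > 0\<close> in auto)
  have le: "\<mu> - \<epsilon> \<le> \<mu>" "M \<ge> 0" using \<open>\<epsilon> > 0\<close> M by auto
  note fam = resolvent_family_of_semigroup[OF gen growth' le mem]
  let ?R = "\<lambda>s. Endo (resolvent D G (complex_of_real (s + \<mu>)))"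
  obtain c where c: "c > 0" and w: "weighted_resolvent_family ?R M \<alpha> (nat \<lfloor>\<alpha>\<rfloor> + 2)"
    and frac: "neg_frac_power D G \<mu> \<alpha> = app (c *\<^sub>R weighted_resolvent_family.frac ?R \<alpha> (nat \<lfloor>\<alpha>\<rfloor> + 2) 0)"
    using neg_frac_power_eq_frac[OF fam(2) fam(1) \<open>\<alpha> > 0\<close>] by blast
  interpret w: weighted_resolvent_family ?R M \<alpha> "nat \<lfloor>\<alpha>\<rfloor> + 2" by (rule w)
  have dec: "norm (op t * w.frac 0) \<le> (L / c) * t powr (- \<beta>)" if t: "t > 0" for t
  proof -
    have "c * norm (op t * w.frac 0) = norm (op t * (c *\<^sub>R w.frac 0))" using c by simp
    also have "\<dots> \<le> L * t powr (- \<beta>)"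
      using norm_op_mult[of t "c *\<^sub>R w.frac 0"] decay[OF t] t by (simp only: frac less_imp_le)
    finally show ?thesis using c by (simp add: field_simps)
  qed
  have bd: "norm (op t) \<le> K" if "t > 0" for t using norm_op that by simp
  have "\<exists>C. \<forall>t>0. norm (op t * ?R 0) \<le> C * t powr (- \<beta> / (\<alpha> + 1))"
    by (rule w.decay_of_resolvent[OF bd dec])
  then obtain C where C: "\<forall>t>0. norm (op t * ?R 0) \<le> C * t powr (- \<beta> / (\<alpha> + 1))" ..
  show ?thesis
  proof (intro exI conjI)
    show "\<beta> / (\<alpha> + 1) > 0" using \<open>\<alpha> > 0\<close> \<open>\<beta> > 0\<close> by simp
    show "\<forall>t>0. norm (op t * Endo (resolvent D G (complex_of_real \<mu>))) \<le> C * t powr (- (\<beta> / (\<alpha> + 1)))"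
      using C by simp
  qed (rule mem)
qed

theorem polynomially_stable_tendsto_zero:
  assumes "polynomially_stable D G T"
  shows "((\<lambda>t. T t x) \<longlongrightarrow> 0) at_top"
proof -
  obtain \<mu> C g where "complex_of_real \<mu> \<in> resolvent_set D G" and "g > 0"
    and "\<And>t. t > 0 \<Longrightarrow> norm (op t * Endo (resolvent D G (complex_of_real \<mu>))) \<le> C * t powr (- g)"
    using resolvent_decay_of_polynomially_stable[OF assms] by blast
  then show ?thesis by (rule tendsto_zero_of_resolvent_decay)
qed

theorem polynomially_stable_decay_exponent:
  assumes "polynomially_stable D G T"
  shows "\<exists>\<alpha>. decay_exponent D G T \<alpha>"
proof -
  obtain \<mu> C g where \<mu>: "complex_of_real \<mu> \<in> resolvent_set D G" and g: "g > 0"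
    and decay: "\<And>t. t > 0 \<Longrightarrow> norm (op t * Endo (resolvent D G (complex_of_real \<mu>))) \<le> C * t powr (- g)"
    using resolvent_decay_of_polynomially_stable[OF assms] by blast
  have "((\<lambda>t. \<bar>\<mu>\<bar> * (C * t powr (- g))) \<longlongrightarrow> \<bar>\<mu>\<bar> * (C * 0)) at_top"
    by (intro tendsto_intros tendsto_neg_powr filterlim_ident) (use g in auto)
  then have "\<forall>\<^sub>F t in at_top. \<bar>\<mu>\<bar> * (C * t powr (- g)) < 1 / 2"
    by (rule order_tendstoD) simp
  with eventually_gt_at_top[of 0] have "\<forall>\<^sub>F t in at_top. t > 0 \<and> \<bar>\<mu>\<bar> * (C * t powr (- g)) < 1 / 2"
    by eventually_elim simp
  then obtain t where t: "t > 0" "\<bar>\<mu>\<bar> * (C * t powr (- g)) < 1 / 2"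
    using eventually_happens[of _ "at_top :: real filter"] by auto
  have "\<bar>\<mu>\<bar> * norm (op t * Endo (resolvent D G (complex_of_real \<mu>))) \<le> 1 / 2"
    by (rule order_trans[OF mult_left_mono[OF decay[OF t(1)]]]) (use t in auto)
  then have zero: "0 \<in> resolvent_set D G"
    using zero_in_resolvent_set[OF \<mu>, of t] t by simp
  obtain C' where "C' \<ge> 0" "\<And>t. t > 0 \<Longrightarrow> norm (op t * Endo (resolvent D G 0)) \<le> C' * t powr (- g)"
    using decay_at_zero[OF \<mu> zero decay] by blast
  then show ?thesis
    by (rule decay_exponent_exists[OF zero g])
qed

theorem decay_rate_on_domain:
  assumes "decay_exponent D G T \<alpha>" and x: "x \<in> D"
  obtains m where "m \<ge> 0" and "\<And>t. t > 0 \<Longrightarrow> norm (T t x) \<le> m * t powr (- 1 / \<alpha>)"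
proof -
  from assms(1) obtain L where "\<alpha> > 0" and zero: "0 \<in> resolvent_set D G" and "L > 0"
    and decay: "\<And>t. t > 0 \<Longrightarrow> onorm (T t \<circ> neg_frac_power D G 0 \<alpha>) \<le> L / t"
    unfolding decay_exponent_def by blast
  note fam = resolvent_family_at_zero[OF zero]
  let ?R = "\<lambda>s. Endo (resolvent D G (complex_of_real (s + 0)))"
  obtain c where c: "c > 0" and w: "weighted_resolvent_family ?R K \<alpha> (nat \<lfloor>\<alpha>\<rfloor> + 2)"
    and frac: "neg_frac_power D G 0 \<alpha> = app (c *\<^sub>R weighted_resolvent_family.frac ?R \<alpha> (nat \<lfloor>\<alpha>\<rfloor> + 2) 0)"
    using neg_frac_power_eq_frac[OF fam(2) fam(1) \<open>\<alpha> > 0\<close>] by blast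
  interpret w: weighted_resolvent_family ?R K \<alpha> "nat \<lfloor>\<alpha>\<rfloor> + 2" by (rule w)
  have 1: "norm (op t * w.frac 0) \<le> (L / c) / t" if t: "t > 0" for t
  proof -
    have "c * norm (op t * w.frac 0) = norm (op t * (c *\<^sub>R w.frac 0))" using c by simp
    also have "\<dots> \<le> L / t"
      using norm_op_mult[of t "c *\<^sub>R w.frac 0"] decay[OF t] t by (simp only: frac less_imp_le)
    finally show ?thesis using c t by (simp add: field_simps)
  qed
  have 2: "op (2 * t) = op t * op t" if "t > 0" for t
    unfolding mult_2 by (rule op_add) (use that in auto)
  have 3: "op t * ?R 0 = ?R 0 * op t" if "t > 0" for t
    by (rule op_commute_resolvent[OF fam(1)]) (use that in auto)
  have 4: "norm (op t) \<le> K" if "t > 0" for t using norm_op that by simp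
  have "\<exists>C>0. \<forall>t>0. norm (op t * ?R 0) \<le> C * t powr (- 1 / \<alpha>)"
    by (rule w.sharp_decay_of_resolvent[OF 4 2 3 1])
  then obtain C where C: "C > 0" "\<And>t. t > 0 \<Longrightarrow> norm (op t * ?R 0) \<le> C * t powr (- 1 / \<alpha>)"
    by blast
  interpret R0: resolvent_point D G 0 by unfold_locales (use zero in simp)
  have xR: "resolvent D G 0 (- G x) = x" using R0.Res_left[OF x] by simp
  have "norm (T t x) \<le> (C * norm (G x)) * t powr (- 1 / \<alpha>)" if t: "t > 0" for t
  proof -
    have "app (op t * ?R 0) (- G x) = T t (resolvent D G 0 (- G x))"
      using t by (simp add: app_op app_Endo[OF R0.Res_linear, simplified])
    then have eq: "T t x = app (op t * ?R 0) (- G x)" by (simp only: xR)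
    have "norm (T t x) \<le> norm (op t * ?R 0) * norm (- G x)"
      unfolding eq by (rule norm_app)
    also have "\<dots> = norm (op t * ?R 0) * norm (G x)" by (simp only: norm_minus_cancel)
    also have "\<dots> \<le> C * t powr (- 1 / \<alpha>) * norm (G x)"
      by (intro mult_right_mono C t) auto
    finally show ?thesis by (simp add: mult_ac)
  qed
  then show ?thesis using that[of "C * norm (G x)"] C(1) by simp
qed

end

section \<open>The regulator equations\<close>

context bounded_c0_semigroup
begin

text \<open>In the variation of constants formula the semigroup runs backwards, \<open>T(t - r)\<close>, and acts on a moving
  vector.\<close>

lemma tendsto_T_reverse:
  assumes s: "s \<in> {0..t}" and q: "(q \<longlongrightarrow> y) (at s within {0..t})"
  shows "((\<lambda>r. T (t - r) (q r)) \<longlongrightarrow> T (t - s) y) (at s within {0..t})"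
proof -
  have "((\<lambda>r. \<bar>K\<bar> * norm (q r - y)) \<longlongrightarrow> \<bar>K\<bar> * norm (y - y)) (at s within {0..t})"
    by (intro tendsto_intros q)
  then have lim: "((\<lambda>r. \<bar>K\<bar> * norm (q r - y)) \<longlongrightarrow> 0) (at s within {0..t})" by simp
  have "norm (T (t - r) (q r - y)) \<le> \<bar>K\<bar> * norm (q r - y)" if "r \<in> {0..t}" for r
    by (rule order_trans[OF bound]) (use that in \<open>auto intro: mult_right_mono\<close>)
  then have "\<forall>\<^sub>F r in at s within {0..t}. norm (T (t - r) (q r - y)) \<le> \<bar>K\<bar> * norm (q r - y)"
    by (auto simp: eventually_at_filter intro!: always_eventually)
  then have 1: "((\<lambda>r. T (t - r) (q r - y)) \<longlongrightarrow> 0) (at s within {0..t})"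
    by (rule Lim_null_comparison[OF _ lim])
  have "continuous_on {0..t} (\<lambda>r. T (t - r) y)"
    by (rule continuous_on_compose2[OF continuous_T]) (auto intro!: continuous_intros)
  then have 2: "((\<lambda>r. T (t - r) y) \<longlongrightarrow> T (t - s) y) (at s within {0..t})"
    using s by (simp add: continuous_on_def)
  have "((\<lambda>r. T (t - r) (q r - y) + T (t - r) y) \<longlongrightarrow> 0 + T (t - s) y) (at s within {0..t})"
    by (rule tendsto_add[OF 1 2])
  moreover have "\<forall>\<^sub>F r in at s within {0..t}. T (t - r) (q r - y) + T (t - r) y = T (t - r) (q r)"
    by (auto simp: eventually_at_filter T_diff intro!: always_eventually)
  ultimately show ?thesis by (simp add: Lim_transform_eventually)
qed

lemma continuous_T_reverse:
  assumes "continuous_on {0..t} g"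
  shows "continuous_on {0..t} (\<lambda>r. T (t - r) (g r))"
  using assms tendsto_T_reverse by (simp add: continuous_on_def)

text \<open>The product rule for a strongly continuous semigroup, with the minus sign from the reversed time.\<close>

lemma deriv_T_reverse:
  assumes s: "s \<in> {0..t}" and y: "(y has_vector_derivative y') (at s within {0..t})" and D: "y s \<in> D"
  shows "((\<lambda>r. T (t - r) (y r)) has_vector_derivative T (t - s) (y' - G (y s))) (at s within {0..t})"
proof -
  have "((\<lambda>r. T r (y s)) \<circ> (\<lambda>r. t - r) has_vector_derivative (- 1) *\<^sub>R T (t - s) (G (y s))) (at s within {0..t})"
  proof (rule vector_diff_chain_within)
    show "((\<lambda>r. t - r) has_vector_derivative - 1) (at s within {0..t})"
      by (auto intro!: derivative_eq_intros)
    show "((\<lambda>r. T r (y s)) has_vector_derivative T (t - s) (G (y s))) (at (t - s) within (\<lambda>r. t - r) ` {0..t})"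
      by (rule has_vector_derivative_within_subset[OF deriv_T[OF _ D]]) (use s in auto)
  qed
  then have "((\<lambda>r. (T (t - r) (y s) - T (t - s) (y s)) /\<^sub>R (r - s)) \<longlongrightarrow> - T (t - s) (G (y s))) (at s within {0..t})"
    by (simp add: has_vector_derivative_iff_quotient)
  moreover have "((\<lambda>r. T (t - r) ((y r - y s) /\<^sub>R (r - s))) \<longlongrightarrow> T (t - s) y') (at s within {0..t})"
    using y by (intro tendsto_T_reverse s) (simp add: has_vector_derivative_iff_quotient)
  ultimately have lim: "((\<lambda>r. T (t - r) ((y r - y s) /\<^sub>R (r - s)) + (T (t - r) (y s) - T (t - s) (y s)) /\<^sub>R (r - s))
      \<longlongrightarrow> T (t - s) y' + - T (t - s) (G (y s))) (at s within {0..t})"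
    by (intro tendsto_add)
  have eq: "T (t - s) y' + - T (t - s) (G (y s)) = T (t - s) (y' - G (y s))"
    using s by (simp add: T_diff)
  have ev: "\<forall>\<^sub>F r in at s within {0..t}.
      T (t - r) ((y r - y s) /\<^sub>R (r - s)) + (T (t - r) (y s) - T (t - s) (y s)) /\<^sub>R (r - s)
      = (T (t - r) (y r) - T (t - s) (y s)) /\<^sub>R (r - s)"
    by (auto simp: eventually_at_filter T_diff T_scaleR algebra_simps intro!: always_eventually)
  show ?thesis
    unfolding has_vector_derivative_iff_quotient using Lim_transform_eventually[OF lim ev] eq by simp
qed

end

text \<open>Right difference quotients already determine the generator of an isometric group: for \<open>h < 0\<close> the quotient
  at \<open>h\<close> is \<open>T(h)\<close> applied to the quotient at \<open>-h\<close>.\<close>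

lemma isometric_group_bounded_c0_semigroup:
  assumes gen: "generates_group D S T" and iso: "isometric_group T"
  shows "bounded_c0_semigroup D S T 1"
proof
  have grp: "c0_group T"
    and D: "D = {x. \<exists>y. ((\<lambda>h. (T h x - x) /\<^sub>R h) \<longlongrightarrow> y) (at 0)}"
    and S: "\<And>x. x \<in> D \<Longrightarrow> ((\<lambda>h. (T h x - x) /\<^sub>R h) \<longlongrightarrow> S x) (at 0)"
    using gen by (auto simp: generates_group_def)
  have lin: "bounded_linear (T t)" for t
    using grp by (auto simp: c0_group_def bounded_clinear_def)
  have T_inv: "T h (T (- h) x) = x" for h x
    using grp by (simp add: c0_group_def) (metis add.right_inverse comp_apply id_apply)
  have at0: "((\<lambda>h. (T h x - x) /\<^sub>R h) \<longlongrightarrow> y) (at 0)"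
    if y: "((\<lambda>h. (T h x - x) /\<^sub>R h) \<longlongrightarrow> y) (at_right 0)" for x y
  proof (rule filterlim_split_at_real)
    have lim: "((\<lambda>h. T h x) \<longlongrightarrow> x) (at_left 0)" for x
      using grp by (auto simp: c0_group_def intro: tendsto_within_subset)
    have "filterlim uminus (at_right 0) (at_left (0::real))"
      by (simp add: at_left_minus filterlim_filtermap filterlim_ident)
    from filterlim_compose[OF y this]
    have q: "((\<lambda>h. (T (- h) x - x) /\<^sub>R (- h)) \<longlongrightarrow> y) (at_left 0)" .
    have "((\<lambda>h. norm ((T (- h) x - x) /\<^sub>R (- h) - y)) \<longlongrightarrow> 0) (at_left 0)"
      using tendsto_norm[OF LIM_zero[OF q]] by simp
    then have "((\<lambda>h. norm (T h ((T (- h) x - x) /\<^sub>R (- h) - y))) \<longlongrightarrow> 0) (at_left 0)"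
      using iso by (simp only: isometric_group_def)
    then have "((\<lambda>h. T h ((T (- h) x - x) /\<^sub>R (- h) - y) + T h y) \<longlongrightarrow> 0 + y) (at_left 0)"
      by (intro tendsto_add lim) (rule tendsto_norm_zero_cancel)
    moreover have "T h ((T (- h) x - x) /\<^sub>R (- h) - y) + T h y = (T h x - x) /\<^sub>R h" for h
      using T_inv[of h x]
      by (simp add: linear_diff[OF bounded_linear.linear[OF lin]] linear_scale[OF bounded_linear.linear[OF lin]]
          linear_neg[OF bounded_linear.linear[OF lin]] scaleR_diff_right)
    ultimately show "((\<lambda>h. (T h x - x) /\<^sub>R h) \<longlongrightarrow> y) (at_left 0)" by simp
  qed (rule y)
  show "generates_semigroup D S T"
    unfolding generates_semigroup_def
  proof (intro conjI ballI)
    show "c0_semigroup T"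
      using grp by (auto simp: c0_group_def c0_semigroup_def intro: tendsto_within_subset)
    show "((\<lambda>h. (T h x - x) /\<^sub>R h) \<longlongrightarrow> S x) (at_right 0)" if "x \<in> D" for x
      using S[OF that] by (rule tendsto_within_subset) simp
    then show "D = {x. \<exists>y. ((\<lambda>h. (T h x - x) /\<^sub>R h) \<longlongrightarrow> y) (at_right 0)}"
      using at0 unfolding D by blast
  qed
  show "norm (T t x) \<le> 1 * norm x" for t x
    using iso by (simp add: isometric_group_def)
qed

text \<open>For \<open>w\<close> in the domain of \<open>S\<close>, the equation identifies \<open>T(t - s) f(T\<^sub>S(s) w)\<close> with the derivative of
  \<open>T(t - s) \<Pi> T\<^sub>S(s) w\<close> in \<open>s\<close>, which is integrated from \<open>0\<close> to \<open>t\<close>. Both sides of the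
  result are bounded operators in \<open>w\<close>, and the domain is dense.\<close>

lemma mild_solution_regulator:
  assumes T: "bounded_c0_semigroup D G T K" and TS: "bounded_c0_semigroup DS S TS K'"
    and Pi0: "bounded_linear Pi0" and f: "bounded_linear f"
    and PiD: "Pi0 ` DS \<subseteq> D"
    and eq: "\<And>w. w \<in> DS \<Longrightarrow> G (Pi0 w) + f w = Pi0 (S w)"
    and t: "t \<ge> 0"
  shows "mild_solution T (\<lambda>s. f (TS s w)) z t = T t (z - Pi0 w) + Pi0 (TS t w)"
proof -
  interpret T: bounded_c0_semigroup D G T K by (rule T)
  interpret TS: bounded_c0_semigroup DS S TS K' by (rule TS)
  let ?I = "\<lambda>w. integral {0..t} (\<lambda>s. T (t - s) (f (TS s w)))"
  have cont: "continuous_on {0..t} (\<lambda>s. T (t - s) (f (TS s w)))" for w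
    by (intro T.continuous_T_reverse bounded_linear.continuous_on[OF f]
        continuous_on_subset[OF TS.continuous_T]) auto
  note int = integrable_continuous_interval[OF cont]
  have I: "?I w = Pi0 (TS t w) - T t (Pi0 w)" if w: "w \<in> DS" for w
  proof -
    have "((\<lambda>s. T (t - s) (f (TS s w))) has_integral T (t - t) (Pi0 (TS t w)) - T (t - 0) (Pi0 (TS 0 w))) {0..t}"
    proof (rule fundamental_theorem_of_calculus[OF t])
      fix s assume s: "s \<in> {0..t}"
      have w': "TS s w \<in> DS" "S (TS s w) = TS s (S w)"
        using TS.T_in_D[of s w] s w by auto
      have "((\<lambda>s. Pi0 (TS s w)) has_vector_derivative Pi0 (TS s (S w))) (at s within {0..t})"
        by (rule bounded_linear.has_vector_derivative[OF Pi0])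
           (rule has_vector_derivative_within_subset[OF TS.deriv_T], use s w in auto)
      from T.deriv_T_reverse[OF s this] w' PiD
      have "((\<lambda>r. T (t - r) (Pi0 (TS r w))) has_vector_derivative
          T (t - s) (Pi0 (TS s (S w)) - G (Pi0 (TS s w)))) (at s within {0..t})" by blast
      moreover have "Pi0 (TS s (S w)) - G (Pi0 (TS s w)) = f (TS s w)"
        using eq[OF w'(1)] w'(2) by (simp add: algebra_simps)
      ultimately show "((\<lambda>r. T (t - r) (Pi0 (TS r w))) has_vector_derivative T (t - s) (f (TS s w))) (at s within {0..t})"
        by simp
    qed
    then show ?thesis by (simp add: has_integral_iff)
  qed
  have I_linear: "bounded_linear ?I"
  proof -
    obtain B where B: "B > 0" "\<And>w. norm (f w) \<le> norm w * B"
      using bounded_linear.pos_bounded[OF f] by blast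
    show ?thesis
    proof (rule bounded_linear_intro[of _ "\<bar>K\<bar> * B * \<bar>K'\<bar> * t"])
      fix v w :: 'b and r :: real
      have "?I (v + w) = integral {0..t} (\<lambda>s. T (t - s) (f (TS s v)) + T (t - s) (f (TS s w)))"
        by (rule integral_cong) (simp add: TS.T_sum T.T_sum linear_add[OF bounded_linear.linear[OF f]])
      then show "?I (v + w) = ?I v + ?I w" by (simp add: integral_add int)
      have "?I (r *\<^sub>R w) = integral {0..t} (\<lambda>s. r *\<^sub>R T (t - s) (f (TS s w)))"
        by (rule integral_cong) (simp add: TS.T_scaleR T.T_scaleR linear_scale[OF bounded_linear.linear[OF f]])
      then show "?I (r *\<^sub>R w) = r *\<^sub>R ?I w" by simp
      have "norm (?I w) \<le> (\<bar>K\<bar> * (\<bar>K'\<bar> * norm w * B)) * (t - 0)"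
      proof (rule integral_bound[OF t cont])
        fix s assume s: "s \<in> {0..t}"
        have "norm (TS s w) \<le> \<bar>K'\<bar> * norm w"
          by (rule order_trans[OF TS.bound]) (use s in \<open>auto intro: mult_right_mono\<close>)
        then have "norm (f (TS s w)) \<le> \<bar>K'\<bar> * norm w * B"
          using B(1) by (intro order_trans[OF B(2)] mult_right_mono) auto
        moreover have "norm (T (t - s) (f (TS s w))) \<le> \<bar>K\<bar> * norm (f (TS s w))"
          by (rule order_trans[OF T.bound]) (use s in \<open>auto intro: mult_right_mono\<close>)
        ultimately show "norm (T (t - s) (f (TS s w))) \<le> \<bar>K\<bar> * (\<bar>K'\<bar> * norm w * B)"
          by (meson abs_ge_zero mult_left_mono order_trans)
      qed
      then show "norm (?I w) \<le> norm w * (\<bar>K\<bar> * B * \<bar>K'\<bar> * t)" by (simp add: mult_ac)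
    qed
  qed
  have lin: "bounded_linear (\<lambda>w. Pi0 (TS t w) - T t (Pi0 w))"
    by (intro bounded_linear_sub bounded_linear_compose[OF Pi0 TS.T_linear[OF t]]
        bounded_linear_compose[OF T.T_linear[OF t] Pi0])
  have "closure DS \<subseteq> {w. ?I w = Pi0 (TS t w) - T t (Pi0 w)}"
  proof (rule closure_minimal)
    show "closed {w. ?I w = Pi0 (TS t w) - T t (Pi0 w)}"
      by (intro closed_Collect_eq linear_continuous_on I_linear lin)
  qed (use I in auto)
  then have "?I w = Pi0 (TS t w) - T t (Pi0 w)"
    using TS.dense_domain by auto
  then show ?thesis
    using t by (simp add: mild_solution_def T.T_diff)
qed

theorem theorem3p2:
  fixes A :: "'z::complex_banach \<Rightarrow> 'z" and DA :: "'z set" and TA :: "real \<Rightarrow> 'z \<Rightarrow> 'z"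
    and B :: "'u::complex_banach \<Rightarrow> 'z" and C :: "'z \<Rightarrow> 'y::complex_banach"
    and S :: "'w::complex_banach \<Rightarrow> 'w" and DS :: "'w set" and TS :: "real \<Rightarrow> 'w \<Rightarrow> 'w"
    and P :: "'w \<Rightarrow> 'z" and Q :: "'w \<Rightarrow> 'y"
    and K :: "'z \<Rightarrow> 'u" and TAK :: "real \<Rightarrow> 'z \<Rightarrow> 'z"
    and Pi0 :: "'w \<Rightarrow> 'z" and \<Gamma> :: "'w \<Rightarrow> 'u"
  assumes "generates_semigroup DA A TA"
    and "bounded_clinear B" and "bounded_clinear C"
    and "generates_group DS S TS" and "isometric_group TS"
    and "bounded_clinear P" and "bounded_clinear Q"
    and "bounded_clinear K"
    and "generates_semigroup DA (\<lambda>z. A z + B (K z)) TAK"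
    and "bounded_semigroup TAK"
    and "polynomially_stable DA (\<lambda>z. A z + B (K z)) TAK"
    and "bounded_clinear Pi0" and "Pi0 ` DS \<subseteq> DA" and "bounded_clinear \<Gamma>"
    and "\<forall>w\<in>DS. A (Pi0 w) + B (\<Gamma> w) + P w = Pi0 (S w)"
    and "\<forall>w. C (Pi0 w) = Q w"
  shows "solves_SFRP DA A B C DS TS P Q K (\<lambda>w. \<Gamma> w - K (Pi0 w))"
proof -
  let ?G = "\<lambda>z. A z + B (K z)" and ?L = "\<lambda>w. \<Gamma> w - K (Pi0 w)"
  let ?e = "tracking_error TAK B C TS P Q ?L"
  note lin = bounded_clinear_imp_bounded_linear
  obtain M where M: "\<And>t. t \<ge> 0 \<Longrightarrow> onorm (TAK t) \<le> M"
    using assms(10) by (auto simp: bounded_semigroup_def)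
  interpret T: nonneg_bounded_c0_semigroup DA ?G TAK "\<bar>M\<bar>"
  proof
    show "norm (TAK t x) \<le> \<bar>M\<bar> * norm x" if t: "t \<ge> 0" for t x
    proof -
      have "bounded_linear (TAK t)"
        using assms(9) t by (auto simp: generates_semigroup_def c0_semigroup_def lin)
      moreover have "onorm (TAK t) \<le> \<bar>M\<bar>" using M[OF t] by simp
      ultimately show ?thesis
        by (meson mult_right_mono norm_ge_zero onorm order_trans)
    qed
  qed (use assms(9) in auto)
  have L: "bounded_clinear ?L"
  proof -
    have "linear (\<lambda>x::'u. c *\<^sub>C x)" for c
      by (rule bounded_linear.linear[OF bounded_linear_scaleC])
    then show ?thesis
      using assms(8,12,14) unfolding bounded_clinear_def
      by (auto intro!: bounded_linear_sub bounded_linear_compose[of K Pi0] simp: linear_diff)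
  qed
  have f: "bounded_linear (\<lambda>w. B (?L w) + P w)"
    using assms(2,6) L by (intro bounded_linear_add bounded_linear_compose[of B ?L] lin)
  have eq: "?G (Pi0 w) + (B (?L w) + P w) = Pi0 (S w)" if "w \<in> DS" for w
  proof -
    have "B (?L w) = B (\<Gamma> w) - B (K (Pi0 w))"
      by (rule linear_diff[OF bounded_linear.linear[OF lin[OF assms(2)]]])
    then show ?thesis
      using assms(15)[rule_format, OF that] by (simp add: algebra_simps)
  qed
  have e: "?e z0 w0 t = C (TAK t (z0 - Pi0 w0))" if t: "t \<ge> 0" for z0 w0 t
    unfolding tracking_error_def
    using mild_solution_regulator[OF T.bounded_c0_semigroup_axioms
        isometric_group_bounded_c0_semigroup[OF assms(4,5)] lin[OF assms(12)] f assms(13) eq t]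
      assms(16)
    by (simp add: linear_add[OF bounded_linear.linear[OF lin[OF assms(3)]]])
  have lim: "(?e z0 w0 \<longlongrightarrow> 0) at_top" for z0 w0
  proof (rule Lim_transform_eventually)
    show "((\<lambda>t. C (TAK t (z0 - Pi0 w0))) \<longlongrightarrow> 0) at_top"
      by (rule bounded_linear.tendsto_zero[OF lin[OF assms(3)]])
         (rule T.polynomially_stable_tendsto_zero[OF assms(11)])
    show "\<forall>\<^sub>F t in at_top. C (TAK t (z0 - Pi0 w0)) = ?e z0 w0 t"
      using eventually_ge_at_top[of 0] by eventually_elim (simp add: e)
  qed
  have rate: "\<exists>m>0. \<forall>t>0. norm (?e z0 w0 t) \<le> m * t powr (- 1 / \<alpha>)"
    if \<alpha>: "decay_exponent DA ?G TAK \<alpha>" and z0: "z0 \<in> DA" and w0: "w0 \<in> DS" for \<alpha> z0 w0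
  proof -
    have "z0 - Pi0 w0 \<in> DA" using T.generator_diff(1) z0 w0 assms(13) by blast
    then obtain m where m: "m \<ge> 0" "\<And>t. t > 0 \<Longrightarrow> norm (TAK t (z0 - Pi0 w0)) \<le> m * t powr (- 1 / \<alpha>)"
      using T.decay_rate_on_domain[OF \<alpha>] by blast
    obtain c where c: "c > 0" "\<And>x. norm (C x) \<le> norm x * c"
      using bounded_linear.pos_bounded[OF lin[OF assms(3)]] by blast
    have "norm (?e z0 w0 t) \<le> (m * c + 1) * t powr (- 1 / \<alpha>)" if t: "t > 0" for t
    proof -
      have "norm (?e z0 w0 t) \<le> (m * t powr (- 1 / \<alpha>)) * c"
        unfolding e[OF less_imp_le[OF t]]
        by (rule order_trans[OF c(2) mult_right_mono[OF m(2)[OF t]]]) (use c in simp)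
      also have "\<dots> \<le> (m * c + 1) * t powr (- 1 / \<alpha>)"
        by (simp add: algebra_simps)
      finally show ?thesis .
    qed
    moreover have "m * c + 1 > 0" using m(1) c(1) by (simp add: add_nonneg_pos)
    ultimately show ?thesis by blast
  qed
  show ?thesis
    unfolding solves_SFRP_def
  proof (intro conjI exI[of _ TAK])
    show "\<exists>\<alpha>. decay_exponent DA ?G TAK \<alpha>"
      by (rule T.polynomially_stable_decay_exponent[OF assms(11)])
    show "\<forall>z0 w0. (?e z0 w0 \<longlongrightarrow> 0) at_top"
      by (intro allI lim)
    show "\<forall>\<alpha>. decay_exponent DA ?G TAK \<alpha> \<longrightarrow> (\<forall>z0\<in>DA. \<forall>w0\<in>DS. \<exists>m>0. \<forall>t>0.
        norm (?e z0 w0 t) \<le> m * t powr (- 1 / \<alpha>))"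
      by (intro allI impI ballI rate)
  qed (rule assms(8) L assms(9-11))+
qed

end
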